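(* Let $(S_k,\,k\ge0)$, $S_0=0$, be a random walk with i.i.d. increments of density $\frac12e^{-|x|}$, let $\tau^-:=\inf\{k\ge 1:S_k<0\}$, $\nu:=\tau^--1$, and let $0=M_0<M_1<\cdots<M_\nu$ be the order statistics of $\{S_0,S_1,\ldots,S_\nu\}$. Then $\{M_0,\ldots,M_\nu\}$ has the same joint distribution as if it were constructed as follows: $M_0=0$ and, for $k=1,2,\ldots$, $M_k$ is the time of the $k^{th}$ death in the critical binary birth and death process $(Z(t),\,t\ge0)$, that is $$M_k:=\text{the }k^{th}\ t>0\text{ such that } Z(t)-Z(t-)=-1,$$ with $Z(0)$ having the geometric$(1/2)$ distribution on $\{0,1,\ldots\}$, i.e. $\mathbb{P}(Z(0)=n)=2^{-n-1}$ for $n\ge0$. (Here $\nu$ corresponds to the total number of deaths.) Consequently, $$\mathbb{P}(M_\nu>t)=\frac1{2+t}\qquad\text{for } t>0.$$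
   Context: $(Z(t),\,t\ge0)$ is the number of individuals alive at time $t$ in a critical binary branching process: starting from $Z(0)$ individuals, each individual lives an exponential lifetime with mean $1/2$ and at its end, according to an independent fair coin toss, leaves either $0$ or $2$ children; all individuals evolve independently according to the same mechanism. Thus $Z$ is a birth and death process on $\{0,1,2,\ldots\}$ with transitions $j\to j+1$ at rate $j$ and $j\to j-1$ at rate $j$, absorbed at $0$; a "death" is a transition $j\to j-1$. *)

theory Defs
  imports "HOL-Probability.Probability"
begin

section \<open>The random walk up to its first strictly negative value\<close>

definition walk :: "(nat \<Rightarrow> 'a \<Rightarrow> real) \<Rightarrow> nat \<Rightarrow> 'a \<Rightarrow> real" where
  "walk X k \<omega> = (\<Sum>i<k. X i \<omega>)"

definition tau_minus :: "(nat \<Rightarrow> 'a \<Rightarrow> real) \<Rightarrow> 'a \<Rightarrow> enat" where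
  "tau_minus X \<omega> = Inf (enat ` {k. 1 \<le> k \<and> walk X k \<omega> < 0})"

definition nu :: "(nat \<Rightarrow> 'a \<Rightarrow> real) \<Rightarrow> 'a \<Rightarrow> enat" where
  "nu X \<omega> = tau_minus X \<omega> - 1"

text \<open>Meaningful for \<open>nu X \<omega> < \<infinity>\<close> and \<open>k \<le> nu X \<omega>\<close>.\<close>

definition order_stat :: "(nat \<Rightarrow> 'a \<Rightarrow> real) \<Rightarrow> nat \<Rightarrow> 'a \<Rightarrow> real" where
  "order_stat X k \<omega> = sort (map (\<lambda>j. walk X j \<omega>) [0..<Suc (the_enat (nu X \<omega>))]) ! k"

section \<open>The critical binary branching process\<close>

text \<open>
  Ulam--Harris labels: \<open>(i, w)\<close> is the descendant of the initial individual number \<open>i\<close>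
  (counted from \<open>0\<close>) reached by choosing, in each generation, the child given by the next
  entry of \<open>w\<close>. Every label \<open>u\<close> carries a lifetime \<open>L u\<close> and a coin \<open>C u\<close>, where
  \<open>True\<close> means two children and \<open>False\<close> none; those of labels that are never born
  play no role.
\<close>

type_synonym label = "nat \<times> bool list"

datatype source = Initial | Lifetime label | Coin label

text \<open>
  Independence of variables with values in different types is expressed after embedding
  their values injectively into the reals.
\<close>

locale critical_binary_branching = prob_space N
  for N :: "'b measure" +
  fixes Z0 :: "'b \<Rightarrow> nat"
    and L :: "label \<Rightarrow> 'b \<Rightarrow> real"
    and C :: "label \<Rightarrow> 'b \<Rightarrow> bool"
  assumes Z0_measurable: "Z0 \<in> measurable N (count_space UNIV)"
    and lifetime: "\<And>u. distributed N lborel (L u) (exponential_density 2)"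
    and coin_measurable: "\<And>u. C u \<in> measurable N (count_space UNIV)"
    and coin_fair: "\<And>u. prob {\<omega> \<in> space N. C u \<omega>} = 1 / 2"
    and independent: "indep_vars (\<lambda>_. borel)
      (\<lambda>s \<omega>. case s of Initial \<Rightarrow> real (Z0 \<omega>) | Lifetime u \<Rightarrow> L u \<omega> | Coin u \<Rightarrow> of_bool (C u \<omega>))
      UNIV"

fun is_born :: "('b \<Rightarrow> nat) \<Rightarrow> (label \<Rightarrow> 'b \<Rightarrow> bool) \<Rightarrow> 'b \<Rightarrow> label \<Rightarrow> bool" where
  "is_born Z0 C \<omega> (i, w) \<longleftrightarrow> i < Z0 \<omega> \<and> (\<forall>j<length w. C (i, take j w) \<omega>)"

fun birth_time :: "(label \<Rightarrow> 'b \<Rightarrow> real) \<Rightarrow> 'b \<Rightarrow> label \<Rightarrow> real" where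
  "birth_time L \<omega> (i, w) = (\<Sum>j<length w. L (i, take j w) \<omega>)"

text \<open>
  The population may be infinite only on a null set, on which \<open>card\<close> returns \<open>0\<close>.
\<close>

definition population ::
  "('b \<Rightarrow> nat) \<Rightarrow> (label \<Rightarrow> 'b \<Rightarrow> real) \<Rightarrow> (label \<Rightarrow> 'b \<Rightarrow> bool) \<Rightarrow> 'b \<Rightarrow> real \<Rightarrow> nat" where
  "population Z0 L C \<omega> t =
     card {u. is_born Z0 C \<omega> u \<and> birth_time L \<omega> u \<le> t \<and> t < birth_time L \<omega> u + L u \<omega>}"

section \<open>Deaths along a path\<close>

definition deaths :: "(real \<Rightarrow> nat) \<Rightarrow> real set" where
  "deaths z = {t. 0 < t \<and>
     (\<exists>l. ((\<lambda>s. real (z s)) \<longlongrightarrow> l) (at_left t) \<and> real (z t) - l = -1)}"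

definition num_deaths :: "(real \<Rightarrow> nat) \<Rightarrow> enat" where
  "num_deaths z = (if finite (deaths z) then enat (card (deaths z)) else \<infinity>)"

text \<open>
  For \<open>k \<ge> 1\<close> this is the element of \<open>deaths z\<close> with exactly \<open>k\<close> deaths up to and including
  it, meaningful if there are at least \<open>k\<close> deaths; the value at \<open>0\<close> is the convention
  \<open>M\<^sub>0 = 0\<close>.
\<close>

definition death_time :: "(real \<Rightarrow> nat) \<Rightarrow> nat \<Rightarrow> real" where
  "death_time z k =
     (if k = 0 then 0 else THE t. t \<in> deaths z \<and> card {s \<in> deaths z. s \<le> t} = k)"

text \<open>
  Equality of the laws of two random finite sequences
  \<open>(U\<^sub>0, \<dots>, U\<^sub>m)\<close> and \<open>(V\<^sub>0, \<dots>, V\<^sub>n)\<close> with random last indices \<open>m\<close> and \<open>n\<close>. The completions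
  matter because path functionals need only be measurable up to null sets; membership of the
  events in the completed sigma-algebras is part of the definition.
\<close>

definition same_finite_sequence_law ::
  "'a measure \<Rightarrow> ('a \<Rightarrow> enat) \<Rightarrow> (nat \<Rightarrow> 'a \<Rightarrow> real) \<Rightarrow>
   'b measure \<Rightarrow> ('b \<Rightarrow> enat) \<Rightarrow> (nat \<Rightarrow> 'b \<Rightarrow> real) \<Rightarrow> bool" where
  "same_finite_sequence_law M m U N n V \<longleftrightarrow>
     (AE \<omega> in M. m \<omega> < \<infinity>) \<and> (AE \<omega> in N. n \<omega> < \<infinity>) \<and>
     (\<forall>r. \<forall>A \<in> sets (\<Pi>\<^sub>M k\<in>{0..r}. borel).
        let E = {\<omega> \<in> space M. m \<omega> = enat r \<and> (\<lambda>k\<in>{0..r}. U k \<omega>) \<in> A};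
            F = {\<omega> \<in> space N. n \<omega> = enat r \<and> (\<lambda>k\<in>{0..r}. V k \<omega>) \<in> A}
        in E \<in> sets (completion M) \<and> F \<in> sets (completion N) \<and>
           measure (completion M) E = measure (completion N) F)"

end

theory Submission
  imports Defs
begin

text \<open>
  Both random finite sets, the positive values of the walk before it becomes negative and the set
  of death times, have the same multiplicative functional
  \<open>E (\<Prod>x. \<phi> x)\<close> for enough functions \<open>\<phi>\<close>, namely \<open>1 / (2 - p 0)\<close>, where \<open>p t\<close> is the functional of the
  progeny of one individual born at time \<open>t\<close>. Conditioning on the first lifetime and coin gives
  the Riccati equation \<open>p' = 2 p - \<phi> - p\<^sup>2\<close>, and the geometric number of ancestors gives \<open>1 / (2 - p 0)\<close>.
  For the walk started at \<open>x\<close> the functional \<open>V x\<close> solves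
  \<open>V x = exp (- x) / 2 + (\<integral>y\<ge>0. exp (- \<bar>y - x\<bar>) / 2 * \<phi> y * V y)\<close>. The kernel is the Green function of
  \<open>1 - d\<^sup>2/dx\<^sup>2\<close>, so \<open>V'' = (1 - \<phi>) V\<close>, whose decaying solution has logarithmic derivative \<open>p - 1\<close> by the
  Riccati equation; the boundary condition at \<open>0\<close> then yields \<open>V 0 = 1 / (2 - p 0)\<close>.
\<close>

section \<open>The Riccati equation and the boundary value problem\<close>

text \<open>No second derivative is ever taken. As \<phi> may jump at finitely many points, \<psi> -
  \<psi>'' = \<phi> \<psi> enters in integrated form, through two antiderivatives of Wronskian type
  that are continuous across the jumps. The equation for V ceases to be a contraction when sup
  \<phi> = 1, hence the scaling of \<phi> by \<theta> < 1 and a passage to the limit. Both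
  functionals are set to 0 on bad outcomes: walks that never become negative, infinite families. At
  \<phi> = 1 criticality makes p the double root of c = (1 + c^2) / 2, so both means are 1 / (2 - 1)
  = 1. Almost sure finiteness of both sequences is thus a result of the computation; no separate
  recurrence or extinction argument is made. The walk functional is a product over indices and the
  family functional one over labels, whereas the theorem speaks of sets of reals; almost sure
  distinctness of sites and of end times bridges the two. "Enough" functions are step functions,
  which encode the numbers of points below finitely many thresholds. The single step at t gives an
  explicitly solvable Riccati equation and thereby the tail of the maximum.\<close>

definition laplace :: "real measure" where
  "laplace = density lborel (\<lambda>x. ennreal (1 / 2 * exp (- \<bar>x\<bar>)))"

text \<open>The left sides here and in the next lemma have the shape in which the product rule
  delivers the derivatives of \<open>e * s * (2 - p)\<close> with e' = e, and of
  \<open>- (e * s * p)\<close> with e' = - e, where s' = (p - 1) s and p' has its Riccati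
  value.\<close>

lemma riccati_lower_identity:
  "(e * s + (p - 1) * s * e) * (2 - p) + (0 - (2 * p - f - p\<^sup>2)) * (e * s) = e * (f * s)" for e s p f :: real
  by (simp add: algebra_simps power2_eq_square)

lemma riccati_upper_identity:
  "- ((e * - 1 * s + (p - 1) * s * e) * p + (2 * p - f - p\<^sup>2) * (e * s)) = e * (f * s)" for e s p f :: real
  by (simp add: algebra_simps power2_eq_square)

lemma nn_integral_exp_Iic: "(\<integral>\<^sup>+y. ennreal (exp y) * indicator {..<0} y \<partial>lborel) = 1"
proof -
  interpret prob_space "density lborel (exponential_density 1)"
    by (rule prob_space_exponential_density) simp
  have "(\<integral>\<^sup>+y. ennreal (exp y) * indicator {..<0} y \<partial>lborel) =
        (\<integral>\<^sup>+y. ennreal (exp (- y)) * indicator {..<0} (- y) \<partial>lborel)"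
    by (subst nn_integral_real_affine[where c="-1" and t=0]) auto
  also have "\<dots> = (\<integral>\<^sup>+y. ennreal (exponential_density 1 y) \<partial>lborel)"
    using AE_lborel_singleton[of 0]
    by (intro nn_integral_cong_AE) (auto simp: exponential_density_def elim!: eventually_mono split: split_indicator)
  also have "\<dots> = 1"
    using emeasure_space_1 by (simp add: emeasure_density)
  finally show ?thesis .
qed

lemma sets_laplace [measurable_cong, simp]: "sets laplace = sets borel"
  by (simp add: laplace_def)

lemma space_laplace [simp]: "space laplace = UNIV"
  by (simp add: laplace_def)

lemma prob_space_laplace: "prob_space laplace"
proof
  have exp_pos: "(\<integral>\<^sup>+x. ennreal (exp x) * indicator {..<0} (- x) \<partial>lborel) = (\<integral>\<^sup>+x. ennreal (exp x) * indicator {0<..} x \<partial>lborel)"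
    by (intro nn_integral_cong) (auto split: split_indicator)
  have "emeasure laplace (space laplace) = (\<integral>\<^sup>+x. ennreal (1 / 2 * exp (- \<bar>x\<bar>)) \<partial>lborel)"
    by (simp add: laplace_def emeasure_density)
  also have "\<dots> = (\<integral>\<^sup>+x. ennreal (1 / 2) * (ennreal (exp x) * indicator {..<0} x) +
       ennreal (1 / 2) * (ennreal (exp (- x)) * indicator {..<0} (- x)) \<partial>lborel)"
    using AE_lborel_singleton[of 0]
    by (intro nn_integral_cong_AE) (auto simp: divide_ennreal_def mult.commute simp flip: ennreal_divide_numeral elim!: eventually_mono split: split_indicator)
  also have "\<dots> = ennreal (1 / 2) * (\<integral>\<^sup>+x. ennreal (exp x) * indicator {..<0} x \<partial>lborel) +
       ennreal (1 / 2) * (\<integral>\<^sup>+x. ennreal (exp (- x)) * indicator {..<0} (- x) \<partial>lborel)"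
    by (subst nn_integral_add) (auto simp: nn_integral_cmult)
  also have "(\<integral>\<^sup>+x. ennreal (exp (- x)) * indicator {..<0} (- x) \<partial>lborel) = (\<integral>\<^sup>+x. ennreal (exp x) * indicator {..<0} x \<partial>lborel)"
    by (subst (2) nn_integral_real_affine[where c="-1" and t=0]) auto
  also have "ennreal (1 / 2) * (\<integral>\<^sup>+x. ennreal (exp x) * indicator {..<0} x \<partial>lborel) +
       ennreal (1 / 2) * (\<integral>\<^sup>+x. ennreal (exp x) * indicator {..<0} x \<partial>lborel) = 1"
    unfolding nn_integral_exp_Iic mult_1_right by (subst ennreal_plus[symmetric]) auto
  finally show "emeasure laplace (space laplace) = 1" .
qed

interpretation laplace: prob_space laplace by (rule prob_space_laplace)

lemma integral_laplace_shift:
  fixes h :: "real \<Rightarrow> real" assumes [measurable]: "h \<in> borel_measurable borel"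
  shows "(\<integral>s. h (x + s) \<partial>laplace) = (\<integral>y. 1 / 2 * exp (- \<bar>y - x\<bar>) * h y \<partial>lborel)"
proof -
  have "(\<integral>s. h (x + s) \<partial>laplace) = (\<integral>s. 1 / 2 * exp (- \<bar>s\<bar>) * h (x + s) \<partial>lborel)"
    unfolding laplace_def by (subst integral_density) auto
  also have "\<dots> = (\<integral>y. 1 / 2 * exp (- \<bar>y - x\<bar>) * h y \<partial>lborel)"
    by (subst (2) lborel_integral_real_affine[where c=1 and t=x]) auto
  finally show ?thesis .
qed

text \<open>The equation for \<open>p\<close> is kept in integral form, as conditioning delivers it;
  this form also encodes the behaviour at infinity. \<open>S\<close> collects the possible jumps of
  \<phi>, where \<open>p\<close> may fail to be differentiable.\<close>

locale riccati =
  fixes \<phi> p :: "real \<Rightarrow> real" and S :: "real set"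
  assumes \<phi>_measurable [measurable]: "\<phi> \<in> borel_measurable borel"
    and p_measurable [measurable]: "p \<in> borel_measurable borel"
    and \<phi>_nonneg: "\<And>x. 0 \<le> \<phi> x" and \<phi>_le_1: "\<And>x. \<phi> x \<le> 1"
    and p_nonneg: "\<And>x. 0 \<le> p x" and p_le_1: "\<And>x. p x \<le> 1"
    and finite_S: "finite S" and \<phi>_cont: "\<And>x. x \<notin> S \<Longrightarrow> isCont \<phi> x"
    and p_eq: "\<And>t. 0 \<le> t \<Longrightarrow> p t = (LINT s:{t<..}|lborel. exp (2 * (t - s)) * (\<phi> s + (p s)\<^sup>2))"
begin

section \<open>From the integral equation, with integrating factor exp (- 2 s), to the differential
  equation\<close>

definition g :: "real \<Rightarrow> real" where "g s = exp (- 2 * s) * (\<phi> s + (p s)\<^sup>2)"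

lemma g_measurable [measurable]: "g \<in> borel_measurable borel"
  unfolding g_def by measurable

lemma set_integrable_exp: "c > 0 \<Longrightarrow> set_integrable lborel {a::real..} (\<lambda>x. exp (- c * x))"
proof -
  assume c: "c > 0"
  have "(\<lambda>x. exp (- c * x)) absolutely_integrable_on {a..}"
    using integrable_on_exp_minus_to_infinity[OF c, of a]
    by (intro nonnegative_absolutely_integrable_1) auto
  thus ?thesis
    unfolding absolutely_integrable_on_def set_integrable_def
    by (subst (asm) integrable_completion) auto
qed

lemma set_integrable_g: "set_integrable lborel {a..} g"
proof (rule set_integrable_bound)
  show "set_integrable lborel {a..} (\<lambda>x. 2 * exp (- 2 * x))"
    using set_integrable_exp[of 2 a] by (simp add: set_integrable_mult_right)
  have "\<phi> x + (p x)\<^sup>2 \<le> 2" for x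
    using \<phi>_le_1[of x] p_le_1[of x] p_nonneg[of x] power_le_one[of "p x" 2] by linarith
  thus "AE x in lborel. x \<in> {a..} \<longrightarrow> norm (g x) \<le> norm (2 * exp (- 2 * x))"
    using \<phi>_nonneg by (auto simp: g_def abs_mult mult.commute)
qed (auto simp: set_borel_measurable_def)

lemma g_integrable_on: "g integrable_on {a..b}"
  using set_borel_integral_eq_integral(1)[OF set_integrable_subset[OF set_integrable_g[of a]], of "{a..b}"]
  by auto

text \<open>Total integral minus an initial piece replaces the tail, so that theorems on indefinite
  integrals give continuity of \<open>p\<close> and, off \<open>S\<close>, its derivative.\<close>

lemma p_eq_integral:
  assumes "0 \<le> t" shows "p t = exp (2 * t) * ((LINT s:{0..}|lborel. g s) - integral {0..t} g)"
proof -
  have i: "set_integrable lborel {0..t} g" "set_integrable lborel {t<..} g"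
    using assms by (auto intro!: set_integrable_subset[OF set_integrable_g[of 0]])
  have "(LINT s:{0..}|lborel. g s) = (LINT s:{0..t} \<union> {t<..}|lborel. g s)"
    using assms by (intro arg_cong[where f="\<lambda>A. set_lebesgue_integral lborel A g"]) auto
  also have "\<dots> = (LINT s:{0..t}|lborel. g s) + (LINT s:{t<..}|lborel. g s)"
    by (rule set_integral_Un) (use i in auto)
  finally have "(LINT s:{t<..}|lborel. g s) = (LINT s:{0..}|lborel. g s) - integral {0..t} g"
    using set_borel_integral_eq_integral(2)[OF i(1)] by simp
  moreover have "p t = exp (2 * t) * (LINT s:{t<..}|lborel. g s)"
    unfolding p_eq[OF assms] set_integral_mult_right[symmetric]
    by (rule set_lebesgue_integral_cong) (auto simp: g_def exp_diff exp_minus field_simps)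
  ultimately show ?thesis by simp
qed

lemma continuous_on_p: "continuous_on {0..T} p"
proof -
  have "continuous_on {0..T} (\<lambda>t. exp (2 * t) * ((LINT s:{0..}|lborel. g s) - integral {0..t} g))"
    by (intro continuous_intros indefinite_integral_continuous_1 g_integrable_on)
  thus ?thesis by (rule continuous_on_eq) (use p_eq_integral in auto)
qed

lemma isCont_p: "0 < t \<Longrightarrow> isCont p t"
  using continuous_on_interior[OF continuous_on_p[of "t + 1"], of t] by simp

lemma DERIV_p:
  assumes "0 < t" "t \<notin> S"
  shows "(p has_real_derivative 2 * p t - \<phi> t - (p t)\<^sup>2) (at t)"
proof -
  have op: "open ({0<..<t + 1} - S)" "t \<in> {0<..<t + 1} - S"
    using assms finite_S by (auto intro: open_Diff finite_imp_closed)
  have "isCont g t"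
    unfolding g_def using \<phi>_cont[OF assms(2)] isCont_p[OF assms(1)] by (intro continuous_intros) auto
  hence "((\<lambda>u. integral {0..u} g) has_vector_derivative g t) (at t within ({0..t + 1} - S))"
    using assms finite_S continuous_at_imp_continuous_at_within[of t g]
    by (intro integral_has_vector_derivative_continuous_at g_integrable_on) auto
  hence "((\<lambda>u. integral {0..u} g) has_vector_derivative g t) (at t within ({0<..<t + 1} - S))"
    by (rule has_vector_derivative_within_subset) force
  hence *: "((\<lambda>u. integral {0..u} g) has_real_derivative g t) (at t)"
    by (simp only: at_within_open[OF op(2,1)] has_real_derivative_iff_has_vector_derivative)
  let ?q = "\<lambda>t. exp (2 * t) * ((LINT s:{0..}|lborel. g s) - integral {0..t} g)"
  have "(?q has_real_derivative 2 * ?q t - exp (2 * t) * g t) (at t)"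
    using * by (auto intro!: derivative_eq_intros)
  moreover have "exp (2 * t) * g t = \<phi> t + (p t)\<^sup>2"
    by (simp add: g_def exp_minus)
  ultimately have "(?q has_real_derivative 2 * p t - \<phi> t - (p t)\<^sup>2) (at t)"
    using p_eq_integral[of t] assms by (simp add: diff_diff_eq)
  thus ?thesis
    by (rule has_field_derivative_transform_within_open[where S="{0<..}"])
       (use assms p_eq_integral in auto)
qed

text \<open>The candidate solution: \<psi>' = (p - 1) \<psi> and the Riccati equation give \<psi>''
  = (1 - \<phi>) \<psi> at positive points off \<open>S\<close>. For negative \<open>x\<close> the
  interval is empty and the value is 1.\<close>

definition \<psi> :: "real \<Rightarrow> real" where "\<psi> x = exp (integral {0..x} (\<lambda>y. p y - 1))"

lemma p1_integrable: "(\<lambda>y. p y - 1) integrable_on {0..T}"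
  by (intro integrable_continuous_real continuous_intros continuous_on_p)

lemma continuous_on_\<psi>: "continuous_on {0..T} \<psi>"
  unfolding \<psi>_def by (intro continuous_intros indefinite_integral_continuous_1 p1_integrable)

lemma DERIV_\<psi>: "0 < t \<Longrightarrow> (\<psi> has_real_derivative (p t - 1) * \<psi> t) (at t)"
proof -
  assume t: "0 < t"
  have "((\<lambda>x. integral {0..x} (\<lambda>y. p y - 1)) has_real_derivative p t - 1) (at t within {0..t + 1})"
    using t by (intro integral_has_real_derivative continuous_on_diff continuous_on_const continuous_on_p) auto
  hence "((\<lambda>x. integral {0..x} (\<lambda>y. p y - 1)) has_real_derivative p t - 1) (at t)"
    using t at_within_Icc_at[of 0 t "t + 1"] by simp
  from DERIV_fun_exp[OF this] show ?thesis unfolding \<psi>_def by (simp add: mult.commute)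
qed

lemma \<psi>_pos: "0 < \<psi> x" by (simp add: \<psi>_def)

lemma \<psi>_0: "\<psi> 0 = 1" by (simp add: \<psi>_def)

lemma \<psi>_le_1: "\<psi> x \<le> 1"
proof -
  have "integral {0..x} (\<lambda>y. p y - 1) \<le> integral {0..x} (\<lambda>y. 0)"
    by (rule integral_le[OF p1_integrable]) (use p_le_1 in auto)
  thus ?thesis by (simp add: \<psi>_def)
qed

lemma \<psi>_measurable_on: "(\<lambda>x. indicator {0..} x * \<psi> x) \<in> borel_measurable borel"
proof -
  have "continuous_on {0..} \<psi>"
    unfolding continuous_on_eq_continuous_within
  proof
    fix x :: real assume "x \<in> {0..}"
    hence "continuous (at x within {0..x+1}) \<psi>"
      using continuous_on_\<psi>[of "x + 1"] by (simp add: continuous_on_eq_continuous_within)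
    moreover have "at x within {0..x+1} = at x within {0..}"
      by (rule at_within_nhd[of x "{x-1<..<x+1}"]) (use \<open>x \<in> {0..}\<close> in auto)
    ultimately show "continuous (at x within {0..}) \<psi>" by simp
  qed
  thus ?thesis
    using borel_measurable_continuous_on_indicator[of "{0..}" \<psi>] by simp
qed

text \<open>The antiderivative \<open>exp y * \<psi> y * (2 - p y)\<close> is exp y (\<psi> -
  \<psi>'), whose derivative exp y (\<psi> - \<psi>'') is the integrand. It is continuous, so the
  finitely many points of \<open>S\<close> may be exempted from the derivative condition.\<close>

lemma int_lower:
  assumes "0 \<le> x"
  shows "((\<lambda>y. exp y * (\<phi> y * \<psi> y)) has_integral exp x * \<psi> x * (2 - p x) - (2 - p 0)) {0..x}"
proof -
  have "((\<lambda>y. exp y * (\<phi> y * \<psi> y)) has_integral exp x * \<psi> x * (2 - p x) - exp 0 * \<psi> 0 * (2 - p 0)) {0..x}"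
  proof (rule fundamental_theorem_of_calculus_interior_strong[OF finite_S assms, where f="\<lambda>y. exp y * \<psi> y * (2 - p y)"])
    fix y assume "y \<in> {0<..<x} - S"
    hence y: "0 < y" "y \<notin> S" by auto
    show "((\<lambda>y. exp y * \<psi> y * (2 - p y)) has_vector_derivative exp y * (\<phi> y * \<psi> y)) (at y)"
      unfolding has_real_derivative_iff_has_vector_derivative[symmetric]
      using DERIV_mult[OF DERIV_mult[OF DERIV_exp DERIV_\<psi>[OF y(1)]] DERIV_diff[OF DERIV_const DERIV_p[OF y], of 2]]
      by (rule DERIV_cong) (rule riccati_lower_identity)
  qed (intro continuous_intros continuous_on_\<psi> continuous_on_p)
  thus ?thesis by (simp add: \<psi>_0)
qed

text \<open>The mirror image: exp (- y) (\<psi> + \<psi>') = exp (- y) \<psi> p has derivative - exp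
  (- y) \<phi> \<psi>. The upper end stays finite here; its boundary term vanishes as
  \<open>b\<close> grows, since \<psi> and \<open>p\<close> are bounded by 1.\<close>

lemma int_upper:
  assumes "0 \<le> x" "x \<le> b"
  shows "((\<lambda>y. exp (- y) * (\<phi> y * \<psi> y)) has_integral exp (- x) * \<psi> x * p x - exp (- b) * \<psi> b * p b) {x..b}"
proof -
  define F where "F y = - (exp (- y) * \<psi> y * p y)" for y
  have F: "(F has_real_derivative exp (- y) * (\<phi> y * \<psi> y)) (at y)" if y: "0 < y" "y \<notin> S" for y
    unfolding F_def using DERIV_minus[OF DERIV_mult[OF DERIV_mult[OF
         DERIV_fun_exp[OF DERIV_minus[OF DERIV_ident]] DERIV_\<psi>[OF y(1)]] DERIV_p[OF y]]]
    by (rule DERIV_cong) (rule riccati_upper_identity)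
  have "continuous_on {0..b} F"
    unfolding F_def by (intro continuous_intros continuous_on_\<psi> continuous_on_p)
  hence "continuous_on {x..b} F"
    by (rule continuous_on_subset) (use assms in auto)
  hence "((\<lambda>y. exp (- y) * (\<phi> y * \<psi> y)) has_integral F b - F x) {x..b}"
    by (intro fundamental_theorem_of_calculus_interior_strong[OF finite_S assms(2)])
       (use F assms in \<open>auto simp flip: has_real_derivative_iff_has_vector_derivative\<close>)
  thus ?thesis by (simp add: F_def)
qed

lemma bound_\<phi>\<psi>: "\<bar>\<phi> y * \<psi> y\<bar> \<le> 1"
  using \<phi>_nonneg[of y] \<phi>_le_1[of y] \<psi>_pos[of y] \<psi>_le_1[of y]
  by (simp add: abs_mult mult_le_one)

lemma set_integrable_kernel:
  assumes A: "A \<in> sets borel" "A \<subseteq> {0..}"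
  shows "set_integrable lborel A (\<lambda>y. exp (- \<bar>y - x\<bar>) * (\<phi> y * \<psi> y))"
proof (rule set_integrable_subset)
  show "set_integrable lborel {0..} (\<lambda>y. exp (- \<bar>y - x\<bar>) * (\<phi> y * \<psi> y))"
  proof (rule set_integrable_bound)
    show "set_integrable lborel {0..} (\<lambda>y. exp x * exp (- 1 * y))"
      by (intro set_integrable_mult_right set_integrable_exp) auto
    have "(\<lambda>y. exp (- \<bar>y - x\<bar>) * (\<phi> y * (indicator {0..} y * \<psi> y))) \<in> borel_measurable borel"
      using \<psi>_measurable_on by measurable
    thus "set_borel_measurable lborel {0..} (\<lambda>y. exp (- \<bar>y - x\<bar>) * (\<phi> y * \<psi> y))"
      unfolding set_borel_measurable_def by (simp add: mult_ac)
    have "exp (- \<bar>y - x\<bar>) * \<bar>\<phi> y * \<psi> y\<bar> \<le> exp x * exp (- y) * 1" for y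
      by (intro mult_mono bound_\<phi>\<psi>) (auto simp: exp_add[symmetric])
    thus "AE y in lborel. y \<in> {0..} \<longrightarrow> norm (exp (- \<bar>y - x\<bar>) * (\<phi> y * \<psi> y)) \<le> norm (exp x * exp (- 1 * y))"
      by (auto simp: abs_mult)
  qed
qed (use A in auto)

text \<open>Splitting at \<open>x\<close> resolves the absolute value into the two exponentials
  above. The boundary terms at \<open>x\<close> add up to \<psi> x (2 - p x) + \<psi> x p x = 2
  \<psi> x; the one at 0 leaves the multiple of \<open>exp (- x)\<close>.\<close>

lemma kernel_integral:
  assumes x: "0 \<le> x"
  shows "(LINT y:{0..}|lborel. exp (- \<bar>y - x\<bar>) * (\<phi> y * \<psi> y)) = 2 * \<psi> x - exp (- x) * (2 - p 0)"
proof -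
  let ?f = "\<lambda>y. exp (- \<bar>y - x\<bar>) * (\<phi> y * \<psi> y)"
  have "(LINT y:{0..}|lborel. ?f y) = (LINT y:{0..<x} \<union> {x..}|lborel. ?f y)"
    using x by (intro arg_cong[where f="\<lambda>A. set_lebesgue_integral lborel A ?f"]) auto
  also have "\<dots> = (LINT y:{0..<x}|lborel. ?f y) + (LINT y:{x..}|lborel. ?f y)"
    by (rule set_integral_Un) (use x in \<open>auto intro!: set_integrable_kernel\<close>)
  also have "(LINT y:{0..<x}|lborel. ?f y) = (LINT y:{0..x}|lborel. ?f y)"
    unfolding set_lebesgue_integral_def
  proof (rule integral_cong_AE)
    show "AE y in lborel. indicator {0..<x} y *\<^sub>R ?f y = indicator {0..x} y *\<^sub>R ?f y"
      using AE_lborel_singleton[of x] by eventually_elim (auto simp: indicator_def)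
    show "(\<lambda>y. indicator {0..<x} y *\<^sub>R ?f y) \<in> borel_measurable lborel"
      by (rule borel_measurable_integrable, rule set_integrable_kernel[unfolded set_integrable_def]) auto
    show "(\<lambda>y. indicator {0..x} y *\<^sub>R ?f y) \<in> borel_measurable lborel"
      by (rule borel_measurable_integrable, rule set_integrable_kernel[unfolded set_integrable_def]) auto
  qed
  also have "\<dots> = integral {0..x} ?f"
    by (rule set_borel_integral_eq_integral) (rule set_integrable_kernel, auto)
  also have "\<dots> = integral {0..x} (\<lambda>y. exp (- x) * (exp y * (\<phi> y * \<psi> y)))"
    by (rule integral_cong) (auto simp: exp_diff exp_minus field_simps)
  also have "\<dots> = exp (- x) * (exp x * \<psi> x * (2 - p x) - (2 - p 0))"
    by (rule integral_unique, rule has_integral_mult_right, rule int_lower[OF x])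
  also have "(LINT y:{x..}|lborel. ?f y) = \<psi> x * p x"
  proof (rule tendsto_unique)
    show "((\<lambda>b. LINT y:{x..b}|lborel. ?f y) \<longlongrightarrow> (LINT y:{x..}|lborel. ?f y)) at_top"
      by (rule tendsto_set_lebesgue_integral_at_top) (use x in \<open>auto intro!: set_integrable_kernel\<close>)
    have eq: "(LINT y:{x..b}|lborel. ?f y) = \<psi> x * p x - exp x * (exp (- b) * (\<psi> b * p b))" if "x \<le> b" for b
    proof -
      have "(LINT y:{x..b}|lborel. ?f y) = integral {x..b} ?f"
        by (rule set_borel_integral_eq_integral) (rule set_integrable_kernel, use x in auto)
      also have "\<dots> = integral {x..b} (\<lambda>y. exp x * (exp (- y) * (\<phi> y * \<psi> y)))"
        by (rule integral_cong) (auto simp: exp_diff exp_minus field_simps)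
      also have "\<dots> = exp x * (exp (- x) * \<psi> x * p x - exp (- b) * \<psi> b * p b)"
        by (rule integral_unique, rule has_integral_mult_right, rule int_upper[OF x that])
      finally show ?thesis by (simp add: exp_minus_inverse right_diff_distrib mult.assoc[symmetric])
    qed
    have lim: "((\<lambda>b. \<psi> x * p x - exp x * (exp (- b) * (\<psi> b * p b))) \<longlongrightarrow> \<psi> x * p x - exp x * 0) at_top"
    proof (intro tendsto_diff tendsto_mult tendsto_const)
      have "((\<lambda>b::real. exp (- b)) \<longlongrightarrow> 0) at_top"
        by (rule filterlim_compose[OF exp_at_bot]) (rule filterlim_uminus_at_bot_at_top)
      thus "((\<lambda>b. exp (- b) * (\<psi> b * p b)) \<longlongrightarrow> 0) at_top"
      proof (rule Lim_null_comparison[rotated])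
        have "\<psi> b * p b \<le> 1" for b
          using \<psi>_pos[of b] \<psi>_le_1[of b] p_nonneg[of b] p_le_1[of b] by (simp add: mult_le_one)
        thus "\<forall>\<^sub>F b in at_top. norm (exp (- b) * (\<psi> b * p b)) \<le> exp (- b)"
          using \<psi>_pos p_nonneg less_imp_le[OF \<psi>_pos] by (auto simp: abs_mult)
      qed
    qed
    have "\<forall>\<^sub>F b in at_top. \<psi> x * p x - exp x * (exp (- b) * (\<psi> b * p b)) = (LINT y:{x..b}|lborel. ?f y)"
      using eventually_ge_at_top[of x] by eventually_elim (simp add: eq)
    from Lim_transform_eventually[OF lim this]
    show "((\<lambda>b. LINT y:{x..b}|lborel. ?f y) \<longlongrightarrow> \<psi> x * p x) at_top" by simp
  qed simp
  finally show ?thesis using x by (simp add: exp_minus field_simps)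
qed

text \<open>The step below 0 contributes \<open>exp (- x) / 2\<close>, and the factor \<kappa> is
  the one for which this cancels the \<open>exp (- x)\<close> term of the kernel integral.\<close>

lemma \<psi>_fixed_point:
  assumes x: "0 \<le> x"
  defines "\<kappa> \<equiv> 1 / (2 - p 0)"
  shows "(\<integral>s. (if x + s < 0 then 1 else \<phi> (x + s) * (\<kappa> * (indicator {0..} (x + s) * \<psi> (x + s)))) \<partial>laplace) = \<kappa> * \<psi> x"
proof -
  note [measurable] = \<psi>_measurable_on
  let ?h = "\<lambda>y. if y < 0 then 1 else \<phi> y * (\<kappa> * (indicator {0..} y * \<psi> y))"
  let ?l = "\<lambda>y. 1 / 2 * exp (- x) * (exp y * indicator {..<0} y) :: real"
  let ?r = "\<lambda>y. \<kappa> / 2 * (indicator {0..} y *\<^sub>R (exp (- \<bar>y - x\<bar>) * (\<phi> y * \<psi> y)))"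
  have l: "has_bochner_integral lborel (\<lambda>y. exp y * indicator {..<0} y) (1::real)"
    by (rule has_bochner_integral_nn_integral) (use nn_integral_exp_Iic in \<open>auto simp: ennreal_mult' ennreal_indicator\<close>)
  have r: "integrable lborel (\<lambda>y. indicator {0..} y *\<^sub>R (exp (- \<bar>y - x\<bar>) * (\<phi> y * \<psi> y)))"
    using set_integrable_kernel[of "{0..}" x] by (simp add: set_integrable_def)
  have "(\<integral>s. ?h (x + s) \<partial>laplace) = (\<integral>y. 1 / 2 * exp (- \<bar>y - x\<bar>) * ?h y \<partial>lborel)"
    by (rule integral_laplace_shift[of ?h]) measurable
  also have "\<dots> = (\<integral>y. ?l y + ?r y \<partial>lborel)"
    using x by (intro Bochner_Integration.integral_cong) (auto simp: indicator_def exp_diff exp_minus field_simps)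
  also have "\<dots> = (\<integral>y. ?l y \<partial>lborel) + (\<integral>y. ?r y \<partial>lborel)"
    using l r by (intro Bochner_Integration.integral_add integrable_mult_right) (auto simp: has_bochner_integral_iff)
  also have "\<dots> = 1 / 2 * exp (- x) + \<kappa> / 2 * (2 * \<psi> x - exp (- x) * (2 - p 0))"
    using l kernel_integral[OF x] unfolding set_lebesgue_integral_def
    by (simp only: integral_mult_right_zero has_bochner_integral_iff mult_1_right)
  also have "\<dots> = \<kappa> * \<psi> x"
    using p_le_1[of 0] by (simp add: \<kappa>_def field_simps)
  finally show ?thesis .
qed

text \<open>For \<open>\<phi> \<le> \<theta> < 1\<close> the equation for \<open>V\<close> is a contraction, so its bounded solution is unique.\<close>

lemma fixed_point_at_0:
  assumes \<theta>: "\<theta> < 1" "\<And>x. \<phi> x \<le> \<theta>"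
    and V [measurable]: "V \<in> borel_measurable borel" and V01: "\<And>x. 0 \<le> V x" "\<And>x. V x \<le> 1"
    and V_eq: "\<And>x. 0 \<le> x \<Longrightarrow> V x = (\<integral>s. (if x + s < 0 then 1 else \<phi> (x + s) * V (x + s)) \<partial>laplace)"
  shows "V 0 = 1 / (2 - p 0)"
proof -
  note [measurable] = \<psi>_measurable_on
  define \<kappa> where "\<kappa> = 1 / (2 - p 0)"
  \<comment> \<open>The cut-off makes \<open>U\<close> measurable on the whole line, since \<psi> is
    controlled on the nonnegative half-line only. Negative sites enter the equation only through the
    value 1.\<close>
  define U where "U x = \<kappa> * (indicator {0..} x * \<psi> x)" for x
  have \<kappa>: "0 \<le> \<kappa>" "\<kappa> \<le> 1" using p_le_1[of 0] by (auto simp: \<kappa>_def)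
  have [measurable]: "U \<in> borel_measurable borel" unfolding U_def by measurable
  have U01: "0 \<le> U x" "U x \<le> 1" for x
    using \<kappa> less_imp_le[OF \<psi>_pos[of x]] \<psi>_le_1[of x] by (auto simp: U_def indicator_def mult_le_one)
  have U_eq: "U x = (\<integral>s. (if x + s < 0 then 1 else \<phi> (x + s) * U (x + s)) \<partial>laplace)" if "0 \<le> x" for x
    unfolding U_def \<kappa>_def using \<psi>_fixed_point[OF that] that by simp
  have \<theta>0: "0 \<le> \<theta>" using \<phi>_nonneg[of 0] \<theta>(2)[of 0] by linarith
  have int: "integrable laplace (\<lambda>s. if x + s < 0 then 1 else \<phi> (x + s) * f (x + s))"
    if [measurable]: "f \<in> borel_measurable borel" and f: "\<And>x. 0 \<le> f x" "\<And>x. f x \<le> 1" for f x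
    by (rule laplace.integrable_const_bound[where B=1])
       (use f \<phi>_nonneg \<phi>_le_1 in \<open>auto simp: mult_le_one\<close>)
  have bound: "\<bar>V x - U x\<bar> \<le> \<theta> ^ n" if "0 \<le> x" for x n
    using that
  proof (induction n arbitrary: x)
    case 0
    show ?case using U01[of x] V01[of x] by auto
  next
    case (Suc n)
    have "V x - U x = (\<integral>s. (if x + s < 0 then 1 else \<phi> (x + s) * V (x + s)) -
        (if x + s < 0 then 1 else \<phi> (x + s) * U (x + s)) \<partial>laplace)"
      by (subst Bochner_Integration.integral_diff)
         (use V_eq U_eq Suc.prems in \<open>auto intro!: int U01 V01\<close>)
    also have "\<bar>\<dots>\<bar> \<le> (\<integral>s. \<theta> ^ Suc n \<partial>laplace)"
      unfolding real_norm_def[symmetric]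
    proof (rule Bochner_Integration.integral_norm_bound_integral)
      fix s
      \<comment> \<open>Below 0 the two integrands are both 1 and cancel, so the difference lives on
        nonnegative sites, where the induction hypothesis applies.\<close>
      have "\<phi> (x + s) * \<bar>V (x + s) - U (x + s)\<bar> \<le> \<theta> * \<theta> ^ n" if "\<not> x + s < 0"
        using that \<theta>0 by (intro mult_mono \<theta> Suc.IH) auto
      thus "norm ((if x + s < 0 then 1 else \<phi> (x + s) * V (x + s)) -
        (if x + s < 0 then 1 else \<phi> (x + s) * U (x + s))) \<le> \<theta> ^ Suc n"
        using \<theta>0 \<phi>_nonneg by (auto simp: abs_mult simp flip: right_diff_distrib)
    qed (auto intro!: int U01 V01)
    also have "\<dots> = \<theta> ^ Suc n"
      using laplace.prob_space by simp
    finally show ?case .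
  qed
  have "\<bar>V 0 - U 0\<bar> \<le> 0"
    by (rule LIMSEQ_le_const[OF LIMSEQ_power_zero]) (use \<theta> \<theta>0 bound[of 0] in auto)
  thus ?thesis by (simp add: U_def \<kappa>_def \<psi>_0)
qed

text \<open>Beyond \<open>T\<close> the source is switched off and \<open>p\<close> is 0; before
  \<open>T\<close> the equation is p' = - (1 - p)^2, so that 1 / (1 - p) decreases with slope 1 down
  to its value 1 at \<open>T\<close>.\<close>

lemma p_0_threshold:
  assumes T: "0 < T" and \<phi>: "\<phi> = indicator {..T}" and S: "S = {T}"
  shows "p 0 = T / (1 + T)"
proof -
  have exp_int: "(LINT s:{t..}|lborel. exp (2 * (t - s)) * c) = c / 2"
    and exp_integrable: "set_integrable lborel {t..} (\<lambda>s. exp (2 * (t - s)) * c)" for t c :: real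
  proof -
    have eq: "exp (2 * (t - s)) * c = exp (2 * t) * c * exp (- 2 * s)" for s
      by (simp add: exp_diff exp_minus field_simps)
    show *: "set_integrable lborel {t..} (\<lambda>s. exp (2 * (t - s)) * c)"
      unfolding eq by (intro set_integrable_mult_right set_integrable_exp) auto
    have "((\<lambda>s. exp (2 * t) * c * exp (- 2 * s)) has_integral exp (2 * t) * c * (exp (- 2 * t) / 2)) {t..}"
      by (intro has_integral_mult_right has_integral_exp_minus_to_infinity) auto
    from integral_unique[OF this] have "integral {t..} (\<lambda>s. exp (2 * t) * c * exp (- 2 * s)) = c / 2"
      by (simp only: mult.assoc) (simp add: field_simps exp_minus)
    thus "(LINT s:{t..}|lborel. exp (2 * (t - s)) * c) = c / 2"
      using set_borel_integral_eq_integral(2)[OF *] by (simp only: eq)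
  qed
  \<comment> \<open>Past \<open>T\<close> only the square is left under the integral. It is at most
    \<open>p\<close>, and the kernel has total mass 1/2, so every application of the integral
    equation halves the bound.\<close>
  have small: "p t \<le> (1 / 2) ^ n" if "T \<le> t" for t n
    using that
  proof (induction n arbitrary: t)
    case (Suc n)
    have "p t = (LINT s:{t<..}|lborel. exp (2 * (t - s)) * (\<phi> s + (p s)\<^sup>2))"
      using Suc.prems T by (intro p_eq) auto
    also have "\<dots> \<le> (LINT s:{t..}|lborel. exp (2 * (t - s)) * (1 / 2) ^ n)"
      unfolding set_lebesgue_integral_def
    proof (rule integral_mono_AE')
      show "integrable lborel (\<lambda>s. indicator {t..} s *\<^sub>R (exp (2 * (t - s)) * (1 / 2) ^ n))"
        using exp_integrable by (simp add: set_integrable_def)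
      have "(p s)\<^sup>2 \<le> (1 / 2) ^ n" if "t < s" for s
        using Suc.IH[of s] Suc.prems that p_nonneg[of s] p_le_1[of s]
          mult_left_le[of "p s" "p s"] by (simp add: power2_eq_square)
      thus "AE s in lborel. indicator {t<..} s *\<^sub>R (exp (2 * (t - s)) * (\<phi> s + (p s)\<^sup>2)) \<le>
          indicator {t..} s *\<^sub>R (exp (2 * (t - s)) * (1 / 2) ^ n)"
        using Suc.prems by (auto simp: \<phi> indicator_def)
    qed auto
    also have "\<dots> = (1 / 2) ^ Suc n" by (subst exp_int) simp
    finally show ?case .
  qed (simp add: p_le_1)
  have "p T \<le> 0"
    by (rule LIMSEQ_le_const[OF LIMSEQ_power_zero[of "1 / 2 :: real"]]) (use small[of T] in auto)
  hence pT: "p T = 0" using p_nonneg[of T] by simp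
  \<comment> \<open>The solution (1 - p s) (1 + T - s) = 1 in a form that avoids division by 1 - p:
    the integrating factor \<psi> makes \<open>F\<close> constant, and \<open>F T\<close> is 0
    because \<open>p T\<close> is 0.\<close>
  define F where "F s = ((1 - p s) * (1 + T - s) - 1) * \<psi> s" for s
  have "F T = F 0"
  proof (rule DERIV_isconst2[OF T])
    show "continuous_on {0..T} F"
      unfolding F_def by (intro continuous_intros continuous_on_p continuous_on_\<psi>)
    fix s assume s: "0 < s" "s < T"
    have "(F has_real_derivative (- (2 * p s - 1 - (p s)\<^sup>2) * (1 + T - s) + (1 - p s) * (-1)) * \<psi> s
       + ((1 - p s) * (1 + T - s) - 1) * ((p s - 1) * \<psi> s)) (at s)"
      unfolding F_def using DERIV_p[of s] DERIV_\<psi>[of s] s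
      by (auto intro!: derivative_eq_intros simp: \<phi> S)
    moreover have "(- (2 * p s - 1 - (p s)\<^sup>2) * (1 + T - s) + (1 - p s) * (-1)) * \<psi> s
       + ((1 - p s) * (1 + T - s) - 1) * ((p s - 1) * \<psi> s) = 0"
      by algebra
    ultimately show "DERIV F s :> 0" by simp
  qed (use T in auto)
  hence "(1 - p 0) * (1 + T) = 1" by (simp add: F_def pT \<psi>_0)
  thus ?thesis using T by (simp add: field_simps)
qed

end

section \<open>Functionals of the random walk\<close>

abbreviation increments :: "(nat \<Rightarrow> real) measure" where
  "increments \<equiv> PiM UNIV (\<lambda>_. laplace)"

definition site :: "real \<Rightarrow> (nat \<Rightarrow> real) \<Rightarrow> nat \<Rightarrow> real" where
  "site x \<xi> k = x + (\<Sum>i<k. \<xi> i)"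

text \<open>For \<open>x = 0\<close> this is the event that \<open>nu\<close> equals
  \<open>r\<close>. The sign of the starting point is not tested, in line with the range k \<ge> 1
  in the definition of \<open>tau_minus\<close>.\<close>

definition exits :: "real \<Rightarrow> (nat \<Rightarrow> real) \<Rightarrow> nat \<Rightarrow> bool" where
  "exits x \<xi> r \<longleftrightarrow> (\<forall>k\<in>{1..r}. 0 \<le> site x \<xi> k) \<and> site x \<xi> (Suc r) < 0"

text \<open>At most one summand is nonzero; the value is \<open>0\<close> on paths that never become negative.\<close>

definition walk_functional :: "(real \<Rightarrow> real) \<Rightarrow> real \<Rightarrow> (nat \<Rightarrow> real) \<Rightarrow> ennreal" where
  "walk_functional \<phi> x \<xi> = (\<Sum>r. indicator {\<xi>. exits x \<xi> r} \<xi> * ennreal (\<Prod>k\<in>{1..r}. \<phi> (site x \<xi> k)))"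

lemma site_measurable [measurable (raw)]:
  assumes [measurable]: "f \<in> borel_measurable N" "g \<in> N \<rightarrow>\<^sub>M increments"
  shows "(\<lambda>p. site (f p) (g p) k) \<in> borel_measurable N"
proof -
  have [measurable]: "(\<lambda>p. g p i) \<in> borel_measurable N" for i
    using measurable_compose[OF assms(2) measurable_component_singleton[of i UNIV "\<lambda>_. laplace"]]
    by (simp add: measurable_cong_sets[OF refl sets_laplace])
  show ?thesis unfolding site_def by measurable
qed

lemma exits_measurable [measurable (raw)]:
  assumes [measurable]: "f \<in> borel_measurable N" "g \<in> N \<rightarrow>\<^sub>M increments"
  shows "Measurable.pred N (\<lambda>p. exits (f p) (g p) r)"
  unfolding exits_def by measurable

lemma walk_functional_measurable [measurable (raw)]:
  assumes [measurable]: "\<phi> \<in> borel_measurable borel" "f \<in> borel_measurable N" "g \<in> N \<rightarrow>\<^sub>M increments"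
  shows "(\<lambda>p. walk_functional \<phi> (f p) (g p)) \<in> borel_measurable N"
  unfolding walk_functional_def indicator_def by measurable

lemma site_Suc_case_nat: "site x (case_nat s \<xi>) (Suc k) = site (x + s) \<xi> k"
  by (simp add: site_def sum.lessThan_Suc_shift del: sum.lessThan_Suc)

lemma site_0 [simp]: "site x \<xi> 0 = x" by (simp add: site_def)

lemma exits_case_nat:
  "exits x (case_nat s \<xi>) 0 \<longleftrightarrow> x + s < 0"
  "exits x (case_nat s \<xi>) (Suc r) \<longleftrightarrow> 0 \<le> x + s \<and> exits (x + s) \<xi> r"
proof -
  have *: "{1..Suc r} = insert 1 (Suc ` {1..r})" for r
    by (auto simp: image_Suc_atLeastAtMost)
  show "exits x (case_nat s \<xi>) 0 \<longleftrightarrow> x + s < 0"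
    by (simp add: exits_def site_Suc_case_nat)
  show "exits x (case_nat s \<xi>) (Suc r) \<longleftrightarrow> 0 \<le> x + s \<and> exits (x + s) \<xi> r"
    unfolding exits_def * by (simp add: site_Suc_case_nat del: image_Suc_atLeastAtMost)
qed

lemma exits_unique: "exits x \<xi> r \<Longrightarrow> exits x \<xi> r' \<Longrightarrow> r = r'"
proof (induction r r' rule: linorder_wlog)
  case (le r r')
  show ?case
  proof (rule ccontr)
    assume "r \<noteq> r'"
    hence "Suc r \<in> {1..r'}" using le by auto
    thus False using le unfolding exits_def by force
  qed
qed simp

text \<open>A pathwise first-step decomposition: a first step below 0 ends the product as an empty
  one, and otherwise the new site contributes its factor and restarts the walk.\<close>

lemma walk_functional_case_nat:
  assumes \<phi>: "\<And>x. 0 \<le> \<phi> x"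
  shows "walk_functional \<phi> x (case_nat s \<xi>) = (if x + s < 0 then 1 else ennreal (\<phi> (x + s)) * walk_functional \<phi> (x + s) \<xi>)"
proof -
  let ?f = "\<lambda>r. indicator {\<xi>. exits x \<xi> r} (case_nat s \<xi>) * ennreal (\<Prod>k\<in>{1..r}. \<phi> (site x (case_nat s \<xi>) k))"
  have f_Suc: "?f (Suc r) = (if x + s < 0 then 0 else ennreal (\<phi> (x + s)) *
      (indicator {\<xi>'. exits (x + s) \<xi>' r} \<xi> * ennreal (\<Prod>k\<in>{1..r}. \<phi> (site (x + s) \<xi> k))))" for r
  proof -
    have "(\<Prod>k\<in>{1..Suc r}. \<phi> (site x (case_nat s \<xi>) k)) = (\<Prod>k\<in>{0..r}. \<phi> (site (x + s) \<xi> k))"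
      using prod.shift_bounds_cl_Suc_ivl[of "\<lambda>k. \<phi> (site x (case_nat s \<xi>) k)" 0 r]
      by (simp add: site_Suc_case_nat)
    also have "\<dots> = \<phi> (x + s) * (\<Prod>k\<in>{1..r}. \<phi> (site (x + s) \<xi> k))"
      by (simp add: prod.atLeast_Suc_atMost)
    finally show ?thesis
      using \<phi> by (auto simp: indicator_def exits_case_nat ennreal_mult prod_nonneg)
  qed
  have "walk_functional \<phi> x (case_nat s \<xi>) = (\<Sum>r. ?f (Suc r)) + ?f 0"
    unfolding walk_functional_def using suminf_offset[of ?f 1] by simp
  also have "?f 0 = (if x + s < 0 then 1 else 0)"
    by (simp add: exits_case_nat)
  finally show ?thesis
    unfolding f_Suc by (cases "x + s < 0") (simp_all add: walk_functional_def ennreal_suminf_cmult)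
qed

lemma walk_functional_le_1:
  assumes \<phi>: "\<And>x. 0 \<le> \<phi> x" "\<And>x. \<phi> x \<le> 1"
  shows "walk_functional \<phi> x \<xi> \<le> 1"
proof -
  have "walk_functional \<phi> x \<xi> \<le> (\<Sum>r. indicator {\<xi>. exits x \<xi> r} \<xi>)"
    unfolding walk_functional_def
    by (intro suminf_le) (use \<phi> in \<open>auto simp: indicator_def intro!: prod_le_1\<close>)
  also have "\<dots> = indicator (\<Union>r. {\<xi>. exits x \<xi> r}) \<xi>"
    by (rule suminf_indicator) (auto simp: disjoint_family_on_def dest: exits_unique)
  also have "\<dots> \<le> 1" by (auto simp: indicator_def)
  finally show ?thesis .
qed

lemma walk_functional_exits:
  assumes "exits x \<xi> r"
  shows "walk_functional \<phi> x \<xi> = ennreal (\<Prod>k\<in>{1..r}. \<phi> (site x \<xi> k))"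
proof -
  have "walk_functional \<phi> x \<xi> = (\<Sum>r'\<in>{r}. indicator {\<xi>. exits x \<xi> r'} \<xi> * ennreal (\<Prod>k\<in>{1..r'}. \<phi> (site x \<xi> k)))"
    unfolding walk_functional_def
    by (rule suminf_finite) (use assms in \<open>auto simp: indicator_def dest: exits_unique\<close>)
  thus ?thesis using assms by simp
qed

lemma walk_functional_not_exits: "(\<And>r. \<not> exits x \<xi> r) \<Longrightarrow> walk_functional \<phi> x \<xi> = 0"
  by (simp add: walk_functional_def)

interpretation increments: sequence_space laplace ..

text \<open>Integrating the first-step decomposition shows that the mean as a function of the
  starting point solves the equation whose bounded solution is unique for \<phi> \<le> \<theta> <
  1.\<close>

lemma (in riccati) walk_functional_integral:
  assumes \<theta>: "\<theta> < 1" "\<And>x. \<phi> x \<le> \<theta>"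
  shows "(\<integral>\<^sup>+\<xi>. walk_functional \<phi> 0 \<xi> \<partial>increments) = ennreal (1 / (2 - p 0))"
proof -
  define V where "V x = (\<integral>\<^sup>+\<xi>. walk_functional \<phi> x \<xi> \<partial>increments)" for x
  have V_le: "V x \<le> 1" for x
  proof -
    have "V x \<le> (\<integral>\<^sup>+\<xi>. 1 \<partial>increments)"
      unfolding V_def by (intro nn_integral_mono walk_functional_le_1 \<phi>_nonneg \<phi>_le_1)
    thus ?thesis by (simp add: increments.P.emeasure_space_1)
  qed
  have [measurable]: "V \<in> borel_measurable borel"
    unfolding V_def by measurable
  have V_eq: "V x = (\<integral>\<^sup>+s. (if x + s < 0 then 1 else ennreal (\<phi> (x + s)) * V (x + s)) \<partial>laplace)" for x
  proof -
    \<comment> \<open>Prepending an independent increment leaves the product law unchanged; this is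
      the Markov property in the form needed.\<close>
    have "V x = (\<integral>\<^sup>+\<xi>. walk_functional \<phi> x \<xi> \<partial>distr (laplace \<Otimes>\<^sub>M increments) increments (\<lambda>(s, \<omega>). case_nat s \<omega>))"
      unfolding V_def increments.PiM_iter ..
    also have "\<dots> = (\<integral>\<^sup>+z. walk_functional \<phi> x (case_nat (fst z) (snd z)) \<partial>(laplace \<Otimes>\<^sub>M increments))"
      by (subst nn_integral_distr) (auto simp: split_beta')
    also have "\<dots> = (\<integral>\<^sup>+s. \<integral>\<^sup>+\<xi>. walk_functional \<phi> x (case_nat s \<xi>) \<partial>increments \<partial>laplace)"
      by (subst increments.P.nn_integral_fst[symmetric]) auto
    also have "\<dots> = (\<integral>\<^sup>+s. (if x + s < 0 then 1 else ennreal (\<phi> (x + s)) * V (x + s)) \<partial>laplace)"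
    proof (rule nn_integral_cong)
      fix s
      show "(\<integral>\<^sup>+\<xi>. walk_functional \<phi> x (case_nat s \<xi>) \<partial>increments) =
        (if x + s < 0 then 1 else ennreal (\<phi> (x + s)) * V (x + s))"
        unfolding walk_functional_case_nat[OF \<phi>_nonneg] V_def
        by (auto simp: nn_integral_cmult increments.P.emeasure_space_1)
    qed
    finally show ?thesis .
  qed
  have V_fin: "V x = ennreal (enn2real (V x))" for x
    using V_le[of x] by (intro ennreal_enn2real[symmetric]) (auto intro: le_less_trans)
  have "enn2real (V 0) = 1 / (2 - p 0)"
  proof (rule fixed_point_at_0[OF \<theta>])
    show "enn2real (V x) \<le> 1" for x
      using V_le[of x] by (intro enn2real_leI) auto
    fix x :: real
    have "(\<integral>\<^sup>+s. (if x + s < 0 then 1 else ennreal (\<phi> (x + s)) * V (x + s)) \<partial>laplace) =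
       (\<integral>\<^sup>+s. ennreal (if x + s < 0 then 1 else \<phi> (x + s) * enn2real (V (x + s))) \<partial>laplace)"
      by (intro nn_integral_cong, subst V_fin) (auto simp: ennreal_mult' \<phi>_nonneg)
    thus "enn2real (V x) = (\<integral>s. (if x + s < 0 then 1 else \<phi> (x + s) * enn2real (V (x + s))) \<partial>laplace)"
      by (subst V_eq, subst integral_eq_nn_integral) (auto simp: \<phi>_nonneg)
  qed auto
  thus ?thesis using V_fin[of 0] by (simp add: V_def)
qed

section \<open>Functionals of a family tree\<close>

definition node :: "(real \<times> bool) measure" where
  "node = density lborel (exponential_density 2) \<Otimes>\<^sub>M measure_pmf (bernoulli_pmf (1 / 2))"

abbreviation trees :: "(bool list \<Rightarrow> real \<times> bool) measure" where
  "trees \<equiv> PiM UNIV (\<lambda>_. node)"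

lemma prob_space_node: "prob_space node"
proof -
  interpret A: prob_space "density lborel (exponential_density 2)"
    by (rule prob_space_exponential_density) simp
  interpret pair_prob_space "density lborel (exponential_density 2)" "measure_pmf (bernoulli_pmf (1 / 2))" ..
  show ?thesis unfolding node_def by unfold_locales
qed

lemma sets_node [measurable_cong]: "sets node = sets (borel \<Otimes>\<^sub>M count_space UNIV)"
  unfolding node_def by (intro sets_pair_measure_cong) auto

lemma space_node [simp]: "space node = UNIV"
  by (simp add: node_def space_pair_measure)

interpretation node: prob_space node by (rule prob_space_node)
interpretation trees: product_prob_space "\<lambda>_. node" "UNIV :: bool list set" ..
interpretation tree_pair: pair_prob_space trees trees ..

lemma space_trees [simp]: "space trees = UNIV" by (simp add: space_PiM)

fun graft :: "'c \<Rightarrow> (bool list \<Rightarrow> 'c) \<Rightarrow> (bool list \<Rightarrow> 'c) \<Rightarrow> bool list \<Rightarrow> 'c" where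
  "graft a y z [] = a"
| "graft a y z (b # w) = (if b then y w else z w)"

lemma graft_measurable [measurable (raw)]:
  assumes [measurable]: "f \<in> N \<rightarrow>\<^sub>M node" "g \<in> N \<rightarrow>\<^sub>M trees" "h \<in> N \<rightarrow>\<^sub>M trees"
  shows "(\<lambda>p. graft (f p) (g p) (h p)) \<in> N \<rightarrow>\<^sub>M trees"
proof (rule measurable_PiM_single')
  fix w :: "bool list"
  show "(\<lambda>p. graft (f p) (g p) (h p) w) \<in> N \<rightarrow>\<^sub>M node"
    by (cases w) auto
qed auto

text \<open>The branching property: a random tree is a root with two independent random trees
  attached. On cylinders it amounts to splitting the finite label set \<open>J\<close> into the
  empty word, the words starting with \<open>True\<close> and those starting with
  \<open>False\<close>.\<close>

lemma distr_graft: "distr (node \<Otimes>\<^sub>M (trees \<Otimes>\<^sub>M trees)) trees (\<lambda>(a, y, z). graft a y z) = trees"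
    (is "?D = _")
proof (rule trees.PiM_eq)
  let "distr _ _ ?f" = "?D"
  let ?M = "\<lambda>_::bool list. node"
  fix J :: "bool list set" and E :: "bool list \<Rightarrow> (real \<times> bool) set"
  assume J: "finite J" "J \<subseteq> UNIV" "\<And>j. j \<in> J \<Longrightarrow> E j \<in> sets node"
  let ?X = "prod_emb UNIV ?M J (\<Pi>\<^sub>E j\<in>J. E j)"
  let ?J = "\<lambda>b. Cons b -` J"
  let ?F = "\<lambda>b. prod_emb UNIV ?M (?J b) (\<Pi>\<^sub>E j\<in>?J b. E (b # j))"
  have finJ: "finite (?J b)" for b using J(1) by (intro finite_vimageI) auto
  have ball_graft: "(\<forall>j\<in>J. graft a y z j \<in> E j) \<longleftrightarrow> ([] \<in> J \<longrightarrow> a \<in> E []) \<and>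
      (\<forall>w\<in>?J True. y w \<in> E (True # w)) \<and> (\<forall>w\<in>?J False. z w \<in> E (False # w))" for a y z
  proof safe
    fix w assume w: "w \<in> J" "\<forall>w\<in>?J True. y w \<in> E (True # w)" "\<forall>w\<in>?J False. z w \<in> E (False # w)"
      and nil: "a \<in> E []"
    show "graft a y z w \<in> E w"
      using w nil by (cases "(a, y, z, w)" rule: graft.cases) auto
  next
    fix w assume w: "w \<in> J" "\<forall>w\<in>?J True. y w \<in> E (True # w)" "\<forall>w\<in>?J False. z w \<in> E (False # w)"
      and nil: "[] \<notin> J"
    show "graft a y z w \<in> E w"
      using w nil by (cases "(a, y, z, w)" rule: graft.cases) auto
  qed (force dest: bspec)+
  have vimage: "?f -` ?X \<inter> space (node \<Otimes>\<^sub>M (trees \<Otimes>\<^sub>M trees)) =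
      (if [] \<in> J then E [] else space node) \<times> (?F True \<times> ?F False)" (is "_ = ?E \<times> _")
    by (auto simp: space_pair_measure prod_emb_def PiE_iff space_PiM ball_graft)
  have F_eq: "emeasure trees (?F b) = (\<Prod>j\<in>Cons b ` ?J b. emeasure node (E j))" for b
  proof -
    have "emeasure trees (?F b) = (\<Prod>j\<in>?J b. emeasure node (E (b # j)))"
      using J finJ by (intro trees.emeasure_PiM_emb) auto
    thus ?thesis by (subst prod.reindex) (auto simp: inj_on_def)
  qed
  have E_eq: "emeasure node ?E = (\<Prod>j\<in>J \<inter> {[]}. emeasure node (E j))"
    using node.emeasure_space_1 by auto
  from vimage have "emeasure ?D ?X = emeasure (node \<Otimes>\<^sub>M (trees \<Otimes>\<^sub>M trees)) (?E \<times> (?F True \<times> ?F False))"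
    by (subst emeasure_distr) (auto intro!: sets_PiM_I simp: split_beta' J)
  also have "\<dots> = emeasure node ?E * (emeasure trees (?F True) * emeasure trees (?F False))"
  proof -
    have "?E \<in> sets node" "?F True \<in> sets trees" "?F False \<in> sets trees"
      using J finJ sets.top[of node] by (auto intro!: sets_PiM_I)
    thus ?thesis
      by (simp only: tree_pair.P.emeasure_pair_measure_Times trees.P.emeasure_pair_measure_Times pair_measureI)
  qed
  also have "\<dots> = (\<Prod>j\<in>(J \<inter> {[]}) \<union> (Cons True ` ?J True \<union> Cons False ` ?J False). emeasure node (E j))"
    unfolding E_eq F_eq using J(1) finJ by (subst prod.union_disjoint, auto)+
  also have "(J \<inter> {[]}) \<union> (Cons True ` ?J True \<union> Cons False ` ?J False) = J"
  proof safe
    fix w assume w: "w \<in> J" "w \<notin> Cons False ` ?J False" "w \<notin> Cons True ` ?J True"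
    thus "w = []" by (cases w) (metis (full_types) imageI vimageI)+
  qed
  finally show "emeasure ?D ?X = (\<Prod>j\<in>J. emeasure node (E j))" .
qed simp_all

definition born :: "(bool list \<Rightarrow> real \<times> bool) \<Rightarrow> bool list set" where
  "born x = {w. \<forall>j<length w. snd (x (take j w))}"

definition leaves :: "(bool list \<Rightarrow> real \<times> bool) \<Rightarrow> bool list set" where
  "leaves x = {w \<in> born x. \<not> snd (x w)}"

definition end_time :: "(bool list \<Rightarrow> real \<times> bool) \<Rightarrow> bool list \<Rightarrow> real" where
  "end_time x w = (\<Sum>j<Suc (length w). fst (x (take j w)))"

text \<open>The default 0 on infinite trees keeps extinction visible: a product over an infinite set
  would evaluate to 1, and the mean at \<phi> = 1 would be trivially 1.\<close>

definition tree_functional :: "(real \<Rightarrow> real) \<Rightarrow> real \<Rightarrow> (bool list \<Rightarrow> real \<times> bool) \<Rightarrow> real" where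
  "tree_functional \<phi> t x = (if finite (born x) then \<Prod>w\<in>leaves x. \<phi> (t + end_time x w) else 0)"

lemma born_graft: "born (graft (a, c) y z) = insert [] (if c then Cons True ` born y \<union> Cons False ` born z else {})"
proof (rule set_eqI)
  fix w
  show "w \<in> born (graft (a, c) y z) \<longleftrightarrow> w \<in> insert [] (if c then Cons True ` born y \<union> Cons False ` born z else {})"
  proof (cases w)
    case (Cons b v)
    thus ?thesis by (cases b) (auto simp: born_def All_less_Suc2)
  qed (simp add: born_def)
qed

lemma leaves_graft: "leaves (graft (a, c) y z) = (if c then Cons True ` leaves y \<union> Cons False ` leaves z else {[]})"
  unfolding leaves_def born_graft by auto

lemma end_time_graft:
  "end_time (graft (a, c) y z) [] = a"
  "end_time (graft (a, c) y z) (b # w) = a + end_time (if b then y else z) w"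
  unfolding end_time_def by (simp_all add: sum.lessThan_Suc_shift del: sum.lessThan_Suc)

lemma tree_functional_graft:
  "tree_functional \<phi> t (graft (a, c) y z) =
    (if c then tree_functional \<phi> (t + a) y * tree_functional \<phi> (t + a) z else \<phi> (t + a))"
proof -
  have fin: "finite (leaves x)" if "finite (born x)" for x
    using that by (rule rev_finite_subset) (auto simp: leaves_def)
  show ?thesis
  proof (cases "c \<and> finite (born y) \<and> finite (born z)")
    case True
    thus ?thesis
      by (simp add: tree_functional_def born_graft leaves_graft, subst prod.union_disjoint)
         (auto simp: fin prod.reindex end_time_graft add.assoc)
  next
    \<comment> \<open>Either the root has no children and is the only leaf, or some subtree is
      infinite and both sides take the default value 0.\<close>
    case False
    thus ?thesis
      by (auto simp: tree_functional_def born_graft leaves_graft end_time_graft finite_image_iff)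
  qed
qed

lemma tree_component_measurable [measurable (raw)]:
  assumes "g \<in> N \<rightarrow>\<^sub>M trees"
  shows "(\<lambda>p. fst (g p w)) \<in> borel_measurable N" "Measurable.pred N (\<lambda>p. snd (g p w))"
proof -
  have "(\<lambda>p. g p w) \<in> N \<rightarrow>\<^sub>M borel \<Otimes>\<^sub>M count_space UNIV"
    using measurable_compose[OF assms measurable_component_singleton[of w UNIV "\<lambda>_. node"]]
    by (simp add: measurable_cong_sets[OF refl sets_node])
  thus "(\<lambda>p. fst (g p w)) \<in> borel_measurable N" "Measurable.pred N (\<lambda>p. snd (g p w))"
    by measurable
qed

lemma end_time_measurable [measurable (raw)]:
  assumes [measurable]: "g \<in> N \<rightarrow>\<^sub>M trees"
  shows "(\<lambda>p. end_time (g p) w) \<in> borel_measurable N"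
  unfolding end_time_def by measurable

lemma countable_finite_sets: "countable {B :: 'c :: countable set. finite B}"
  using countable_Collect_finite by simp

text \<open>A countable type has only countably many finite subsets, so a random finite set is a
  discrete random element. Infinite values are sent to \<open>UNIV\<close> to keep the range
  countable.\<close>

lemma finite_set_measurable:
  fixes S :: "'p \<Rightarrow> 'c :: countable set"
  assumes [measurable]: "\<And>u. Measurable.pred N (\<lambda>p. u \<in> S p)"
  shows "(\<lambda>p. if finite (S p) then S p else UNIV) \<in> N \<rightarrow>\<^sub>M count_space (insert UNIV {B. finite B})"
    "Measurable.pred N (\<lambda>p. finite (S p))"
proof -
  have [measurable]: "Measurable.pred N (\<lambda>p. S p = B)" for B
    unfolding set_eq_iff by measurable
  have "(\<Union>B\<in>{B. finite B}. {p \<in> space N. S p = B}) \<in> sets N"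
    by (rule sets.countable_UN'[OF countable_finite_sets]) auto
  also have "(\<Union>B\<in>{B. finite B}. {p \<in> space N. S p = B}) = {p \<in> space N. finite (S p)}"
    by auto
  finally show fin: "Measurable.pred N (\<lambda>p. finite (S p))" by (simp add: pred_def)
  show "(\<lambda>p. if finite (S p) then S p else UNIV) \<in> N \<rightarrow>\<^sub>M count_space (insert UNIV {B. finite B})"
  proof (rule measurable_count_space_eq_countable[THEN iffD2])
    show "countable (insert UNIV {B :: 'c set. finite B})"
      using countable_finite_sets by auto
    have "(\<lambda>p. if finite (S p) then S p else UNIV) -` {B} \<inter> space N \<in> sets N" for B
    proof -
      have "(\<lambda>p. if finite (S p) then S p else UNIV) -` {B} \<inter> space N =
         {p \<in> space N. finite (S p)} \<inter> {p \<in> space N. S p = B} \<union>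
         (if UNIV = B then space N - {p \<in> space N. finite (S p)} else {})"
        by (intro set_eqI) (simp split: if_split; blast)
      also have "\<dots> \<in> sets N"
        using fin[unfolded pred_def] by (intro sets.Un sets.Int) auto
      finally show ?thesis .
    qed
    thus "(\<lambda>p. if finite (S p) then S p else UNIV) \<in> space N \<rightarrow> insert UNIV {B. finite B} \<and>
      (\<forall>B\<in>insert UNIV {B. finite B}. (\<lambda>p. if finite (S p) then S p else UNIV) -` {B} \<inter> space N \<in> sets N)"
      by auto
  qed
qed

lemma born_measurable:
  assumes [measurable]: "g \<in> N \<rightarrow>\<^sub>M trees"
  shows "(\<lambda>p. if finite (born (g p)) then born (g p) else UNIV) \<in> N \<rightarrow>\<^sub>M count_space (insert UNIV {B. finite B})"
  by (rule finite_set_measurable) (simp add: born_def)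

lemma tree_functional_measurable [measurable (raw)]:
  assumes [measurable]: "\<phi> \<in> borel_measurable borel" "f \<in> borel_measurable N" "g \<in> N \<rightarrow>\<^sub>M trees"
  shows "(\<lambda>p. tree_functional \<phi> (f p) (g p)) \<in> borel_measurable N"
proof -
  \<comment> \<open>For a fixed set \<open>B\<close> of born labels this is a finite product of
    measurable factors, with inner nodes contributing 1; measurability then follows by composing
    over the countably many values of \<open>B\<close>.\<close>
  define G where "G B p = (if finite B then \<Prod>w\<in>B. if snd (g p w) then 1 else \<phi> (f p + end_time (g p) w) else 0)" for B p
  have "(\<lambda>p. G (if finite (born (g p)) then born (g p) else UNIV) p) \<in> borel_measurable N"
  proof (rule measurable_compose_countable'[OF _ born_measurable[OF assms(3)]])
    show "G B \<in> borel_measurable N" for B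
      unfolding G_def by measurable
    show "countable (insert UNIV {B :: bool list set. finite B})"
      using countable_finite_sets by auto
  qed
  also have "(\<lambda>p. G (if finite (born (g p)) then born (g p) else UNIV) p) = (\<lambda>p. tree_functional \<phi> (f p) (g p))"
  proof
    fix p
    \<comment> \<open>\<open>UNIV\<close> stands for infinite trees; being infinite itself, it makes
      \<open>G\<close> return the same default 0.\<close>
    have "infinite (UNIV :: bool list set)" by (rule infinite_UNIV_listI)
    thus "G (if finite (born (g p)) then born (g p) else UNIV) p = tree_functional \<phi> (f p) (g p)"
      unfolding G_def tree_functional_def leaves_def
      by (auto intro!: prod.mono_neutral_cong_right)
  qed
  finally show ?thesis .
qed

definition tree_pgf :: "(real \<Rightarrow> real) \<Rightarrow> real \<Rightarrow> real" where
  "tree_pgf \<phi> t = (\<integral>x. tree_functional \<phi> t x \<partial>trees)"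

context
  fixes \<phi> :: "real \<Rightarrow> real"
  assumes \<phi> [measurable]: "\<phi> \<in> borel_measurable borel" and \<phi>01: "\<And>x. 0 \<le> \<phi> x" "\<And>x. \<phi> x \<le> 1"
begin

lemma tree_functional_bounds: "0 \<le> tree_functional \<phi> t x" "tree_functional \<phi> t x \<le> 1"
  using \<phi>01 by (auto simp: tree_functional_def prod_nonneg prod_le_1)

lemma integrable_tree_functional: "integrable trees (tree_functional \<phi> t)"
  by (rule trees.P.integrable_const_bound[where B=1]) (use tree_functional_bounds in auto)

lemma tree_pgf_bounds: "0 \<le> tree_pgf \<phi> t" "tree_pgf \<phi> t \<le> 1"
proof -
  show "0 \<le> tree_pgf \<phi> t"
    unfolding tree_pgf_def by (intro integral_nonneg_AE) (auto simp: tree_functional_bounds)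
  have "tree_pgf \<phi> t \<le> (\<integral>x. 1 \<partial>trees)"
    unfolding tree_pgf_def by (intro integral_mono integrable_tree_functional) (auto simp: tree_functional_bounds)
  thus "tree_pgf \<phi> t \<le> 1" using trees.P.prob_space by simp
qed

lemma ennreal_tree_pgf: "ennreal (tree_pgf \<phi> t) = (\<integral>\<^sup>+x. ennreal (tree_functional \<phi> t x) \<partial>trees)"
  unfolding tree_pgf_def
  by (rule nn_integral_eq_integral[symmetric]) (auto simp: integrable_tree_functional tree_functional_bounds)

lemma tree_pgf_measurable [measurable]: "tree_pgf \<phi> \<in> borel_measurable borel"
  unfolding tree_pgf_def by measurable

text \<open>Both subtrees are independent and born at the end \<open>t + a\<close> of the root's
  life, hence the square; the division by 2 averages over the coin. The computation runs in
  nonnegative integrals, where Tonelli applies directly.\<close>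

lemma tree_pgf_recursion:
  "tree_pgf \<phi> t = (\<integral>a. (\<phi> (t + a) + (tree_pgf \<phi> (t + a))\<^sup>2) / 2 \<partial>density lborel (exponential_density 2))"
proof -
  let ?E = "density lborel (exponential_density 2)"
  let ?B = "measure_pmf (bernoulli_pmf (1 / 2))"
  interpret E: prob_space ?E by (rule prob_space_exponential_density) simp
  interpret EB: pair_prob_space ?E ?B ..
  have inner: "(\<integral>\<^sup>+yz. ennreal (tree_functional \<phi> t (graft (a, c) (fst yz) (snd yz))) \<partial>(trees \<Otimes>\<^sub>M trees)) =
     ennreal (if c then (tree_pgf \<phi> (t + a))\<^sup>2 else \<phi> (t + a))" for a c
  proof (cases c)
    case False
    thus ?thesis by (simp add: tree_functional_graft tree_pair.P.emeasure_space_1 del: space_pair_measure)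
  next
    case True
    have "(\<integral>\<^sup>+yz. ennreal (tree_functional \<phi> (t + a) (fst yz) * tree_functional \<phi> (t + a) (snd yz)) \<partial>(trees \<Otimes>\<^sub>M trees)) =
      (\<integral>\<^sup>+y. \<integral>\<^sup>+z. ennreal (tree_functional \<phi> (t + a) y) * ennreal (tree_functional \<phi> (t + a) z) \<partial>trees \<partial>trees)"
      by (subst trees.P.nn_integral_fst[symmetric]) (auto simp: ennreal_mult tree_functional_bounds)
    also have "\<dots> = ennreal (tree_pgf \<phi> (t + a)) * ennreal (tree_pgf \<phi> (t + a))"
      by (simp add: nn_integral_cmult nn_integral_multc flip: ennreal_tree_pgf)
    finally show ?thesis using True
      by (simp add: tree_functional_graft power2_eq_square ennreal_mult tree_pgf_bounds)
  qed
  have "ennreal (tree_pgf \<phi> t) =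
      (\<integral>\<^sup>+x. ennreal (tree_functional \<phi> t x) \<partial>distr (node \<Otimes>\<^sub>M (trees \<Otimes>\<^sub>M trees)) trees (\<lambda>(a, y, z). graft a y z))"
    unfolding ennreal_tree_pgf distr_graft ..
  also have "\<dots> = (\<integral>\<^sup>+q. ennreal (tree_functional \<phi> t (graft (fst q) (fst (snd q)) (snd (snd q)))) \<partial>(node \<Otimes>\<^sub>M (trees \<Otimes>\<^sub>M trees)))"
    by (subst nn_integral_distr) (auto simp: split_beta')
  also have "\<dots> = (\<integral>\<^sup>+ac. \<integral>\<^sup>+yz. ennreal (tree_functional \<phi> t (graft ac (fst yz) (snd yz))) \<partial>(trees \<Otimes>\<^sub>M trees) \<partial>node)"
    by (subst tree_pair.P.nn_integral_fst[symmetric]) auto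
  also have "\<dots> = (\<integral>\<^sup>+ac. ennreal (if snd ac then (tree_pgf \<phi> (t + fst ac))\<^sup>2 else \<phi> (t + fst ac)) \<partial>node)"
  proof (rule nn_integral_cong)
    fix ac
    show "(\<integral>\<^sup>+yz. ennreal (tree_functional \<phi> t (graft ac (fst yz) (snd yz))) \<partial>(trees \<Otimes>\<^sub>M trees)) =
      ennreal (if snd ac then (tree_pgf \<phi> (t + fst ac))\<^sup>2 else \<phi> (t + fst ac))"
      using inner[of "fst ac" "snd ac"] by (simp only: prod.collapse)
  qed
  also have "\<dots> = (\<integral>\<^sup>+a. \<integral>\<^sup>+c. ennreal (if c then (tree_pgf \<phi> (t + a))\<^sup>2 else \<phi> (t + a)) \<partial>?B \<partial>?E)"
    unfolding node_def by (subst measure_pmf.nn_integral_fst[symmetric]) auto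
  also have "\<dots> = (\<integral>\<^sup>+a. ennreal ((\<phi> (t + a) + (tree_pgf \<phi> (t + a))\<^sup>2) / 2) \<partial>?E)"
    by (intro nn_integral_cong)
       (simp add: \<phi>01 add_divide_distrib add.commute ennreal_divide_numeral flip: divide_ennreal_def ennreal_plus)
  finally have eq: "ennreal (tree_pgf \<phi> t) = (\<integral>\<^sup>+a. ennreal ((\<phi> (t + a) + (tree_pgf \<phi> (t + a))\<^sup>2) / 2) \<partial>?E)" .
  thus ?thesis
    by (subst integral_eq_nn_integral) (auto simp: \<phi>01 tree_pgf_bounds simp flip: eq)
qed

text \<open>The rate 2 of the lifetime cancels the coin weight 1/2, which leaves the kernel
  \<open>exp (2 * (t - s))\<close>.\<close>

lemma riccati_tree_pgf:
  assumes "finite S" "\<And>x. x \<notin> S \<Longrightarrow> isCont \<phi> x"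
  shows "riccati \<phi> (tree_pgf \<phi>) S"
proof
  fix t :: real
  let ?h = "\<lambda>s. \<phi> s + (tree_pgf \<phi> s)\<^sup>2"
  have "tree_pgf \<phi> t = (\<integral>a. exponential_density 2 a * (?h (t + a) / 2) \<partial>lborel)"
    by (subst tree_pgf_recursion, subst integral_density) (auto simp: exponential_density_def)
  also have "\<dots> = (\<integral>s. exponential_density 2 (s - t) * (?h s / 2) \<partial>lborel)"
    by (subst (2) lborel_integral_real_affine[where c=1 and t=t]) auto
  also have "\<dots> = (LINT s:{t<..}|lborel. exp (2 * (t - s)) * ?h s)"
    unfolding set_lebesgue_integral_def using AE_lborel_singleton[of t]
    by (intro integral_cong_AE) (auto simp: exponential_density_def mult_ac algebra_simps elim!: eventually_mono)
  finally show "tree_pgf \<phi> t = (LINT s:{t<..}|lborel. exp (2 * (t - s)) * ?h s)" .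
qed (use assms \<phi>01 tree_pgf_bounds in auto)

end

section \<open>The common generating functional\<close>

text \<open>Wide enough for step functions, closed under scaling by constants in the unit interval,
  and narrow enough for the fundamental theorem with a finite exceptional set.\<close>

definition regular :: "(real \<Rightarrow> real) \<Rightarrow> bool" where
  "regular \<phi> \<longleftrightarrow> \<phi> \<in> borel_measurable borel \<and> (\<forall>x. 0 \<le> \<phi> x \<and> \<phi> x \<le> 1) \<and> (\<exists>S. finite S \<and> (\<forall>x. x \<notin> S \<longrightarrow> isCont \<phi> x))"

lemma regular_measurable: "regular \<phi> \<Longrightarrow> \<phi> \<in> borel_measurable borel"
  and regular_nonneg: "regular \<phi> \<Longrightarrow> 0 \<le> \<phi> x"
  and regular_le_1: "regular \<phi> \<Longrightarrow> \<phi> x \<le> 1"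
  by (auto simp: regular_def)

lemma regular_cmult: "regular \<phi> \<Longrightarrow> 0 \<le> c \<Longrightarrow> c \<le> 1 \<Longrightarrow> regular (\<lambda>x. c * \<phi> x)"
  unfolding regular_def by (auto intro!: mult_le_one exI)

lemma regular_1: "regular (\<lambda>_. 1)"
  by (auto simp: regular_def)

lemma riccati_regular: "regular \<phi> \<Longrightarrow> \<exists>S. riccati \<phi> (tree_pgf \<phi>) S"
  unfolding regular_def by (blast intro: riccati_tree_pgf)

lemma walk_functional_tendsto:
  assumes "\<And>x. (\<lambda>n. \<phi>' n x) \<longlonglongrightarrow> \<phi> x"
  shows "(\<lambda>n. walk_functional (\<phi>' n) x \<xi>) \<longlonglongrightarrow> walk_functional \<phi> x \<xi>"
proof (cases "\<exists>r. exits x \<xi> r")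
  case True
  then obtain r where "exits x \<xi> r" ..
  thus ?thesis by (simp only: walk_functional_exits) (intro tendsto_ennrealI tendsto_prod assms)
qed (simp add: walk_functional_not_exits)

lemma tree_functional_tendsto:
  assumes "\<And>x. (\<lambda>n. \<phi>' n x) \<longlonglongrightarrow> \<phi> x"
  shows "(\<lambda>n. tree_functional (\<phi>' n) t x) \<longlonglongrightarrow> tree_functional \<phi> t x"
  unfolding tree_functional_def by (auto intro!: tendsto_prod assms)

text \<open>The bound \<theta> < 1 is removed by letting \<theta> increase to 1: each path sees a
  finite product or the constant 0, both functionals are at most 1, and dominated convergence
  applies to both sides.\<close>

theorem walk_functional_pgf:
  assumes \<phi>: "regular \<phi>"
  shows "(\<integral>\<^sup>+\<xi>. walk_functional \<phi> 0 \<xi> \<partial>increments) = ennreal (1 / (2 - tree_pgf \<phi> 0))"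
proof -
  define \<theta> :: "nat \<Rightarrow> real" where "\<theta> n = 1 - 1 / real (Suc n)" for n
  have \<theta>: "0 \<le> \<theta> n" "\<theta> n < 1" for n by (auto simp: \<theta>_def)
  have "\<theta> \<longlonglongrightarrow> 1 - 0"
    unfolding \<theta>_def by (intro tendsto_diff tendsto_const LIMSEQ_Suc[OF lim_1_over_n])
  hence lim: "(\<lambda>n. \<theta> n * \<phi> x) \<longlonglongrightarrow> \<phi> x" for x
    using tendsto_mult[of \<theta> 1 sequentially "\<lambda>_. \<phi> x" "\<phi> x"] by simp
  have reg: "regular (\<lambda>x. \<theta> n * \<phi> x)" for n
    using \<theta>[of n] \<phi> by (intro regular_cmult) auto
  note [measurable] = regular_measurable[OF \<phi>] regular_measurable[OF reg]
  note bounds = regular_nonneg[OF \<phi>] regular_le_1[OF \<phi>] regular_nonneg[OF reg] regular_le_1[OF reg]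
  have eq: "(\<integral>\<^sup>+\<xi>. walk_functional (\<lambda>x. \<theta> n * \<phi> x) 0 \<xi> \<partial>increments) = ennreal (1 / (2 - tree_pgf (\<lambda>x. \<theta> n * \<phi> x) 0))" for n
  proof -
    obtain S where "riccati (\<lambda>x. \<theta> n * \<phi> x) (tree_pgf (\<lambda>x. \<theta> n * \<phi> x)) S"
      using riccati_regular[OF reg] by blast
    thus ?thesis
      by (rule riccati.walk_functional_integral[where \<theta>="\<theta> n"])
         (use \<theta>[of n] bounds in \<open>auto intro: mult_left_le\<close>)
  qed
  have "(\<lambda>n. \<integral>\<^sup>+\<xi>. walk_functional (\<lambda>x. \<theta> n * \<phi> x) 0 \<xi> \<partial>increments) \<longlonglongrightarrow> (\<integral>\<^sup>+\<xi>. walk_functional \<phi> 0 \<xi> \<partial>increments)"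
  proof (rule nn_integral_dominated_convergence[where w="\<lambda>_. 1"])
    show "AE \<xi> in increments. walk_functional (\<lambda>x. \<theta> n * \<phi> x) 0 \<xi> \<le> 1" for n
      using bounds by (auto intro!: walk_functional_le_1)
    show "AE \<xi> in increments. (\<lambda>n. walk_functional (\<lambda>x. \<theta> n * \<phi> x) 0 \<xi>) \<longlonglongrightarrow> walk_functional \<phi> 0 \<xi>"
      by (intro AE_I2 walk_functional_tendsto lim)
  qed (auto simp: increments.P.emeasure_space_1)
  moreover have "(\<lambda>n. tree_pgf (\<lambda>x. \<theta> n * \<phi> x) 0) \<longlonglongrightarrow> tree_pgf \<phi> 0"
    unfolding tree_pgf_def
  proof (rule integral_dominated_convergence[where w="\<lambda>_. 1"])
    show "AE x in trees. norm (tree_functional (\<lambda>x. \<theta> n * \<phi> x) 0 x) \<le> 1" for n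
      using tree_functional_bounds[OF regular_measurable[OF reg] bounds(3,4)] by auto
    show "AE x in trees. (\<lambda>n. tree_functional (\<lambda>x. \<theta> n * \<phi> x) 0 x) \<longlonglongrightarrow> tree_functional \<phi> 0 x"
      by (intro AE_I2 tree_functional_tendsto lim)
  qed auto
  hence "(\<lambda>n. ennreal (1 / (2 - tree_pgf (\<lambda>x. \<theta> n * \<phi> x) 0))) \<longlonglongrightarrow> ennreal (1 / (2 - tree_pgf \<phi> 0))"
    using tree_pgf_bounds(2)[OF regular_measurable[OF \<phi>] bounds(1,2), of 0]
    by (intro tendsto_intros) auto
  ultimately show ?thesis
    unfolding eq by (rule LIMSEQ_unique)
qed

text \<open>Almost sure extinction. Without dependence on time the recursion reads c = (1 + c^2) /
  2, and criticality is what makes 1 its double and hence only root.\<close>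

lemma tree_pgf_1: "tree_pgf (\<lambda>_. 1) t = 1"
proof -
  interpret E: prob_space "density lborel (exponential_density 2)"
    by (rule prob_space_exponential_density) simp
  define c where "c = tree_pgf (\<lambda>_. 1) 0"
  have const: "tree_pgf (\<lambda>_. 1) s = c" for s
    unfolding c_def tree_pgf_def tree_functional_def by simp
  have "tree_pgf (\<lambda>_. 1) 0 = (1 + c\<^sup>2) / 2"
    by (subst tree_pgf_recursion) (simp_all add: const E.prob_space del: space_density)
  hence "(c - 1)\<^sup>2 = 0"
    by (simp add: power2_eq_square algebra_simps const)
  thus ?thesis by (simp add: const)
qed

lemma isCont_indicator_atMost: "x \<noteq> T \<Longrightarrow> isCont (indicator {..T::real} :: real \<Rightarrow> real) x"
proof -
  assume "x \<noteq> T"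
  then consider "x < T" | "x > T" by linarith
  thus ?thesis
  proof cases
    case 1
    hence "\<forall>\<^sub>F y in nhds x. indicator {..T} y = (1::real)"
      using eventually_nhds_in_open[of "{..<T}" x] by (auto elim!: eventually_mono)
    thus ?thesis by (subst isCont_cong) auto
  next
    case 2
    hence "\<forall>\<^sub>F y in nhds x. indicator {..T} y = (0::real)"
      using eventually_nhds_in_open[of "{T<..}" x] by (auto elim!: eventually_mono)
    thus ?thesis by (subst isCont_cong) auto
  qed
qed

lemma regular_indicator_atMost: "regular (indicator {..T})"
  unfolding regular_def using isCont_indicator_atMost by (auto simp: indicator_def intro!: exI[of _ "{T}"])

text \<open>The value is the probability that the whole progeny of one individual is extinct by time
  \<open>T\<close>.\<close>

lemma tree_pgf_indicator:
  assumes "0 < T" shows "tree_pgf (indicator {..T}) 0 = T / (1 + T)"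
proof -
  interpret riccati "indicator {..T}" "tree_pgf (indicator {..T})" "{T}"
    by (rule riccati_tree_pgf) (use isCont_indicator_atMost in \<open>auto simp: indicator_def\<close>)
  show ?thesis by (rule p_0_threshold) (use assms in auto)
qed

section \<open>The given branching process as a random number of independent trees\<close>

context critical_binary_branching
begin

definition individual_tree :: "nat \<Rightarrow> 'b \<Rightarrow> bool list \<Rightarrow> real \<times> bool" where
  "individual_tree i \<omega> w = (L (i, w) \<omega>, C (i, w) \<omega>)"

definition src :: "source \<Rightarrow> 'b \<Rightarrow> real" where
  "src s \<omega> = (case s of Initial \<Rightarrow> real (Z0 \<omega>) | Lifetime u \<Rightarrow> L u \<omega> | Coin u \<Rightarrow> of_bool (C u \<omega>))"

lemma indep_src: "indep_vars (\<lambda>_. borel) src UNIV"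
  using independent unfolding src_def[abs_def] .

lemma lifetime_measurable [measurable]: "L u \<in> borel_measurable N"
  using lifetime by (auto simp: distributed_def)

lemmas [measurable] = Z0_measurable coin_measurable

lemma distr_coin: "distr N (count_space UNIV) (C u) = measure_pmf (bernoulli_pmf (1 / 2))"
proof (rule measure_eqI_finite[of _ UNIV])
  have False_eq: "prob {\<omega> \<in> space N. \<not> C u \<omega>} = 1 / 2"
  proof -
    have "{\<omega> \<in> space N. \<not> C u \<omega>} = space N - {\<omega> \<in> space N. C u \<omega>}" by auto
    thus ?thesis using prob_compl[of "{\<omega> \<in> space N. C u \<omega>}"] coin_fair[of u] by simp
  qed
  fix c :: bool
  have "C u -` {c} \<inter> space N = {\<omega> \<in> space N. C u \<omega> = c}" by auto
  thus "emeasure (distr N (count_space UNIV) (C u)) {c} = emeasure (measure_pmf (bernoulli_pmf (1 / 2))) {c}"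
    by (cases c) (simp_all add: emeasure_distr emeasure_eq_measure emeasure_pmf_single coin_fair False_eq)
qed auto

text \<open>Independence is assumed for real-valued images of the sources. The coin is recovered
  from its image by testing for equality with 1, which transports the product form to the
  pair.\<close>

lemma distr_node: "distr N node (\<lambda>\<omega>. (L u \<omega>, C u \<omega>)) = node"
proof -
  have "indep_var (PiM {Lifetime u} (\<lambda>_. borel)) (\<lambda>\<omega>. restrict (\<lambda>s. src s \<omega>) {Lifetime u})
      (PiM {Coin u} (\<lambda>_. borel)) (\<lambda>\<omega>. restrict (\<lambda>s. src s \<omega>) {Coin u})"
    by (rule indep_var_restrict[OF indep_src]) auto
  from indep_var_compose[OF this, of "\<lambda>x. x (Lifetime u)" borel "\<lambda>x. x (Coin u)" borel]
  have "indep_var borel (L u) borel (\<lambda>\<omega>. of_bool (C u \<omega>) :: real)"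
    by (simp add: src_def comp_def)
  hence prod: "distr N borel (L u) \<Otimes>\<^sub>M distr N borel (\<lambda>\<omega>. of_bool (C u \<omega>) :: real) =
    distr N (borel \<Otimes>\<^sub>M borel) (\<lambda>\<omega>. (L u \<omega>, of_bool (C u \<omega>)))"
    by (simp add: indep_var_distribution_eq)
  have "distr N borel (L u) \<Otimes>\<^sub>M distr N (count_space UNIV) (C u) =
      distr (distr N borel (L u)) borel (\<lambda>x. x) \<Otimes>\<^sub>M
      distr (distr N borel (\<lambda>\<omega>. of_bool (C u \<omega>) :: real)) (count_space UNIV) (\<lambda>r. r = 1)"
    by (simp add: distr_distr comp_def distr_id2)
  also have "\<dots> = distr (distr N borel (L u) \<Otimes>\<^sub>M distr N borel (\<lambda>\<omega>. of_bool (C u \<omega>) :: real))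
      (borel \<Otimes>\<^sub>M count_space UNIV) (\<lambda>(x, r). (x, r = 1))"
    by (rule pair_measure_distr)
       (auto intro!: prob_space_imp_sigma_finite prob_space.prob_space_distr prob_space_distr)
  also have "\<dots> = distr N (borel \<Otimes>\<^sub>M count_space UNIV) (\<lambda>\<omega>. (L u \<omega>, C u \<omega>))"
    unfolding prod by (subst distr_distr) (auto simp: comp_def)
  also have "\<dots> = distr N node (\<lambda>\<omega>. (L u \<omega>, C u \<omega>))"
    by (intro distr_cong) (auto simp: sets_node)
  also have "distr N borel (L u) = density lborel (exponential_density 2)"
    using distributed_distr_eq_density[OF lifetime[of u]] by (simp cong: distr_cong)
  finally show ?thesis by (simp add: distr_coin node_def)
qed

lemma individual_tree_measurable [measurable]: "individual_tree i \<in> N \<rightarrow>\<^sub>M trees"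
  unfolding individual_tree_def[abs_def]
  by (rule measurable_PiM_single') (auto simp: measurable_cong_sets[OF refl sets_node])

text \<open>Grouping the sources into pairs of lifetime and coin, one pair for each word, gives
  independent blocks, and functions of disjoint blocks are independent.\<close>

lemma distr_individual_tree: "distr N trees (individual_tree i) = trees"
proof -
  define K where "K w = {Lifetime (i, w), Coin (i, w)}" for w
  have "indep_vars (\<lambda>w. PiM (K w) (\<lambda>_. borel)) (\<lambda>w \<omega>. restrict (\<lambda>s. src s \<omega>) (K w)) UNIV"
    by (rule indep_vars_restrict[OF indep_src]) (auto simp: disjoint_family_on_def K_def)
  hence "indep_vars (\<lambda>_. node) (\<lambda>w \<omega>. (\<lambda>x. (x (Lifetime (i, w)), x (Coin (i, w)) = 1)) (restrict (\<lambda>s. src s \<omega>) (K w))) UNIV"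
    by (rule indep_vars_compose2) (auto simp: K_def measurable_cong_sets[OF refl sets_node])
  hence "indep_vars (\<lambda>_. node) (\<lambda>w \<omega>. (L (i, w) \<omega>, C (i, w) \<omega>)) UNIV"
    by (simp add: K_def src_def)
  hence "distr N trees (\<lambda>\<omega>. \<lambda>w\<in>UNIV. (L (i, w) \<omega>, C (i, w) \<omega>)) = PiM UNIV (\<lambda>w. distr N node (\<lambda>\<omega>. (L (i, w) \<omega>, C (i, w) \<omega>)))"
    by (subst (asm) indep_vars_iff_distr_eq_PiM') (auto simp: measurable_cong_sets[OF refl sets_node])
  thus ?thesis
    by (simp add: distr_node individual_tree_def[abs_def] restrict_UNIV)
qed

definition forest_functional :: "(real \<Rightarrow> real) \<Rightarrow> 'b \<Rightarrow> real" where
  "forest_functional \<phi> \<omega> = (if finite {u. is_born Z0 C \<omega> u}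
     then \<Prod>u\<in>{u. is_born Z0 C \<omega> u \<and> \<not> C u \<omega>}. \<phi> (birth_time L \<omega> u + L u \<omega>) else 0)"

lemma is_born_iff: "is_born Z0 C \<omega> (i, w) \<longleftrightarrow> i < Z0 \<omega> \<and> w \<in> born (individual_tree i \<omega>)"
  by (simp add: born_def individual_tree_def)

lemma end_time_individual_tree: "end_time (individual_tree i \<omega>) w = birth_time L \<omega> (i, w) + L (i, w) \<omega>"
  by (simp add: end_time_def individual_tree_def)

lemma forest_functional_eq: "forest_functional \<phi> \<omega> = (\<Prod>i<Z0 \<omega>. tree_functional \<phi> 0 (individual_tree i \<omega>))"
proof -
  let ?t = "\<lambda>i. individual_tree i \<omega>"
  have born_eq: "{u. is_born Z0 C \<omega> u} = Sigma {..<Z0 \<omega>} (\<lambda>i. born (?t i))"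
    by (auto simp: is_born_iff simp del: is_born.simps)
  have leaves_eq: "{u. is_born Z0 C \<omega> u \<and> \<not> C u \<omega>} = Sigma {..<Z0 \<omega>} (\<lambda>i. leaves (?t i))"
    by (auto simp: is_born_iff leaves_def individual_tree_def simp del: is_born.simps)
  show ?thesis
  proof (cases "\<forall>i<Z0 \<omega>. finite (born (?t i))")
    case True
    hence "finite (leaves (?t i))" if "i < Z0 \<omega>" for i
      using that by (auto simp: leaves_def)
    hence "(\<Prod>i<Z0 \<omega>. \<Prod>w\<in>leaves (?t i). \<phi> (end_time (?t i) w)) =
        (\<Prod>(i, w)\<in>Sigma {..<Z0 \<omega>} (\<lambda>i. leaves (?t i)). \<phi> (end_time (?t i) w))"
      by (intro prod.Sigma) auto
    moreover have "finite (Sigma {..<Z0 \<omega>} (\<lambda>i. born (?t i)))"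
      using True by (intro finite_SigmaI) auto
    ultimately show ?thesis
      unfolding forest_functional_def leaves_eq born_eq using True
      by (auto simp: tree_functional_def end_time_individual_tree split_beta' simp del: birth_time.simps)
  next
    case False
    then obtain i where i: "i < Z0 \<omega>" "infinite (born (?t i))" by auto
    \<comment> \<open>One infinite family makes the whole forest infinite, so both the forest
      functional and its factor on the right have the default value 0.\<close>
    have "Pair i ` born (?t i) \<subseteq> Sigma {..<Z0 \<omega>} (\<lambda>i. born (?t i))"
      using i(1) by auto
    moreover have "infinite (Pair i ` born (?t i))"
      using i(2) by (auto dest: finite_imageD simp: inj_on_def)
    ultimately have "infinite (Sigma {..<Z0 \<omega>} (\<lambda>i. born (?t i)))"
      using finite_subset by blast
    moreover have "tree_functional \<phi> 0 (?t i) = 0"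
      using i by (simp add: tree_functional_def)
    ultimately show ?thesis
      unfolding forest_functional_def born_eq using i(1) by (auto simp: prod_zero_iff)
  qed
qed

theorem forest_functional_pgf:
  assumes Z0: "\<And>n. prob {\<omega> \<in> space N. Z0 \<omega> = n} = 1 / 2 ^ (n + 1)" and \<phi>: "regular \<phi>"
  shows "(\<integral>\<^sup>+\<omega>. ennreal (forest_functional \<phi> \<omega>) \<partial>N) = ennreal (1 / (2 - tree_pgf \<phi> 0))"
proof -
  note [measurable] = regular_measurable[OF \<phi>]
  let ?p = "tree_pgf \<phi> 0"
  have p: "0 \<le> ?p" "?p \<le> 1"
    using tree_pgf_bounds[OF regular_measurable[OF \<phi>] regular_nonneg[OF \<phi>] regular_le_1[OF \<phi>]] by auto
  have F: "0 \<le> tree_functional \<phi> 0 x" for x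
    using tree_functional_bounds[OF regular_measurable[OF \<phi>] regular_nonneg[OF \<phi>] regular_le_1[OF \<phi>]] by auto
  have tree_int: "(\<integral>\<^sup>+\<omega>. ennreal (tree_functional \<phi> 0 (individual_tree i \<omega>)) \<partial>N) = ennreal ?p" for i
  proof -
    have "(\<integral>\<^sup>+\<omega>. ennreal (tree_functional \<phi> 0 (individual_tree i \<omega>)) \<partial>N) =
        (\<integral>\<^sup>+x. ennreal (tree_functional \<phi> 0 x) \<partial>distr N trees (individual_tree i))"
      by (subst nn_integral_distr) auto
    thus ?thesis
      using ennreal_tree_pgf[OF regular_measurable[OF \<phi>] regular_nonneg[OF \<phi>] regular_le_1[OF \<phi>]]
      by (simp add: distr_individual_tree)
  qed
  have term_eq: "(\<integral>\<^sup>+\<omega>. indicator {\<omega>. Z0 \<omega> = n} \<omega> * ennreal (\<Prod>i<n. tree_functional \<phi> 0 (individual_tree i \<omega>)) \<partial>N) =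
      ennreal (1 / 2 * (?p / 2) ^ n)" for n
  proof -
    \<comment> \<open>Blocks of sources: \<open>None\<close> holds the initial number,
      \<open>Some i\<close> everything carried by the i-th tree. \<open>Y\<close> recomputes from a
      block the factor that \<open>V\<close> reads off the process.\<close>
    define K where "K j = (case j of None \<Rightarrow> {Initial}
      | Some i \<Rightarrow> range (\<lambda>w. Lifetime (i, w)) \<union> range (\<lambda>w. Coin (i, w)))" for j :: "nat option"
    define Y :: "nat option \<Rightarrow> (source \<Rightarrow> real) \<Rightarrow> ennreal" where "Y j x = (case j of None \<Rightarrow> indicator {x. x Initial = real n} x
      | Some i \<Rightarrow> ennreal (tree_functional \<phi> 0 (\<lambda>w. (x (Lifetime (i, w)), x (Coin (i, w)) = 1))))" for j x
    define V where "V j \<omega> = (case j of None \<Rightarrow> indicator {\<omega>. Z0 \<omega> = n} \<omega>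
      | Some i \<Rightarrow> ennreal (tree_functional \<phi> 0 (individual_tree i \<omega>)))" for j \<omega>
    have "indep_vars (\<lambda>j. PiM (K j) (\<lambda>_. borel)) (\<lambda>j \<omega>. restrict (\<lambda>s. src s \<omega>) (K j)) UNIV"
      by (rule indep_vars_restrict[OF indep_src]) (auto simp: disjoint_family_on_def K_def split: option.splits)
    hence "indep_vars (\<lambda>_. borel) (\<lambda>j \<omega>. Y j (restrict (\<lambda>s. src s \<omega>) (K j))) UNIV"
    proof (rule indep_vars_compose2)
      fix j
      show "Y j \<in> borel_measurable (PiM (K j) (\<lambda>_. borel))"
      proof (cases j)
        case None
        have "(\<lambda>x. x Initial) \<in> borel_measurable (PiM {Initial} (\<lambda>_. borel :: real measure))"
          by (rule measurable_component_singleton) simp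
        thus ?thesis by (simp add: None Y_def[abs_def] K_def indicator_def)
      next
        case (Some i)
        have comp: "(\<lambda>x. x s) \<in> borel_measurable (PiM (K j) (\<lambda>_. borel :: real measure))" if "s \<in> K j" for s
          using that by (rule measurable_component_singleton)
        have "(\<lambda>x w. (x (Lifetime (i, w)), x (Coin (i, w)) = 1)) \<in> PiM (K j) (\<lambda>_. borel :: real measure) \<rightarrow>\<^sub>M trees"
        proof (rule measurable_PiM_single')
          fix w
          have [measurable]: "(\<lambda>x. x (Lifetime (i, w))) \<in> borel_measurable (PiM (K j) (\<lambda>_. borel :: real measure))"
            "(\<lambda>x. x (Coin (i, w))) \<in> borel_measurable (PiM (K j) (\<lambda>_. borel :: real measure))"
            by (rule comp; simp add: K_def Some)+
          show "(\<lambda>x. (x (Lifetime (i, w)), x (Coin (i, w)) = 1)) \<in> PiM (K j) (\<lambda>_. borel :: real measure) \<rightarrow>\<^sub>M node"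
            unfolding measurable_cong_sets[OF refl sets_node] by measurable
        qed auto
        from tree_functional_measurable[OF regular_measurable[OF \<phi>] measurable_const this]
        show ?thesis by (simp add: Some Y_def[abs_def])
      qed
    qed
    also have "(\<lambda>j \<omega>. Y j (restrict (\<lambda>s. src s \<omega>) (K j))) = V"
      by (auto simp: fun_eq_iff Y_def V_def K_def src_def individual_tree_def[abs_def] indicator_def split: option.splits)
    finally have "indep_vars (\<lambda>_. borel) V UNIV" .
    hence ind: "indep_vars (\<lambda>_. borel) V (insert None (Some ` {..<n}))"
      by (rule indep_vars_subset) auto
    have "(\<integral>\<^sup>+\<omega>. indicator {\<omega>. Z0 \<omega> = n} \<omega> * ennreal (\<Prod>i<n. tree_functional \<phi> 0 (individual_tree i \<omega>)) \<partial>N) =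
        (\<integral>\<^sup>+\<omega>. (\<Prod>j\<in>insert None (Some ` {..<n}). V j \<omega>) \<partial>N)"
      by (intro nn_integral_cong, subst prod.insert)
         (auto simp: V_def prod.reindex prod_ennreal F)
    also have "\<dots> = (\<Prod>j\<in>insert None (Some ` {..<n}). \<integral>\<^sup>+\<omega>. V j \<omega> \<partial>N)"
      by (rule indep_vars_nn_integral[OF _ ind]) auto
    also have "\<dots> = (\<integral>\<^sup>+\<omega>. indicator {\<omega>. Z0 \<omega> = n} \<omega> \<partial>N) * ennreal ?p ^ n"
      by (subst prod.insert) (auto simp: V_def[abs_def] prod.reindex tree_int)
    also have "(\<integral>\<^sup>+\<omega>. indicator {\<omega>. Z0 \<omega> = n} \<omega> \<partial>N) = (\<integral>\<^sup>+\<omega>. indicator {\<omega> \<in> space N. Z0 \<omega> = n} \<omega> \<partial>N)"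
      by (intro nn_integral_cong) (auto simp: indicator_def)
    also have "\<dots> = ennreal (1 / 2 ^ (n + 1))"
      by (subst nn_integral_indicator) (auto simp: emeasure_eq_measure Z0)
    also have "\<dots> * ennreal ?p ^ n = ennreal (1 / 2 * (?p / 2) ^ n)"
      using p by (simp add: ennreal_power power_divide flip: ennreal_mult)
    finally show ?thesis .
  qed
  have "(\<integral>\<^sup>+\<omega>. ennreal (forest_functional \<phi> \<omega>) \<partial>N) =
      (\<integral>\<^sup>+\<omega>. (\<Sum>n. indicator {\<omega>. Z0 \<omega> = n} \<omega> * ennreal (\<Prod>i<n. tree_functional \<phi> 0 (individual_tree i \<omega>))) \<partial>N)"
  proof (rule nn_integral_cong)
    fix \<omega>
    have "(\<Sum>n. indicator {\<omega>. Z0 \<omega> = n} \<omega> * ennreal (\<Prod>i<n. tree_functional \<phi> 0 (individual_tree i \<omega>))) =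
      (\<Sum>n\<in>{Z0 \<omega>}. indicator {\<omega>. Z0 \<omega> = n} \<omega> * ennreal (\<Prod>i<n. tree_functional \<phi> 0 (individual_tree i \<omega>)))"
      by (rule suminf_finite) auto
    thus "ennreal (forest_functional \<phi> \<omega>) =
      (\<Sum>n. indicator {\<omega>. Z0 \<omega> = n} \<omega> * ennreal (\<Prod>i<n. tree_functional \<phi> 0 (individual_tree i \<omega>)))"
      by (simp add: forest_functional_eq)
  qed
  also have "\<dots> = (\<Sum>n. ennreal (1 / 2 * (?p / 2) ^ n))"
    unfolding term_eq[symmetric] by (rule nn_integral_suminf) (auto simp: indicator_def)
  \<comment> \<open>The ratio is at most 1/2, so the geometric series also converges in the
    extinction case where \<open>?p\<close> is 1.\<close>
  also have "\<dots> = ennreal (1 / 2 * (1 / (1 - ?p / 2)))"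
    using p by (intro suminf_ennreal_eq sums_mult geometric_sums) auto
  also have "1 / 2 * (1 / (1 - ?p / 2)) = 1 / (2 - ?p)"
    using p by (simp add: field_simps)
  finally show ?thesis .
qed

end

section \<open>Generating functionals determine the law of the order statistics\<close>

text \<open>Lower orthants are stable under intersection, by taking minima of the corners, they
  generate the product sigma-algebra, and the cubic ones exhaust the space.\<close>

lemma measure_eqI_PiM_atMost:
  fixes P Q :: "('i \<Rightarrow> real) measure"
  assumes I: "finite I" and sets: "sets P = sets (PiM I (\<lambda>_. borel))" "sets Q = sets (PiM I (\<lambda>_. borel))"
    and fin: "finite_measure P"
    and eq: "\<And>a. emeasure P {f \<in> space (PiM I (\<lambda>_. borel :: real measure)). \<forall>i\<in>I. f i \<le> a i} =
                 emeasure Q {f \<in> space (PiM I (\<lambda>_. borel :: real measure)). \<forall>i\<in>I. f i \<le> a i}"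
  shows "P = Q"
proof -
  define box where "box a = {f \<in> PiE I (\<lambda>_. UNIV :: real set). \<forall>i\<in>I. f i \<le> a i}" for a
  have box_eq: "box a = {f \<in> space (PiM I (\<lambda>_. borel :: real measure)). \<forall>i\<in>I. f i \<le> a i}" for a
    by (simp add: box_def space_PiM)
  have "sets (PiM I (\<lambda>_. sigma (UNIV :: real set) (range atMost))) =
     sets (sigma (PiE I (\<lambda>_. UNIV)) {{f \<in> PiE I (\<lambda>_. UNIV). \<forall>i\<in>j. f i \<in> A i} | A j. j \<in> {I} \<and> A \<in> Pi j (\<lambda>_. range atMost)})"
  proof (rule sets_PiM_sigma)
    show "\<exists>S\<subseteq>range atMost. countable S \<and> (UNIV :: real set) = \<Union> S"
      by (rule exI[of _ "range (\<lambda>n. {..real n})"]) (auto intro: real_arch_simple)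
  qed (use I in auto)
  also have "{{f \<in> PiE I (\<lambda>_. UNIV :: real set). \<forall>i\<in>j. f i \<in> A i} | A j. j \<in> {I} \<and> A \<in> Pi j (\<lambda>_. range atMost)} = range box"
  proof (intro set_eqI iffI)
    fix X assume "X \<in> range box"
    then obtain a where "X = box a" by auto
    thus "X \<in> {{f \<in> PiE I (\<lambda>_. UNIV :: real set). \<forall>i\<in>j. f i \<in> A i} | A j. j \<in> {I} \<and> A \<in> Pi j (\<lambda>_. range atMost)}"
      by (auto simp: box_def intro!: exI[of _ "\<lambda>i. {..a i}"])
  next
    fix X assume "X \<in> {{f \<in> PiE I (\<lambda>_. UNIV :: real set). \<forall>i\<in>j. f i \<in> A i} | A j. j \<in> {I} \<and> A \<in> Pi j (\<lambda>_. range atMost)}"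
    then obtain A where X: "X = {f \<in> PiE I (\<lambda>_. UNIV :: real set). \<forall>i\<in>I. f i \<in> A i}" and A: "A \<in> I \<rightarrow> range atMost"
      by blast
    from A have "\<forall>i\<in>I. \<exists>a. A i = {..a}" by auto
    then obtain a where "\<forall>i\<in>I. A i = {..a i}" by metis
    hence "X = box a" by (auto simp: X box_def)
    thus "X \<in> range box" by simp
  qed
  also have "sets (sigma (PiE I (\<lambda>_. UNIV)) (range box)) = sigma_sets (PiE I (\<lambda>_. UNIV)) (range box)"
    by (rule sets_measure_of) (auto simp: box_def)
  finally have gen: "sets (PiM I (\<lambda>_. borel :: real measure)) = sigma_sets (PiE I (\<lambda>_. UNIV)) (range box)"
    unfolding borel_eq_atMost .
  show ?thesis
  proof (rule measure_eqI_generator_eq[where E="range box" and \<Omega>="PiE I (\<lambda>_. UNIV)" and A="\<lambda>n. box (\<lambda>_. real n)"])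
    show "Int_stable (range box)"
    proof (rule Int_stableI_image)
      fix a a' :: "'i \<Rightarrow> real"
      have "box a \<inter> box a' = box (\<lambda>i. min (a i) (a' i))" by (auto simp: box_def)
      thus "\<exists>c\<in>UNIV. box a \<inter> box a' = box c" by blast
    qed
    show "(\<Union>n. box (\<lambda>_. real n)) = PiE I (\<lambda>_. UNIV)"
    proof (intro equalityI subsetI)
      fix f assume f: "f \<in> PiE I (\<lambda>_. UNIV :: real set)"
      obtain n where n: "(\<Sum>i\<in>I. \<bar>f i\<bar>) \<le> real n" using real_arch_simple by blast
      have "f i \<le> real n" if "i \<in> I" for i
        using member_le_sum[OF that _ I, of "\<lambda>i. \<bar>f i\<bar>"] n by auto
      thus "f \<in> (\<Union>n. box (\<lambda>_. real n))" using f by (auto simp: box_def)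
    qed (auto simp: box_def)
    show "emeasure P X = emeasure Q X" if "X \<in> range box" for X
      using that eq by (auto simp: box_eq)
  qed (auto simp: sets gen box_def finite_measure.emeasure_finite[OF fin])
qed

text \<open>Convergence at 1/2 yields a power series on a full disc around 0, hence continuous
  there; its limit from the right identifies the constant term, although vanishing is known for
  positive arguments only.\<close>

lemma power_series_coeff_0:
  fixes d :: "nat \<Rightarrow> real"
  assumes "\<And>\<theta>. 0 < \<theta> \<Longrightarrow> \<theta> < 1 \<Longrightarrow> (\<lambda>n. d n * \<theta> ^ n) sums 0"
  shows "d 0 = 0"
proof -
  have sums: "(\<lambda>n. d n * x ^ n) sums (\<Sum>n. d n * x ^ n)" if "norm x < 1 / 2" for x
    using powser_inside[of d "1 / 2" x] assms[of "1 / 2"] that by (auto simp: sums_iff)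
  have "((\<lambda>x. \<Sum>n. d n * x ^ n) \<longlongrightarrow> d 0) (at 0)"
    by (rule powser_limit_0[OF _ sums, of "1 / 2"]) auto
  hence "((\<lambda>x. \<Sum>n. d n * x ^ n) \<longlongrightarrow> d 0) (at_right 0)"
    by (rule filterlim_mono) (auto simp: at_le)
  moreover have "\<forall>\<^sub>F x in at_right 0. (\<Sum>n. d n * x ^ n) = (0::real)"
    using eventually_at_right_less[of 0] eventually_at_right_real[of 0 1]
    by (auto elim!: eventually_mono dest: assms simp: sums_iff)
  ultimately have "((\<lambda>x. 0) \<longlongrightarrow> d 0) (at_right (0::real))"
    by (rule Lim_transform_eventually)
  thus ?thesis by (simp add: tendsto_const_iff)
qed

text \<open>By strong induction the earlier coefficients of the difference vanish; after division by
  \<open>\<theta> ^ n\<close> the coefficient in question becomes the constant term.\<close>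

lemma power_series_unique:
  fixes a b :: "nat \<Rightarrow> real"
  assumes "\<And>\<theta>. 0 < \<theta> \<Longrightarrow> \<theta> < 1 \<Longrightarrow> (\<lambda>n. a n * \<theta> ^ n) sums f \<theta>"
    and "\<And>\<theta>. 0 < \<theta> \<Longrightarrow> \<theta> < 1 \<Longrightarrow> (\<lambda>n. b n * \<theta> ^ n) sums f \<theta>"
  shows "a n = b n"
proof -
  define d where "d n = a n - b n" for n
  have d: "(\<lambda>n. d n * \<theta> ^ n) sums 0" if "0 < \<theta>" "\<theta> < 1" for \<theta>
    using sums_diff[OF assms(1)[OF that] assms(2)[OF that]] by (simp add: d_def left_diff_distrib)
  have "d n = 0"
  proof (induction n rule: less_induct)
    case (less n)
    have "(\<lambda>k. d (k + n) * \<theta> ^ k) sums 0" if \<theta>: "0 < \<theta>" "\<theta> < 1" for \<theta>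
    proof -
      have "(\<lambda>k. d (k + n) * \<theta> ^ (k + n)) sums 0"
        using sums_split_initial_segment[OF d[OF \<theta>], of n] less by simp
      from sums_mult[OF this, of "1 / \<theta> ^ n"] show ?thesis
        using \<theta> by (simp add: power_add)
    qed
    from power_series_coeff_0[OF this] show ?case by simp
  qed
  thus ?thesis by (simp add: d_def)
qed

lemma nn_integral_power_eq:
  assumes M: "prob_space M" and [measurable]: "K \<in> M \<rightarrow>\<^sub>M count_space UNIV" "h \<in> borel_measurable M"
    and h: "\<And>\<omega>. h \<omega> \<le> 1" and \<theta>: "0 < \<theta>" "\<theta> < 1"
  shows "(\<lambda>n. enn2real (\<integral>\<^sup>+\<omega>. h \<omega> * indicator {\<omega>. K \<omega> = n} \<omega> \<partial>M) * \<theta> ^ n) sums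
     enn2real (\<integral>\<^sup>+\<omega>. h \<omega> * ennreal (\<theta> ^ K \<omega>) \<partial>M)"
proof -
  interpret prob_space M by fact
  define a where "a n = enn2real (\<integral>\<^sup>+\<omega>. h \<omega> * indicator {\<omega>. K \<omega> = n} \<omega> \<partial>M)" for n
  have le: "(\<integral>\<^sup>+\<omega>. h \<omega> * indicator {\<omega>. K \<omega> = n} \<omega> \<partial>M) \<le> 1" for n
  proof -
    have "(\<integral>\<^sup>+\<omega>. h \<omega> * indicator {\<omega>. K \<omega> = n} \<omega> \<partial>M) \<le> (\<integral>\<^sup>+\<omega>. 1 \<partial>M)"
      by (intro nn_integral_mono) (auto simp: indicator_def h)
    thus ?thesis by (simp add: emeasure_space_1)
  qed
  have a: "ennreal (a n) = (\<integral>\<^sup>+\<omega>. h \<omega> * indicator {\<omega>. K \<omega> = n} \<omega> \<partial>M)" for n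
    unfolding a_def by (rule ennreal_enn2real) (use le[of n] in \<open>auto intro: le_less_trans\<close>)
  have a01: "0 \<le> a n" "a n \<le> 1" for n
    using le[of n] by (auto simp: a_def intro!: enn2real_leI)
  have "summable (\<lambda>n. a n * \<theta> ^ n)"
    by (rule summable_comparison_test'[where g="\<lambda>n. \<theta> ^ n"])
       (use \<theta> a01 in \<open>auto intro!: summable_geometric mult_left_le_one_le simp: abs_mult\<close>)
  hence sums: "(\<lambda>n. a n * \<theta> ^ n) sums (\<Sum>n. a n * \<theta> ^ n)" by (simp add: summable_sums)
  have nonneg: "0 \<le> (\<Sum>n. a n * \<theta> ^ n)"
    using sums \<theta> a01 by (intro suminf_nonneg) (auto simp: sums_iff)
  have "(\<integral>\<^sup>+\<omega>. h \<omega> * ennreal (\<theta> ^ K \<omega>) \<partial>M) = (\<integral>\<^sup>+\<omega>. (\<Sum>n. h \<omega> * indicator {\<omega>. K \<omega> = n} \<omega> * ennreal (\<theta> ^ n)) \<partial>M)"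
  proof (rule nn_integral_cong)
    fix \<omega>
    have "(\<Sum>n. h \<omega> * indicator {\<omega>. K \<omega> = n} \<omega> * ennreal (\<theta> ^ n)) = (\<Sum>n\<in>{K \<omega>}. h \<omega> * indicator {\<omega>. K \<omega> = n} \<omega> * ennreal (\<theta> ^ n))"
      by (rule suminf_finite) auto
    thus "h \<omega> * ennreal (\<theta> ^ K \<omega>) = (\<Sum>n. h \<omega> * indicator {\<omega>. K \<omega> = n} \<omega> * ennreal (\<theta> ^ n))"
      by simp
  qed
  also have "\<dots> = (\<Sum>n. \<integral>\<^sup>+\<omega>. h \<omega> * indicator {\<omega>. K \<omega> = n} \<omega> * ennreal (\<theta> ^ n) \<partial>M)"
    by (rule nn_integral_suminf) (auto simp: indicator_def)
  also have "\<dots> = (\<Sum>n. ennreal (a n * \<theta> ^ n))"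
    using a01 \<theta> by (subst nn_integral_multc) (auto simp: a ennreal_mult indicator_def)
  also have "\<dots> = ennreal (\<Sum>n. a n * \<theta> ^ n)"
    using a01 \<theta> by (intro suminf_ennreal_eq sums) auto
  finally have "enn2real (\<integral>\<^sup>+\<omega>. h \<omega> * ennreal (\<theta> ^ K \<omega>) \<partial>M) = (\<Sum>n. a n * \<theta> ^ n)"
    using nonneg by simp
  thus ?thesis using sums by (simp add: a_def)
qed

text \<open>The weight \<open>h\<close> is carried along so that a double generating function can be
  inverted one variable at a time.\<close>

lemma pgf_unique:
  assumes M: "prob_space M" "K \<in> M \<rightarrow>\<^sub>M count_space UNIV" "h \<in> borel_measurable M" "\<And>\<omega>. h \<omega> \<le> 1"
    and N: "prob_space N" "K' \<in> N \<rightarrow>\<^sub>M count_space UNIV" "h' \<in> borel_measurable N" "\<And>\<omega>. h' \<omega> \<le> 1"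
    and eq: "\<And>\<theta>. 0 < \<theta> \<Longrightarrow> \<theta> < 1 \<Longrightarrow> (\<integral>\<^sup>+\<omega>. h \<omega> * ennreal (\<theta> ^ K \<omega>) \<partial>M) = (\<integral>\<^sup>+\<omega>. h' \<omega> * ennreal (\<theta> ^ K' \<omega>) \<partial>N)"
  shows "(\<integral>\<^sup>+\<omega>. h \<omega> * indicator {\<omega>. K \<omega> = n} \<omega> \<partial>M) = (\<integral>\<^sup>+\<omega>. h' \<omega> * indicator {\<omega>. K' \<omega> = n} \<omega> \<partial>N)"
proof -
  have fin: "(\<integral>\<^sup>+\<omega>. f \<omega> * indicator A \<omega> \<partial>R) < \<top>" if "prob_space R" "\<And>\<omega>. f \<omega> \<le> 1" for R and f :: "'c \<Rightarrow> ennreal" and A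
  proof -
    interpret prob_space R by fact
    have "(\<integral>\<^sup>+\<omega>. f \<omega> * indicator A \<omega> \<partial>R) \<le> (\<integral>\<^sup>+\<omega>. 1 \<partial>R)"
      by (intro nn_integral_mono) (auto simp: indicator_def that)
    thus ?thesis by (auto simp: emeasure_space_1 intro: le_less_trans)
  qed
  have "enn2real (\<integral>\<^sup>+\<omega>. h \<omega> * indicator {\<omega>. K \<omega> = n} \<omega> \<partial>M) = enn2real (\<integral>\<^sup>+\<omega>. h' \<omega> * indicator {\<omega>. K' \<omega> = n} \<omega> \<partial>N)"
    by (rule power_series_unique[OF nn_integral_power_eq[OF M]]) (simp_all add: eq nn_integral_power_eq[OF N])
  from arg_cong[OF this, of ennreal] show ?thesis
    by (simp only: ennreal_enn2real fin[OF M(1) M(4)] fin[OF N(1) N(4)])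
qed

text \<open>Digits occupy positions 1 to \<open>n\<close>, so the bound is one power higher than the
  top position. The alternative \<open>b = 0\<close> covers the empty sum, where no digit forces
  \<open>b\<close> to be positive.\<close>

lemma digit_sum_less:
  fixes b :: nat
  assumes "\<And>k. k \<in> {1..n} \<Longrightarrow> c k < b"
  shows "(\<Sum>k\<in>{1..n}. b ^ k * c k) < b ^ Suc n \<or> b = 0"
  using assms
proof (induction n)
  case (Suc n)
  show ?case
  proof (cases "b = 0")
    case False
    have "(\<Sum>k\<in>{1..Suc n}. b ^ k * c k) = (\<Sum>k\<in>{1..n}. b ^ k * c k) + b ^ Suc n * c (Suc n)"
      by simp
    also have "\<dots> < b ^ Suc n + b ^ Suc n * c (Suc n)"
      using Suc False by auto
    also have "\<dots> = b ^ Suc n * Suc (c (Suc n))" by simp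
    also have "\<dots> \<le> b ^ Suc n * b"
      using Suc.prems[of "Suc n"] by (intro mult_left_mono) auto
    finally show ?thesis by (simp add: mult_ac)
  qed auto
qed auto

text \<open>Division by \<open>b ^ Suc n\<close> isolates the top digit, because the lower part is
  smaller than that power; the remaining digits follow by induction.\<close>

lemma digit_sum_inj:
  fixes b :: nat
  assumes "\<And>k. k \<in> {1..n} \<Longrightarrow> c k < b" "\<And>k. k \<in> {1..n} \<Longrightarrow> c' k < b"
    and "(\<Sum>k\<in>{1..n}. b ^ k * c k) = (\<Sum>k\<in>{1..n}. b ^ k * c' k)" "k \<in> {1..n}"
  shows "c k = c' k"
  using assms
proof (induction n arbitrary: k)
  case (Suc n)
  have b: "b > 0" using Suc.prems(1)[of "Suc n"] by auto
  have less: "(\<Sum>k\<in>{1..n}. b ^ k * c k) < b ^ Suc n" "(\<Sum>k\<in>{1..n}. b ^ k * c' k) < b ^ Suc n"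
    using digit_sum_less[of n c b] digit_sum_less[of n c' b] Suc.prems(1,2) b by auto
  have eq: "(\<Sum>k\<in>{1..n}. b ^ k * c k) + b ^ Suc n * c (Suc n) = (\<Sum>k\<in>{1..n}. b ^ k * c' k) + b ^ Suc n * c' (Suc n)"
    using Suc.prems(3) by simp
  have "((\<Sum>k\<in>{1..n}. b ^ k * c k) + b ^ Suc n * c (Suc n)) div b ^ Suc n = c (Suc n)"
    "((\<Sum>k\<in>{1..n}. b ^ k * c' k) + b ^ Suc n * c' (Suc n)) div b ^ Suc n = c' (Suc n)"
    using less b by (simp_all del: power_Suc)
  hence last: "c (Suc n) = c' (Suc n)" using eq by metis
  show ?case
  proof (cases "k = Suc n")
    case False
    hence "k \<in> {1..n}" using Suc.prems(4) by auto
    thus ?thesis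
      by (intro Suc.IH) (use Suc.prems(1,2) eq last in auto)
  qed (simp add: last)
qed simp

text \<open>This turns order statistics into counts. The indices whose entries are at most
  \<open>T\<close> form an initial segment, and its length is the number of points up to
  \<open>T\<close>.\<close>

lemma sorted_list_of_set_nth_le_iff:
  fixes D :: "real set"
  assumes D: "finite D" and i: "i < card D"
  shows "sorted_list_of_set D ! i \<le> T \<longleftrightarrow> Suc i \<le> card {x \<in> D. x \<le> T}"
proof -
  define xs where "xs = sorted_list_of_set D"
  have xs: "sorted xs" "distinct xs" "set xs = D" "length xs = card D"
    using D by (auto simp: xs_def)
  define J where "J = {j. j < length xs \<and> xs ! j \<le> T}"
  have "{x \<in> D. x \<le> T} = (\<lambda>j. xs ! j) ` J"
    unfolding J_def xs(3)[symmetric] by (auto simp: in_set_conv_nth)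
  moreover have "inj_on (\<lambda>j. xs ! j) J"
    using xs(2) by (auto simp: inj_on_def J_def nth_eq_iff_index_eq)
  ultimately have card: "card {x \<in> D. x \<le> T} = card J" by (simp add: card_image)
  have "finite J" by (simp add: J_def)
  show ?thesis
  proof
    assume le: "sorted_list_of_set D ! i \<le> T"
    have "{..i} \<subseteq> J"
      using le i sorted_nth_mono[OF xs(1)] by (fastforce simp: J_def xs(4) simp flip: xs_def)
    from card_mono[OF \<open>finite J\<close> this] show "Suc i \<le> card {x \<in> D. x \<le> T}" by (simp add: card)
  next
    assume ge: "Suc i \<le> card {x \<in> D. x \<le> T}"
    show "sorted_list_of_set D ! i \<le> T"
    proof (rule ccontr)
      assume "\<not> sorted_list_of_set D ! i \<le> T"
      hence gt: "T < xs ! i" by (simp add: xs_def)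
      have "J \<subseteq> {..<i}"
      proof
        fix j assume j: "j \<in> J"
        show "j \<in> {..<i}"
        proof (rule ccontr)
          assume "j \<notin> {..<i}"
          hence "xs ! i \<le> xs ! j" using j by (intro sorted_nth_mono[OF xs(1)]) (auto simp: J_def)
          thus False using j gt by (auto simp: J_def)
        qed
      qed
      from card_mono[OF _ this] show False using ge by (simp add: card)
    qed
  qed
qed

text \<open>The common interface of the two sides. \<open>cnt\<close> and \<open>tot\<close> are
  measurable versions of the counts, while the path functionals \<open>D\<close>, \<open>m\<close>
  and \<open>U\<close> are tied to them only almost everywhere.\<close>

locale ordered_points = prob_space M
  for M :: "'a measure" +
  fixes D :: "'a \<Rightarrow> real set" and cnt :: "real \<Rightarrow> 'a \<Rightarrow> nat" and tot :: "'a \<Rightarrow> nat"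
    and m :: "'a \<Rightarrow> enat" and U :: "nat \<Rightarrow> 'a \<Rightarrow> real"
  assumes cnt_measurable [measurable]: "\<And>T. cnt T \<in> M \<rightarrow>\<^sub>M count_space UNIV"
    and tot_measurable [measurable]: "tot \<in> M \<rightarrow>\<^sub>M count_space UNIV"
    and finite_D: "AE \<omega> in M. finite (D \<omega>)"
    and cnt_eq: "AE \<omega> in M. \<forall>T. cnt T \<omega> = card {x \<in> D \<omega>. x \<le> T}"
    and tot_eq: "AE \<omega> in M. tot \<omega> = card (D \<omega>)"
    and m_eq: "AE \<omega> in M. m \<omega> = enat (card (D \<omega>))"
    and U_eq: "AE \<omega> in M. \<forall>k\<le>card (D \<omega>). U k \<omega> = (0 # sorted_list_of_set (D \<omega>)) ! k"

text \<open>
  The functional of this function is the double generating function, in \<open>\<theta>\<close> and \<open>s\<close>, of the number of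
  points and of the number whose \<open>k\<close>-th digit in base \<open>r + 1\<close> counts the points below \<open>t k\<close>. If there
  are \<open>r\<close> points there is no carry, so the digits, hence all counts, are recovered.
\<close>

definition test_function :: "(nat \<Rightarrow> real) \<Rightarrow> nat \<Rightarrow> real \<Rightarrow> real \<Rightarrow> real \<Rightarrow> real" where
  "test_function t r \<theta> s x = \<theta> * (\<Prod>k\<in>{1..r}. 1 + (s ^ (Suc r ^ k) - 1) * indicator {..t k} x)"

lemma regular_test_function:
  assumes "0 < \<theta>" "\<theta> < 1" "0 < s" "s < 1"
  shows "regular (test_function t r \<theta> s)"
proof -
  have factor: "0 \<le> 1 + (s ^ n - 1) * indicator {..a} x \<and> 1 + (s ^ n - 1) * indicator {..a} x \<le> (1::real)" for n a x
    using assms by (auto simp: indicator_def power_le_one)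
  have "test_function t r \<theta> s \<in> borel_measurable borel"
    unfolding test_function_def[abs_def] by measurable
  moreover have "0 \<le> test_function t r \<theta> s x \<and> test_function t r \<theta> s x \<le> 1" for x
    unfolding test_function_def using factor assms
    by (intro conjI mult_nonneg_nonneg mult_le_one prod_nonneg prod_le_1) auto
  moreover have "isCont (test_function t r \<theta> s) x" if "x \<notin> t ` {1..r}" for x
    unfolding test_function_def[abs_def] using that
    by (intro continuous_mult continuous_prod continuous_add continuous_const isCont_indicator_atMost) auto
  ultimately show ?thesis
    unfolding regular_def by (auto intro!: exI[of _ "t ` {1..r}"])
qed

context ordered_points
begin

definition code :: "(nat \<Rightarrow> real) \<Rightarrow> nat \<Rightarrow> 'a \<Rightarrow> nat" where
  "code t r \<omega> = (\<Sum>k\<in>{1..r}. Suc r ^ k * cnt (t k) \<omega>)"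

lemma code_measurable [measurable]: "code t r \<in> M \<rightarrow>\<^sub>M count_space UNIV"
  unfolding code_def[abs_def] by measurable

text \<open>Exchanging the products over points and thresholds, each threshold contributes
  \<open>s\<close> to the power of its place value once per point below it.\<close>

lemma prod_test_function:
  "AE \<omega> in M. (\<Prod>x\<in>D \<omega>. test_function t r \<theta> s x) = \<theta> ^ tot \<omega> * s ^ code t r \<omega>"
  using finite_D cnt_eq tot_eq
proof eventually_elim
  case (elim \<omega>)
  have "(\<Prod>x\<in>D \<omega>. 1 + (s ^ n - 1) * indicator {..a} x) = (s ^ n) ^ cnt a \<omega>" for n a
  proof -
    have "(\<Prod>x\<in>D \<omega>. 1 + (s ^ n - 1) * indicator {..a} x) = (\<Prod>x\<in>{x \<in> D \<omega>. x \<le> a}. s ^ n)"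
      using elim(1) by (intro prod.mono_neutral_cong_right) auto
    thus ?thesis using elim(2) by simp
  qed
  hence "(\<Prod>x\<in>D \<omega>. \<Prod>k\<in>{1..r}. 1 + (s ^ (Suc r ^ k) - 1) * indicator {..t k} x) = s ^ code t r \<omega>"
    by (subst prod.swap) (simp add: code_def power_sum power_mult)
  thus ?case
    unfolding test_function_def prod.distrib using elim by simp
qed

definition level :: "nat \<Rightarrow> (nat \<Rightarrow> real) \<Rightarrow> 'a set" where
  "level r t = {\<omega> \<in> space M. tot \<omega> = r \<and> (\<forall>k\<in>{1..r}. k \<le> cnt (t k) \<omega>)}"

text \<open>\<open>G r\<close> lists the codes whose k-th digit lies between \<open>k\<close> and
  \<open>r\<close>. On \<open>tot = r\<close> the counts are digits in base \<open>r + 1\<close>, so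
  the code determines them and the event is a finite disjoint union of code events.\<close>

lemma level_decode:
  defines "G \<equiv> \<lambda>r. {\<Sum>k\<in>{1..r}. Suc r ^ k * c k | c. \<forall>k\<in>{1..r}. k \<le> c k \<and> c k \<le> (r::nat)}"
  shows "emeasure M (level r t) = (\<Sum>n\<in>G r. emeasure M {\<omega> \<in> space M. tot \<omega> = r \<and> code t r \<omega> = n})"
proof -
  have fin: "finite (G r)"
  proof (rule finite_subset)
    show "G r \<subseteq> {..(\<Sum>k\<in>{1..r}. Suc r ^ k * r)}"
      unfolding G_def by (auto intro!: sum_mono mult_left_mono)
  qed simp
  have "AE \<omega> in M. \<omega> \<in> level r t \<longleftrightarrow> \<omega> \<in> (\<Union>n\<in>G r. {\<omega> \<in> space M. tot \<omega> = r \<and> code t r \<omega> = n})"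
    using finite_D cnt_eq tot_eq AE_space
  proof eventually_elim
    case (elim \<omega>)
    have le: "cnt a \<omega> \<le> tot \<omega>" for a
      unfolding elim(2)[rule_format] elim(3) by (intro card_mono elim(1)) auto
    show ?case
    proof
      assume "\<omega> \<in> level r t"
      hence "tot \<omega> = r" "code t r \<omega> \<in> G r"
        using le by (auto simp: level_def G_def code_def intro!: exI[of _ "\<lambda>k. cnt (t k) \<omega>"])
      thus "\<omega> \<in> (\<Union>n\<in>G r. {\<omega> \<in> space M. tot \<omega> = r \<and> code t r \<omega> = n})"
        using elim(4) by auto
    next
      assume "\<omega> \<in> (\<Union>n\<in>G r. {\<omega> \<in> space M. tot \<omega> = r \<and> code t r \<omega> = n})"
      then obtain c where r: "tot \<omega> = r" and c: "\<forall>k\<in>{1..r}. k \<le> c k \<and> c k \<le> r"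
        and code: "(\<Sum>k\<in>{1..r}. Suc r ^ k * cnt (t k) \<omega>) = (\<Sum>k\<in>{1..r}. Suc r ^ k * c k)"
        by (auto simp: G_def code_def)
      have "cnt (t k) \<omega> = c k" if "k \<in> {1..r}" for k
        by (rule digit_sum_inj[OF _ _ code that])
           (use le[unfolded r] c in \<open>auto simp: less_Suc_eq_le\<close>)
      thus "\<omega> \<in> level r t" using r c elim(4) by (auto simp: level_def)
    qed
  qed
  hence "emeasure M (level r t) = emeasure M (\<Union>n\<in>G r. {\<omega> \<in> space M. tot \<omega> = r \<and> code t r \<omega> = n})"
    by (rule emeasure_eq_AE) (use fin in \<open>auto simp: level_def\<close>)
  also have "\<dots> = (\<Sum>n\<in>G r. emeasure M {\<omega> \<in> space M. tot \<omega> = r \<and> code t r \<omega> = n})"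
    by (rule sum_emeasure[symmetric]) (use fin in \<open>auto simp: disjoint_family_on_def\<close>)
  finally show ?thesis .
qed

definition statistics :: "nat \<Rightarrow> 'a \<Rightarrow> nat \<Rightarrow> real" where
  "statistics r \<omega> = (\<lambda>k\<in>{0..r}. if tot \<omega> = r then U k \<omega> else 0)"

text \<open>A subprobability: the joint law of \<open>U 0\<close>, ..., \<open>U r\<close>
  restricted to the event of exactly \<open>r\<close> points. The completion is used because
  \<open>U\<close> itself need only be measurable up to null sets.\<close>

definition statistics_law :: "nat \<Rightarrow> (nat \<Rightarrow> real) measure" where
  "statistics_law r = distr (density (completion M) (indicator {\<omega>. tot \<omega> = r})) (PiM {0..r} (\<lambda>_. borel)) (statistics r)"

text \<open>\<open>U 0\<close> is the prepended 0, so \<open>U k\<close> is entry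
  \<open>k - 1\<close> of the sorted list of points; this shift makes the condition read
  \<open>k \<le> cnt a \<omega>\<close>.\<close>

lemma AE_order: "AE \<omega> in M. tot \<omega> = r \<longrightarrow>
   U 0 \<omega> = 0 \<and> (\<forall>k\<in>{1..r}. \<forall>a. U k \<omega> \<le> a \<longleftrightarrow> k \<le> cnt a \<omega>)"
  using finite_D cnt_eq tot_eq U_eq
proof eventually_elim
  case (elim \<omega>)
  have "U k \<omega> \<le> a \<longleftrightarrow> k \<le> cnt a \<omega>" if "tot \<omega> = r" "k \<in> {1..r}" for k a
    using sorted_list_of_set_nth_le_iff[OF elim(1), of "k - 1" a] that elim by auto
  thus ?case using elim(4) by auto
qed

interpretation completion: complete_measure "completion M" by (rule completion.complete_measure_axioms)

text \<open>Each event that a coordinate is at most \<open>a\<close> agrees almost everywhere with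
  an event described by \<open>cnt\<close> and \<open>tot\<close>, and a complete sigma-algebra
  contains every set differing from a member by a null set.\<close>

lemma statistics_measurable: "statistics r \<in> completion M \<rightarrow>\<^sub>M PiM {0..r} (\<lambda>_. borel)"
  unfolding statistics_def
proof (rule measurable_restrict, rule borel_measurableI_le)
  fix k a assume k: "k \<in> {0..r}"
  let ?A = "{\<omega> \<in> space M. (tot \<omega> = r \<longrightarrow> (if k = 0 then 0 \<le> a else k \<le> cnt a \<omega>)) \<and> (tot \<omega> \<noteq> r \<longrightarrow> 0 \<le> a)}"
  have ae: "AE \<omega> in completion M. \<omega> \<in> ?A \<longleftrightarrow> \<omega> \<in> {\<omega> \<in> space (completion M). (if tot \<omega> = r then U k \<omega> else 0) \<le> a}"
    by (rule AE_completion, use AE_order[of r] AE_space in eventually_elim) (use k in auto)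
  have A: "?A \<in> sets M" by (cases "k = 0") simp_all
  show "{\<omega> \<in> space (completion M). (if tot \<omega> = r then U k \<omega> else 0) \<le> a} \<in> sets (completion M)"
    by (rule completion.in_sets_AE[OF ae sets_completionI_sets[OF A]]) blast
qed

lemma event_law:
  assumes A: "A \<in> sets (PiM {0..r} (\<lambda>_. borel :: real measure))"
  defines "E \<equiv> {\<omega> \<in> space M. m \<omega> = enat r \<and> (\<lambda>k\<in>{0..r}. U k \<omega>) \<in> A}"
  shows "E \<in> sets (completion M)" "emeasure (completion M) E = emeasure (statistics_law r) A"
proof -
  note [measurable] = statistics_measurable measurable_completion[OF tot_measurable]
  let ?F = "{\<omega> \<in> space (completion M). tot \<omega> = r \<and> statistics r \<omega> \<in> A}"
  have F: "?F \<in> sets (completion M)"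
    using A by measurable
  have ae: "AE \<omega> in completion M. \<omega> \<in> ?F \<longleftrightarrow> \<omega> \<in> E"
    by (rule AE_completion, use m_eq tot_eq in eventually_elim)
       (auto simp: E_def statistics_def cong: restrict_cong)
  show E: "E \<in> sets (completion M)"
    by (rule completion.in_sets_AE[OF ae F]) (auto simp: E_def)
  have "emeasure (completion M) E = emeasure (completion M) ?F"
    by (rule emeasure_eq_AE[OF _ E F]) (use ae in auto)
  also have "\<dots> = (\<integral>\<^sup>+\<omega>. indicator {\<omega>. tot \<omega> = r} \<omega> * indicator (statistics r -` A \<inter> space (completion M)) \<omega> \<partial>completion M)"
    unfolding nn_integral_indicator[OF F, symmetric]
    by (intro nn_integral_cong) (auto simp: indicator_def)
  also have "\<dots> = emeasure (statistics_law r) A"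
    unfolding statistics_law_def using A measurable_sets[OF statistics_measurable A]
    by (subst emeasure_distr, simp, simp, subst emeasure_density) (auto simp: indicator_def)
  finally show "emeasure (completion M) E = emeasure (statistics_law r) A" .
qed

text \<open>Coordinate 0 is almost surely 0, so its constraint is the deterministic condition
  \<open>0 \<le> a 0\<close>; the remaining constraints are conditions on counts.\<close>

lemma statistics_law_box:
  "emeasure (statistics_law r) {f \<in> space (PiM {0..r} (\<lambda>_. borel)). \<forall>k\<in>{0..r}. f k \<le> a k} =
    (if 0 \<le> a 0 then emeasure M (level r a) else 0)"
proof -
  let ?A = "{f \<in> space (PiM {0..r} (\<lambda>_. borel :: real measure)). \<forall>k\<in>{0..r}. f k \<le> a k}"
  let ?E = "{\<omega> \<in> space M. m \<omega> = enat r \<and> (\<lambda>k\<in>{0..r}. U k \<omega>) \<in> ?A}"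
  let ?L = "if 0 \<le> a 0 then level r a else {}"
  have A: "?A \<in> sets (PiM {0..r} (\<lambda>_. borel))" by measurable
  have L: "?L \<in> sets M" unfolding level_def by auto
  have "AE \<omega> in completion M. \<omega> \<in> ?E \<longleftrightarrow> \<omega> \<in> ?L"
  proof (rule AE_completion, use AE_order[of r] m_eq tot_eq AE_space in eventually_elim)
    case (elim \<omega>)
    have split: "{0..r} = insert 0 {1..r}" by auto
    show ?case
    proof (cases "tot \<omega> = r")
      case True
      have "\<omega> \<in> ?E \<longleftrightarrow> (\<forall>k\<in>{0..r}. U k \<omega> \<le> a k)"
        using elim True by (auto simp: space_PiM PiE_iff extensional_def)
      also have "\<dots> \<longleftrightarrow> 0 \<le> a 0 \<and> (\<forall>k\<in>{1..r}. k \<le> cnt (a k) \<omega>)"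
        unfolding split using elim True by auto
      finally show ?thesis using True elim by (auto simp: level_def)
    next
      case False
      thus ?thesis using elim by (auto simp: level_def)
    qed
  qed
  hence eq: "emeasure (completion M) ?E = emeasure (completion M) ?L"
    by (rule emeasure_eq_AE[OF _ event_law(1)[OF A]]) (use L in auto)
  have "emeasure (statistics_law r) ?A = emeasure (completion M) ?E"
    by (rule event_law(2)[OF A, symmetric])
  also note eq
  also have "emeasure (completion M) ?L = emeasure M ?L" using L by simp
  finally show ?thesis by simp
qed

lemma emeasure_level_code:
  "emeasure M {\<omega> \<in> space M. tot \<omega> = r \<and> code t r \<omega> = n} =
    (\<integral>\<^sup>+\<omega>. indicator {\<omega>. tot \<omega> = r} \<omega> * indicator {\<omega>. code t r \<omega> = n} \<omega> \<partial>M)"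
proof -
  have "(\<integral>\<^sup>+\<omega>. indicator {\<omega>. tot \<omega> = r} \<omega> * indicator {\<omega>. code t r \<omega> = n} \<omega> \<partial>M) =
      (\<integral>\<^sup>+\<omega>. indicator {\<omega> \<in> space M. tot \<omega> = r \<and> code t r \<omega> = n} \<omega> \<partial>M)"
    by (intro nn_integral_cong) (auto simp: indicator_def)
  thus ?thesis by simp
qed

end

theorem same_finite_sequence_law_pgf:
  assumes "ordered_points M D cnt tot m U" and "ordered_points N D' cnt' tot' n V"
    and pgf: "\<And>\<phi>. regular \<phi> \<Longrightarrow> (\<integral>\<^sup>+\<omega>. ennreal (\<Prod>x\<in>D \<omega>. \<phi> x) \<partial>M) = (\<integral>\<^sup>+\<omega>. ennreal (\<Prod>x\<in>D' \<omega>. \<phi> x) \<partial>N)"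
  shows "same_finite_sequence_law M m U N n V"
proof -
  interpret M: ordered_points M D cnt tot m U by fact
  interpret N: ordered_points N D' cnt' tot' n V by fact
  have double_pgf: "(\<integral>\<^sup>+\<omega>. ennreal (s ^ M.code t r \<omega>) * ennreal (\<theta> ^ tot \<omega>) \<partial>M) =
      (\<integral>\<^sup>+\<omega>. ennreal (s ^ N.code t r \<omega>) * ennreal (\<theta> ^ tot' \<omega>) \<partial>N)"
    if "0 < s" "s < 1" "0 < \<theta>" "\<theta> < 1" for s \<theta> t r
  proof -
    have "(\<integral>\<^sup>+\<omega>. ennreal (s ^ M.code t r \<omega>) * ennreal (\<theta> ^ tot \<omega>) \<partial>M) =
        (\<integral>\<^sup>+\<omega>. ennreal (\<Prod>x\<in>D \<omega>. test_function t r \<theta> s x) \<partial>M)"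
      by (rule nn_integral_cong_AE, use M.prod_test_function[of t r \<theta> s] in eventually_elim)
         (use that in \<open>simp add: mult.commute flip: ennreal_mult\<close>)
    also have "\<dots> = (\<integral>\<^sup>+\<omega>. ennreal (\<Prod>x\<in>D' \<omega>. test_function t r \<theta> s x) \<partial>N)"
      by (rule pgf[OF regular_test_function]) (use that in auto)
    also have "\<dots> = (\<integral>\<^sup>+\<omega>. ennreal (s ^ N.code t r \<omega>) * ennreal (\<theta> ^ tot' \<omega>) \<partial>N)"
      by (rule nn_integral_cong_AE, use N.prod_test_function[of t r \<theta> s] in eventually_elim)
         (use that in \<open>simp add: mult.commute flip: ennreal_mult\<close>)
    finally show ?thesis .
  qed
  \<comment> \<open>Inversion in \<theta>, with the power of \<open>s\<close> as the weight, fixes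
    the total.\<close>
  have tot_pgf: "(\<integral>\<^sup>+\<omega>. ennreal (s ^ M.code t r \<omega>) * indicator {\<omega>. tot \<omega> = q} \<omega> \<partial>M) =
      (\<integral>\<^sup>+\<omega>. ennreal (s ^ N.code t r \<omega>) * indicator {\<omega>. tot' \<omega> = q} \<omega> \<partial>N)"
    if "0 < s" "s < 1" for s t r q
    by (rule pgf_unique[OF M.prob_space_axioms M.tot_measurable _ _ N.prob_space_axioms N.tot_measurable])
       (use that double_pgf in \<open>auto simp: power_le_one\<close>)
  \<comment> \<open>Inversion in \<open>s\<close>, now with the indicator of the total as the
    weight, gives the joint law of total and code.\<close>
  have code_law: "emeasure M {\<omega> \<in> space M. tot \<omega> = r \<and> M.code t r \<omega> = q} =
      emeasure N {\<omega> \<in> space N. tot' \<omega> = r \<and> N.code t r \<omega> = q}" for t r q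
    unfolding M.emeasure_level_code N.emeasure_level_code
    by (rule pgf_unique[OF M.prob_space_axioms M.code_measurable _ _ N.prob_space_axioms N.code_measurable])
       (use tot_pgf in \<open>auto simp: mult.commute indicator_def\<close>)
  have level: "emeasure M (M.level r t) = emeasure N (N.level r t)" for r t
    unfolding M.level_decode N.level_decode by (simp add: code_law)
  have law: "M.statistics_law r = N.statistics_law r" for r
  proof (rule measure_eqI_PiM_atMost[of "{0..r}"])
    have "emeasure (M.statistics_law r) (space (PiM {0..r} (\<lambda>_. borel))) \<le> emeasure (completion M) (space M)"
      unfolding M.event_law(2)[OF sets.top, symmetric] by (intro emeasure_mono) auto
    hence "emeasure (M.statistics_law r) (space (M.statistics_law r)) < \<top>"
      by (auto simp: M.emeasure_space_1 M.statistics_law_def intro: le_less_trans)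
    thus "finite_measure (M.statistics_law r)"
      by (intro finite_measureI) auto
    show "emeasure (M.statistics_law r) {f \<in> space (PiM {0..r} (\<lambda>_. borel)). \<forall>i\<in>{0..r}. f i \<le> a i} =
      emeasure (N.statistics_law r) {f \<in> space (PiM {0..r} (\<lambda>_. borel)). \<forall>i\<in>{0..r}. f i \<le> a i}" for a
      unfolding M.statistics_law_box N.statistics_law_box level ..
  qed (auto simp: M.statistics_law_def N.statistics_law_def)
  show ?thesis
    unfolding same_finite_sequence_law_def Let_def
  proof (intro conjI allI ballI)
    show "AE \<omega> in M. m \<omega> < \<infinity>" using M.m_eq by eventually_elim simp
    show "AE \<omega> in N. n \<omega> < \<infinity>" using N.m_eq by eventually_elim simp
    fix r and A :: "(nat \<Rightarrow> real) set" assume A: "A \<in> sets (PiM {0..r} (\<lambda>_. borel))"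
    show "{\<omega> \<in> space M. m \<omega> = enat r \<and> (\<lambda>k\<in>{0..r}. U k \<omega>) \<in> A} \<in> sets (completion M)"
      by (rule M.event_law(1)[OF A])
    show "{\<omega> \<in> space N. n \<omega> = enat r \<and> (\<lambda>k\<in>{0..r}. V k \<omega>) \<in> A} \<in> sets (completion N)"
      by (rule N.event_law(1)[OF A])
    show "measure (completion M) {\<omega> \<in> space M. m \<omega> = enat r \<and> (\<lambda>k\<in>{0..r}. U k \<omega>) \<in> A} =
        measure (completion N) {\<omega> \<in> space N. n \<omega> = enat r \<and> (\<lambda>k\<in>{0..r}. V k \<omega>) \<in> A}"
      unfolding measure_def M.event_law(2)[OF A] N.event_law(2)[OF A] law ..
  qed
qed

section \<open>Order statistics of the walk\<close>

text \<open>The law of \<open>Y\<close> has no atoms, so for every fixed value of \<open>Z\<close>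
  coincidence has probability 0; independence and Fubini conclude.\<close>

lemma (in prob_space) AE_indep_var_neq:
  fixes Y Z :: "'a \<Rightarrow> real"
  assumes ind: "indep_var borel Z borel Y" and Y: "distributed M lborel Y f"
  shows "AE \<omega> in M. Y \<omega> \<noteq> Z \<omega>"
proof -
  have [measurable]: "Y \<in> borel_measurable M" "Z \<in> borel_measurable M"
    using indep_var_rv2[OF ind] indep_var_rv1[OF ind] by auto
  have "distr M borel Y = density lborel f"
    using distributed_distr_eq_density[OF Y] by (simp cong: distr_cong)
  interpret Y: prob_space "distr M borel Y" by (rule prob_space_distr) simp
  interpret Z: prob_space "distr M borel Z" by (rule prob_space_distr) simp
  interpret ZY: pair_sigma_finite "distr M borel Z" "distr M borel Y" ..
  have "AE y in distr M borel Y. z \<noteq> y" for z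
    unfolding \<open>distr M borel Y = density lborel f\<close> using AE_lborel_singleton[of z]
    by (subst AE_density) (use distributed_borel_measurable[OF Y] in \<open>auto elim: eventually_mono\<close>)
  moreover have "Measurable.pred (distr M borel Z \<Otimes>\<^sub>M distr M borel Y) (\<lambda>q. fst q \<noteq> snd q)"
    by measurable
  ultimately have "AE q in distr M borel Z \<Otimes>\<^sub>M distr M borel Y. fst q \<noteq> snd q"
    by (intro ZY.AE_pair_measure) (simp_all add: pred_def)
  also have "distr M borel Z \<Otimes>\<^sub>M distr M borel Y = distr M (borel \<Otimes>\<^sub>M borel) (\<lambda>\<omega>. (Z \<omega>, Y \<omega>))"
    using ind by (simp add: indep_var_distribution_eq)
  finally show ?thesis
    by (subst (asm) AE_distr_iff) (auto elim: eventually_mono)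
qed

locale laplace_walk = prob_space M
  for M :: "'a measure" +
  fixes X :: "nat \<Rightarrow> 'a \<Rightarrow> real"
  assumes indep: "indep_vars (\<lambda>_. borel) X UNIV"
    and X_distributed: "\<And>i. distributed M lborel (X i) (\<lambda>x. ennreal (1 / 2 * exp (- \<bar>x\<bar>)))"
begin

abbreviation \<xi> :: "'a \<Rightarrow> nat \<Rightarrow> real" where "\<xi> \<omega> \<equiv> \<lambda>i. X i \<omega>"

lemma X_measurable [measurable]: "X i \<in> borel_measurable M"
  using X_distributed by (auto simp: distributed_def)

lemma \<xi>_measurable [measurable]: "\<xi> \<in> M \<rightarrow>\<^sub>M increments"
  by (rule measurable_PiM_single') (auto simp: measurable_cong_sets[OF refl sets_laplace])

lemma distr_\<xi>: "distr M increments \<xi> = increments"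
proof -
  have "distr M laplace (X i) = laplace" for i
    using distributed_distr_eq_density[OF X_distributed[of i]]
    by (simp add: laplace_def cong: distr_cong)
  moreover have "indep_vars (\<lambda>_. laplace) X UNIV"
    using indep_vars_compose2[OF indep, of "\<lambda>_ x. x" "\<lambda>_. laplace"]
    by (auto simp: measurable_cong_sets[OF refl sets_laplace])
  ultimately show ?thesis
    by (subst (asm) indep_vars_iff_distr_eq_PiM')
       (auto simp: restrict_UNIV measurable_cong_sets[OF refl sets_laplace])
qed

lemma walk_eq_site: "walk X k \<omega> = site 0 (\<xi> \<omega>) k"
  by (simp add: walk_def site_def)

lemma walk_measurable [measurable]: "walk X k \<in> borel_measurable M"
  unfolding walk_eq_site[abs_def] by measurable

abbreviation exit_at :: "nat \<Rightarrow> 'a \<Rightarrow> bool" where "exit_at r \<omega> \<equiv> exits 0 (\<xi> \<omega>) r"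

lemma nu_exit:
  assumes "exit_at r \<omega>" shows "nu X \<omega> = enat r"
proof -
  have ge: "Suc r \<le> k" if "1 \<le> k" "walk X k \<omega> < 0" for k
  proof (rule ccontr)
    assume "\<not> Suc r \<le> k"
    hence "k \<in> {1..r}" using that by auto
    hence "0 \<le> walk X k \<omega>" using assms unfolding exits_def walk_eq_site by blast
    thus False using that by simp
  qed
  have "tau_minus X \<omega> = enat (Suc r)"
    unfolding tau_minus_def
  proof (rule antisym)
    show "Inf (enat ` {k. 1 \<le> k \<and> walk X k \<omega> < 0}) \<le> enat (Suc r)"
      using assms by (intro Inf_lower) (auto simp: exits_def walk_eq_site)
    show "enat (Suc r) \<le> Inf (enat ` {k. 1 \<le> k \<and> walk X k \<omega> < 0})"
      using ge by (intro Inf_greatest) auto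
  qed
  thus ?thesis by (simp add: nu_def one_enat_def)
qed

lemma nu_no_exit:
  assumes "\<And>r. \<not> exit_at r \<omega>" shows "nu X \<omega> = \<infinity>"
proof -
  have "\<not> (\<exists>k. 1 \<le> k \<and> walk X k \<omega> < 0)"
  proof
    assume ex: "\<exists>k. 1 \<le> k \<and> walk X k \<omega> < 0"
    define k where "k = (LEAST k. 1 \<le> k \<and> walk X k \<omega> < 0)"
    have k: "1 \<le> k \<and> walk X k \<omega> < 0"
      unfolding k_def using ex by (rule LeastI_ex)
    have "0 \<le> walk X j \<omega>" if "j \<in> {1..k - 1}" for j
    proof -
      have "j < k" using that by auto
      hence "\<not> (1 \<le> j \<and> walk X j \<omega> < 0)" unfolding k_def by (rule not_less_Least)
      thus ?thesis using that by auto
    qed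
    hence "exit_at (k - 1) \<omega>"
      using k by (auto simp: exits_def walk_eq_site)
    thus False using assms by blast
  qed
  hence "{k. 1 \<le> k \<and> walk X k \<omega> < 0} = {}" by auto
  hence "tau_minus X \<omega> = \<infinity>"
    unfolding tau_minus_def by (simp only: image_empty Inf_empty top_enat_def)
  thus ?thesis by (simp add: nu_def one_enat_def)
qed

lemma walk_functional_integral:
  assumes \<phi>: "regular \<phi>"
  shows "(\<integral>\<^sup>+\<omega>. walk_functional \<phi> 0 (\<xi> \<omega>) \<partial>M) = ennreal (1 / (2 - tree_pgf \<phi> 0))"
proof -
  note [measurable] = regular_measurable[OF \<phi>]
  have "(\<integral>\<^sup>+\<omega>. walk_functional \<phi> 0 (\<xi> \<omega>) \<partial>M) = (\<integral>\<^sup>+x. walk_functional \<phi> 0 x \<partial>distr M increments \<xi>)"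
    by (subst nn_integral_distr) auto
  thus ?thesis by (simp add: distr_\<xi> walk_functional_pgf[OF \<phi>])
qed

lemma walk_functional_indicator:
  "walk_functional (indicator A) 0 (\<xi> \<omega>) = indicator {\<omega>. \<exists>r. exit_at r \<omega> \<and> (\<forall>k\<in>{1..r}. walk X k \<omega> \<in> A)} \<omega>"
proof (cases "\<exists>r. exit_at r \<omega>")
  case True
  then obtain r where r: "exit_at r \<omega>" ..
  hence eq: "(\<exists>r. exit_at r \<omega> \<and> (\<forall>k\<in>{1..r}. walk X k \<omega> \<in> A)) \<longleftrightarrow> (\<forall>k\<in>{1..r}. walk X k \<omega> \<in> A)"
    by (auto dest: exits_unique)
  show ?thesis
  proof (cases "\<forall>k\<in>{1..r}. walk X k \<omega> \<in> A")
    case True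
    hence "(\<Prod>k\<in>{1..r}. indicator A (site 0 (\<xi> \<omega>) k)) = (1::real)"
      by (intro prod.neutral) (auto simp: walk_eq_site)
    thus ?thesis using True eq by (simp add: walk_functional_exits[OF r])
  next
    case False
    then obtain k where "k \<in> {1..r}" "site 0 (\<xi> \<omega>) k \<notin> A" by (auto simp: walk_eq_site)
    hence p0: "(\<Prod>k\<in>{1..r}. indicator A (site 0 (\<xi> \<omega>) k)) = (0::real)"
      by (intro prod_zero bexI[of _ k]) auto
    show ?thesis unfolding walk_functional_exits[OF r] p0 using False eq by simp
  qed
qed (simp add: walk_functional_not_exits)

text \<open>At \<phi> = 1 the walk functional is the indicator of becoming negative at some time,
  and its mean is 1 because the trees die out almost surely.\<close>

lemma AE_exit: "AE \<omega> in M. \<exists>r. exit_at r \<omega>"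
proof -
  have "(\<integral>\<^sup>+\<omega>. walk_functional (indicator UNIV) 0 (\<xi> \<omega>) \<partial>M) = 1"
    using walk_functional_integral[OF regular_1] by (simp add: tree_pgf_1 indicator_UNIV)
  also have "(\<integral>\<^sup>+\<omega>. walk_functional (indicator UNIV) 0 (\<xi> \<omega>) \<partial>M) =
      (\<integral>\<^sup>+\<omega>. indicator {\<omega> \<in> space M. \<exists>r. exit_at r \<omega>} \<omega> \<partial>M)"
    unfolding walk_functional_indicator by (intro nn_integral_cong) (auto simp: indicator_def)
  also have "\<dots> = emeasure M {\<omega> \<in> space M. \<exists>r. exit_at r \<omega>}"
    by (rule nn_integral_indicator) measurable
  finally have "prob {\<omega> \<in> space M. \<exists>r. exit_at r \<omega>} = 1"
    by (simp add: emeasure_eq_measure)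
  thus ?thesis by (subst (asm) prob_Collect_eq_1) auto
qed

text \<open>A tie at times i < j says that \<open>X i\<close> equals minus the sum of the increments
  strictly between; that sum is independent of \<open>X i\<close>, which has a density.\<close>

lemma AE_walk_distinct: "AE \<omega> in M. \<forall>i j. i < j \<longrightarrow> walk X i \<omega> \<noteq> walk X j \<omega>"
  unfolding AE_all_countable
proof (intro allI)
  fix i j :: nat
  show "AE \<omega> in M. i < j \<longrightarrow> walk X i \<omega> \<noteq> walk X j \<omega>"
  proof (cases "i < j")
    case True
    have "indep_var (PiM {i<..<j} (\<lambda>_. borel)) (\<lambda>\<omega>. restrict (\<lambda>l. X l \<omega>) {i<..<j})
        (PiM {i} (\<lambda>_. borel)) (\<lambda>\<omega>. restrict (\<lambda>l. X l \<omega>) {i})"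
      by (rule indep_var_restrict[OF indep]) auto
    from indep_var_compose[OF this, of "\<lambda>x. - (\<Sum>l\<in>{i<..<j}. x l)" borel "\<lambda>x. x i" borel]
    have "indep_var borel (\<lambda>\<omega>. - (\<Sum>l\<in>{i<..<j}. X l \<omega>)) borel (X i)"
      by (simp add: comp_def)
    from AE_indep_var_neq[OF this X_distributed] show ?thesis
    proof eventually_elim
      case (elim \<omega>)
      have "{..<j} = {..<i} \<union> insert i {i<..<j}" using True by auto
      hence "walk X j \<omega> = (\<Sum>l\<in>{..<i} \<union> insert i {i<..<j}. X l \<omega>)"
        by (simp only: walk_def)
      also have "\<dots> = walk X i \<omega> + (X i \<omega> + (\<Sum>l\<in>{i<..<j}. X l \<omega>))"
        unfolding walk_def by (subst sum.union_disjoint) auto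
      finally have "walk X j \<omega> = walk X i \<omega> + (X i \<omega> + (\<Sum>l\<in>{i<..<j}. X l \<omega>))" .
      thus ?case using elim by auto
    qed
  qed simp
qed

definition points :: "'a \<Rightarrow> real set" where
  "points \<omega> = (\<lambda>k. walk X k \<omega>) ` {k. 1 \<le> k \<and> enat k \<le> nu X \<omega>}"

text \<open>A version of \<open>nu X\<close> with natural-number values, whose measurability follows
  from that of \<open>exits\<close>; its value is left open on the null set of walks that never
  become negative.\<close>

definition exit_time :: "'a \<Rightarrow> nat" where "exit_time \<omega> = (LEAST r. exit_at r \<omega>)"

definition count_below :: "real \<Rightarrow> 'a \<Rightarrow> nat" where
  "count_below T \<omega> = (\<Sum>k\<in>{1..exit_time \<omega>}. if walk X k \<omega> \<le> T then 1 else 0)"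

lemma exit_time_measurable [measurable]: "exit_time \<in> M \<rightarrow>\<^sub>M count_space UNIV"
  unfolding exit_time_def[abs_def] by measurable

lemma count_below_measurable: "count_below T \<in> M \<rightarrow>\<^sub>M count_space UNIV"
  unfolding count_below_def[abs_def]
  by (rule measurable_compose_countable[OF _ exit_time_measurable]) measurable

lemma AE_good: "AE \<omega> in M. \<exists>r. exit_at r \<omega> \<and> inj_on (\<lambda>k. walk X k \<omega>) {0..r} \<and> (\<forall>k\<in>{1..r}. 0 < walk X k \<omega>)"
  using AE_exit AE_walk_distinct
proof eventually_elim
  case (elim \<omega>)
  then obtain r where r: "exit_at r \<omega>" by blast
  have "inj_on (\<lambda>k. walk X k \<omega>) {0..r}"
    using elim(2) by (intro linorder_inj_onI) auto
  moreover have "0 < walk X k \<omega>" if "k \<in> {1..r}" for k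
  proof -
    have "0 \<le> walk X k \<omega>" using r that by (auto simp: exits_def walk_eq_site)
    moreover have "walk X 0 \<omega> \<noteq> walk X k \<omega>" using elim(2) that by auto
    ultimately show ?thesis by (simp add: walk_def)
  qed
  ultimately show ?case using r by blast
qed

lemma good_path:
  assumes r: "exit_at r \<omega>" and inj: "inj_on (\<lambda>k. walk X k \<omega>) {0..r}" and pos: "\<forall>k\<in>{1..r}. 0 < walk X k \<omega>"
  shows "points \<omega> = (\<lambda>k. walk X k \<omega>) ` {1..r}" "card (points \<omega>) = r" "exit_time \<omega> = r"
    "count_below T \<omega> = card {x \<in> points \<omega>. x \<le> T}"
    "order_stat X k \<omega> = (0 # sorted_list_of_set (points \<omega>)) ! k"
proof -
  note nu = nu_exit[OF r]
  have inj1: "inj_on (\<lambda>k. walk X k \<omega>) {1..r}" by (rule inj_on_subset[OF inj]) auto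
  show pts: "points \<omega> = (\<lambda>k. walk X k \<omega>) ` {1..r}"
    unfolding points_def nu by (auto simp: image_iff)
  show "card (points \<omega>) = r"
    unfolding pts by (subst card_image[OF inj1]) simp
  show et: "exit_time \<omega> = r"
    unfolding exit_time_def using r by (intro Least_equality) (auto dest: exits_unique)
  have "{x \<in> points \<omega>. x \<le> T} = (\<lambda>k. walk X k \<omega>) ` {k \<in> {1..r}. walk X k \<omega> \<le> T}"
    unfolding pts by auto
  moreover have "inj_on (\<lambda>k. walk X k \<omega>) {k \<in> {1..r}. walk X k \<omega> \<le> T}"
    by (rule inj_on_subset[OF inj1]) auto
  ultimately have "card {x \<in> points \<omega>. x \<le> T} = card {k \<in> {1..r}. walk X k \<omega> \<le> T}"
    by (simp add: card_image)
  thus "count_below T \<omega> = card {x \<in> points \<omega>. x \<le> T}"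
    unfolding count_below_def et by (simp add: sum.If_cases Int_def)
  let ?xs = "map (\<lambda>j. walk X j \<omega>) [0..<Suc r]"
  have "set ?xs = (\<lambda>k. walk X k \<omega>) ` {0..r}"
    by (simp add: atLeastLessThanSuc_atLeastAtMost del: upt_Suc)
  also have "{0..r} = insert 0 {1..r}" by auto
  finally have set: "set ?xs = insert 0 (points \<omega>)"
    by (simp add: pts walk_def[of X 0])
  have "distinct ?xs"
    using inj by (simp add: distinct_map atLeastLessThanSuc_atLeastAtMost del: upt_Suc)
  hence "sort ?xs = sorted_list_of_set (insert 0 (points \<omega>))"
    unfolding set[symmetric] sorted_list_of_set_sort_remdups by (simp only: distinct_remdups_id)
  \<comment> \<open>All points are strictly positive, so the starting value 0 is the minimum and
    heads the sorted list.\<close>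
  also have "\<dots> = 0 # sorted_list_of_set (points \<omega>)"
  proof -
    have fin: "finite (points \<omega>)" and p: "\<forall>x\<in>points \<omega>. 0 < x" using pos by (auto simp: pts)
    have "Min (insert 0 (points \<omega>)) = 0"
      using fin p by (intro Min_eqI) auto
    moreover have "insert 0 (points \<omega>) - {0} = points \<omega>" using p by auto
    ultimately show ?thesis
      using sorted_list_of_set_nonempty[of "insert 0 (points \<omega>)"] fin by simp
  qed
  finally show "order_stat X k \<omega> = (0 # sorted_list_of_set (points \<omega>)) ! k"
    by (simp add: order_stat_def nu del: upt_Suc)
qed

lemma order_stat_strict: "AE \<omega> in M. \<exists>n. nu X \<omega> = enat n \<and> order_stat X 0 \<omega> = 0 \<and>
    (\<forall>k<n. order_stat X k \<omega> < order_stat X (Suc k) \<omega>)"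
  using AE_good
proof eventually_elim
  case (elim \<omega>)
  then obtain r where r: "exit_at r \<omega>" "inj_on (\<lambda>k. walk X k \<omega>) {0..r}" "\<forall>k\<in>{1..r}. 0 < walk X k \<omega>"
    by blast
  let ?ys = "0 # sorted_list_of_set (points \<omega>)"
  have "finite (points \<omega>)" "\<forall>x\<in>points \<omega>. 0 < x" using good_path(1)[OF r] r(3) by auto
  hence "sorted_wrt (<) ?ys" by simp
  moreover have "length ?ys = Suc r" using good_path(2)[OF r] by simp
  ultimately have "?ys ! k < ?ys ! Suc k" if "k < r" for k
    using sorted_wrt_nth_less[of "(<)" ?ys k "Suc k"] that by simp
  thus ?case
    using nu_exit[OF r(1)] good_path(5)[OF r] by (intro exI[of _ r]) auto
qed

lemma ordered_points_walk: "ordered_points M points count_below exit_time (nu X) (order_stat X)"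
proof
  show "AE \<omega> in M. finite (points \<omega>)"
    using AE_good by eventually_elim (auto simp: good_path(1))
  show "AE \<omega> in M. \<forall>T. count_below T \<omega> = card {x \<in> points \<omega>. x \<le> T}"
    using AE_good by eventually_elim (auto simp: good_path(4))
  show "AE \<omega> in M. exit_time \<omega> = card (points \<omega>)"
    using AE_good by eventually_elim (auto simp: good_path(2,3))
  show "AE \<omega> in M. nu X \<omega> = enat (card (points \<omega>))"
    using AE_good by eventually_elim (auto simp: good_path(2) nu_exit)
  show "AE \<omega> in M. \<forall>k\<le>card (points \<omega>). order_stat X k \<omega> = (0 # sorted_list_of_set (points \<omega>)) ! k"
    using AE_good by eventually_elim (auto simp: good_path(5))
qed (auto intro: count_below_measurable)

lemma points_pgf:
  assumes \<phi>: "regular \<phi>"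
  shows "(\<integral>\<^sup>+\<omega>. ennreal (\<Prod>x\<in>points \<omega>. \<phi> x) \<partial>M) = ennreal (1 / (2 - tree_pgf \<phi> 0))"
proof -
  have "AE \<omega> in M. ennreal (\<Prod>x\<in>points \<omega>. \<phi> x) = walk_functional \<phi> 0 (\<xi> \<omega>)"
    using AE_good
  proof eventually_elim
    case (elim \<omega>)
    then obtain r where r: "exit_at r \<omega>" "inj_on (\<lambda>k. walk X k \<omega>) {0..r}" "\<forall>k\<in>{1..r}. 0 < walk X k \<omega>"
      by blast
    have "inj_on (\<lambda>k. walk X k \<omega>) {1..r}" by (rule inj_on_subset[OF r(2)]) auto
    thus ?case
      by (simp add: good_path(1)[OF r] walk_functional_exits[OF r(1)] prod.reindex walk_eq_site)
  qed
  thus ?thesis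
    unfolding walk_functional_integral[OF \<phi>, symmetric] by (rule nn_integral_cong_AE)
qed

lemma max_order_stat:
  assumes "exit_at r \<omega>"
  shows "t < order_stat X r \<omega> \<longleftrightarrow> (\<exists>k\<in>{0..r}. t < walk X k \<omega>)"
proof -
  let ?xs = "map (\<lambda>j. walk X j \<omega>) [0..<Suc r]"
  have sorted: "sorted (sort ?xs)" by simp
  have set: "set (sort ?xs) = (\<lambda>k. walk X k \<omega>) ` {0..r}"
    by (simp add: atLeastLessThanSuc_atLeastAtMost del: upt_Suc)
  have len: "length (sort ?xs) = Suc r" by simp
  have "sort ?xs ! r \<in> set (sort ?xs)" by (rule nth_mem) (simp add: len)
  moreover have "x \<le> sort ?xs ! r" if "x \<in> set (sort ?xs)" for x
  proof -
    from that obtain j where "j < Suc r" "x = sort ?xs ! j"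
      unfolding in_set_conv_nth len by auto
    thus ?thesis using sorted_nth_mono[OF sorted, of j r] len by simp
  qed
  moreover have "order_stat X r \<omega> = sort ?xs ! r"
    by (simp add: order_stat_def nu_exit[OF assms] del: upt_Suc)
  ultimately show ?thesis
    unfolding set by (metis (no_types, lifting) image_iff less_le_trans)
qed

text \<open>The complementary event, all sites up to the exit at most \<open>t\<close>, has the walk
  functional of the indicator of \<open>{..t}\<close> as its indicator. Its mean is 1 / (2 - t / (1
  + t)) = (1 + t) / (2 + t).\<close>

lemma max_tail:
  assumes t: "0 < t"
  shows "measure M {\<omega> \<in> space M. nu X \<omega> < \<infinity> \<and> order_stat X (the_enat (nu X \<omega>)) \<omega> > t} = 1 / (2 + t)"
proof -
  let ?E = "{\<omega> \<in> space M. \<exists>r. exit_at r \<omega> \<and> (\<exists>k\<in>{0..r}. t < walk X k \<omega>)}"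
  let ?F = "{\<omega> \<in> space M. \<exists>r. exit_at r \<omega> \<and> (\<forall>k\<in>{1..r}. walk X k \<omega> \<in> {..t})}"
  have eq: "{\<omega> \<in> space M. nu X \<omega> < \<infinity> \<and> order_stat X (the_enat (nu X \<omega>)) \<omega> > t} = ?E"
  proof (intro Collect_cong conj_cong refl)
    fix \<omega>
    show "nu X \<omega> < \<infinity> \<and> order_stat X (the_enat (nu X \<omega>)) \<omega> > t \<longleftrightarrow>
        (\<exists>r. exit_at r \<omega> \<and> (\<exists>k\<in>{0..r}. t < walk X k \<omega>))"
    proof (cases "\<exists>r. exit_at r \<omega>")
      case True
      then obtain r where r: "exit_at r \<omega>" ..
      hence "(\<exists>r. exit_at r \<omega> \<and> (\<exists>k\<in>{0..r}. t < walk X k \<omega>)) \<longleftrightarrow> (\<exists>k\<in>{0..r}. t < walk X k \<omega>)"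
        by (blast dest: exits_unique)
      thus ?thesis using nu_exit[OF r] max_order_stat[OF r, of t] by simp
    qed (simp add: nu_no_exit)
  qed
  have meas: "?E \<in> sets M" "?F \<in> sets M" by measurable
  have "(\<integral>\<^sup>+\<omega>. walk_functional (indicator {..t}) 0 (\<xi> \<omega>) \<partial>M) = emeasure M ?F"
    unfolding walk_functional_indicator nn_integral_indicator[OF meas(2), symmetric]
    by (intro nn_integral_cong) (auto simp: indicator_def)
  also have "(\<integral>\<^sup>+\<omega>. walk_functional (indicator {..t}) 0 (\<xi> \<omega>) \<partial>M) = ennreal (1 / (2 - t / (1 + t)))"
    using walk_functional_integral[OF regular_indicator_atMost[of t]] by (simp add: tree_pgf_indicator[OF t])
  also have "1 / (2 - t / (1 + t)) = (1 + t) / (2 + t)"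
    using t by (simp add: field_simps)
  finally have "ennreal ((1 + t) / (2 + t)) = ennreal (prob ?F)"
    unfolding emeasure_eq_measure .
  hence F: "prob ?F = (1 + t) / (2 + t)"
    using t by (subst (asm) ennreal_inj) auto
  have "AE \<omega> in M. \<omega> \<in> ?E \<longleftrightarrow> \<omega> \<in> space M - ?F"
    using AE_exit AE_space
  proof eventually_elim
    case (elim \<omega>)
    then obtain r where r: "exit_at r \<omega>" by blast
    hence uniq: "exit_at r' \<omega> \<longleftrightarrow> r' = r" for r' by (auto dest: exits_unique)
    \<comment> \<open>The maximum also runs over index 0, the functional over positive indices; the
      walk starts at 0 < \<open>t\<close>, so both give the same event.\<close>
    have "{0..r} = insert 0 {1..r}" by auto
    hence "(\<exists>k\<in>{0..r}. t < walk X k \<omega>) \<longleftrightarrow> (\<exists>k\<in>{1..r}. t < walk X k \<omega>)"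
      using t by (simp add: walk_def[of X 0])
    thus ?case using elim(2) by (auto simp: uniq not_le)
  qed
  hence "prob ?E = prob (space M - ?F)"
    by (rule measure_eq_AE) (use meas in auto)
  also have "\<dots> = 1 / (2 + t)"
    unfolding prob_compl[OF meas(2)] F using t by (simp add: field_simps)
  finally show ?thesis unfolding eq .
qed

end

section \<open>Death times of the branching process\<close>

lemma card_sorted_list_of_set_nth:
  fixes D :: "real set"
  assumes D: "finite D" and j: "j < card D"
  shows "card {x \<in> D. x \<le> sorted_list_of_set D ! j} = Suc j"
proof (rule antisym)
  let ?xs = "sorted_list_of_set D"
  show "Suc j \<le> card {x \<in> D. x \<le> ?xs ! j}"
    using sorted_list_of_set_nth_le_iff[OF D j, of "?xs ! j"] by simp
  show "card {x \<in> D. x \<le> ?xs ! j} \<le> Suc j"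
  proof (rule ccontr)
    assume "\<not> ?thesis"
    hence ge: "Suc (Suc j) \<le> card {x \<in> D. x \<le> ?xs ! j}" by simp
    also have "\<dots> \<le> card D" by (intro card_mono D) auto
    finally have "Suc j < card D" by simp
    hence "?xs ! Suc j \<le> ?xs ! j"
      using sorted_list_of_set_nth_le_iff[OF D, of "Suc j" "?xs ! j"] ge by simp
    moreover have "?xs ! j < ?xs ! Suc j"
      using sorted_wrt_nth_less[OF strict_sorted_list_of_set, of j "Suc j" D] \<open>Suc j < card D\<close> by simp
    ultimately show False by simp
  qed
qed

lemma death_time_eq:
  assumes D: "finite (deaths z)" and k: "k \<le> card (deaths z)"
  shows "death_time z k = (0 # sorted_list_of_set (deaths z)) ! k"
proof (cases k)
  case 0
  thus ?thesis by (simp add: death_time_def)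
next
  case (Suc j)
  let ?xs = "sorted_list_of_set (deaths z)"
  have j: "j < card (deaths z)" using k Suc by simp
  have "(THE t. t \<in> deaths z \<and> card {s \<in> deaths z. s \<le> t} = k) = ?xs ! j"
  proof (rule the_equality)
    have "?xs ! j \<in> set ?xs" using j by (intro nth_mem) simp
    thus "?xs ! j \<in> deaths z \<and> card {s \<in> deaths z. s \<le> ?xs ! j} = k"
      using D j Suc by (simp add: card_sorted_list_of_set_nth)
    fix t assume t: "t \<in> deaths z \<and> card {s \<in> deaths z. s \<le> t} = k"
    hence "t \<in> set ?xs" using D by simp
    then obtain i where i: "i < card (deaths z)" "t = ?xs ! i"
      by (auto simp: in_set_conv_nth)
    hence "Suc i = k" using t card_sorted_list_of_set_nth[OF D i(1)] by simp
    thus "t = ?xs ! j" using i Suc by simp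
  qed
  thus ?thesis using Suc by (simp add: death_time_def)
qed

section \<open>Lines of descent and the jumps of the population along a path\<close>

definition ancestors :: "label \<Rightarrow> label set" where
  "ancestors u = (\<lambda>j. (fst u, take j (snd u))) ` {..length (snd u)}"

lemma finite_ancestors: "finite (ancestors u)"
  by (simp add: ancestors_def)

lemma self_in_ancestors: "u \<in> ancestors u"
  by (auto simp: ancestors_def intro!: image_eqI[of _ _ "length (snd u)"])

lemma ancestors_antisym: "u \<in> ancestors v \<Longrightarrow> v \<in> ancestors u \<Longrightarrow> u = v"
proof -
  assume uv: "u \<in> ancestors v" "v \<in> ancestors u"
  from uv(1) obtain j where j: "fst u = fst v" "snd u = take j (snd v)"
    by (auto simp: ancestors_def)
  from uv(2) obtain k where k: "snd v = take k (snd u)"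
    by (auto simp: ancestors_def)
  have "length (snd v) \<le> length (snd u)"
    by (subst k) simp
  hence "snd u = snd v" using j(2) by simp
  thus "u = v" using j(1) by (simp add: prod_eq_iff)
qed

text \<open>An individual counts among its own ancestors, so the sum includes its own lifetime. In
  this form end times are linear in the independent lifetimes, with visible supports.\<close>

lemma end_eq_sum_ancestors: "birth_time L \<omega> u + L u \<omega> = (\<Sum>a\<in>ancestors u. L a \<omega>)"
proof (cases u)
  case (Pair i w)
  have "inj_on (\<lambda>j. (i, take j w)) {..length w}"
  proof (rule inj_onI)
    fix j k assume "j \<in> {..length w}" "k \<in> {..length w}" "(i, take j w) = (i, take k w)"
    hence "length (take j w) = length (take k w)" by simp
    thus "j = k" using \<open>j \<in> _\<close> \<open>k \<in> _\<close> by simp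
  qed
  hence "(\<Sum>a\<in>ancestors u. L a \<omega>) = (\<Sum>j\<in>{..length w}. L (i, take j w) \<omega>)"
    unfolding ancestors_def Pair by (simp add: sum.reindex)
  also have "\<dots> = (\<Sum>j<length w. L (i, take j w) \<omega>) + L (i, w) \<omega>"
    by (simp flip: lessThan_Suc_atMost)
  finally show ?thesis by (simp add: Pair)
qed

text \<open>Pathwise conditions, shown later to hold almost surely, under which the population jumps
  at finitely many times and at most one individual ends at each.\<close>

locale finite_genealogy =
  fixes Z0 :: "'b \<Rightarrow> nat" and L :: "label \<Rightarrow> 'b \<Rightarrow> real" and C :: "label \<Rightarrow> 'b \<Rightarrow> bool" and \<omega> :: 'b
  assumes finite_born: "finite {u. is_born Z0 C \<omega> u}"
    and L_pos: "\<And>u. 0 < L u \<omega>"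
    and ends_distinct: "\<And>u v. u \<noteq> v \<Longrightarrow> birth_time L \<omega> u + L u \<omega> \<noteq> birth_time L \<omega> v + L v \<omega>"
begin

abbreviation "born_set \<equiv> {u. is_born Z0 C \<omega> u}"
abbreviation "birth \<equiv> birth_time L \<omega>"
definition "end_of u = birth u + L u \<omega>"
abbreviation "z \<equiv> population Z0 L C \<omega>"

definition before :: "real \<Rightarrow> label set" where "before t = {u \<in> born_set. birth u < t \<and> t \<le> end_of u}"

lemma birth_nonneg: "0 \<le> birth u"
  using less_imp_le[OF L_pos] by (cases u) (auto intro!: sum_nonneg)

lemma end_of_pos: "0 < end_of u"
  using birth_nonneg[of u] L_pos[of u] by (simp add: end_of_def)

lemma birth_child: "birth (i, w @ [b]) = end_of (i, w)"
  by (simp add: end_of_def)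

lemma is_born_child: "is_born Z0 C \<omega> (i, w @ [b]) \<longleftrightarrow> is_born Z0 C \<omega> (i, w) \<and> C (i, w) \<omega>"
  by (auto simp: less_Suc_eq)

lemma population_eq: "z t = card {u \<in> born_set. birth u \<le> t \<and> t < end_of u}"
  by (simp add: population_def end_of_def)

text \<open>Just left of \<open>t\<close> the alive status of each individual is constant, and the
  finite number of born individuals makes this uniform.\<close>

lemma population_left_limit:
  "((\<lambda>s. real (z s)) \<longlongrightarrow> real (card (before t))) (at_left t)"
proof -
  have "\<forall>\<^sub>F s in at_left t. (birth u \<le> s \<and> s < end_of u) \<longleftrightarrow> (birth u < t \<and> t \<le> end_of u)" for u
  proof -
    have "\<forall>\<^sub>F s in at_left t. (birth u \<le> s \<longleftrightarrow> birth u < t)"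
    proof (cases "birth u < t")
      case True
      thus ?thesis using eventually_at_left_real[OF True] by (auto elim!: eventually_mono)
    next
      case False
      thus ?thesis by (auto simp: eventually_at_filter)
    qed
    moreover have "\<forall>\<^sub>F s in at_left t. (s < end_of u \<longleftrightarrow> t \<le> end_of u)"
    proof (cases "end_of u < t")
      case True
      thus ?thesis using eventually_at_left_real[OF True] by (auto elim!: eventually_mono)
    next
      case False
      thus ?thesis by (auto simp: eventually_at_filter)
    qed
    ultimately show ?thesis by eventually_elim auto
  qed
  hence "\<forall>\<^sub>F s in at_left t. \<forall>u\<in>born_set. (birth u \<le> s \<and> s < end_of u) \<longleftrightarrow> (birth u < t \<and> t \<le> end_of u)"
    using finite_born by (intro eventually_ball_finite) auto
  hence "\<forall>\<^sub>F s in at_left t. real (card (before t)) = real (z s)"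
    by (rule eventually_mono)
       (unfold population_eq before_def, intro arg_cong[where f="\<lambda>A. real (card A)"], blast)
  thus ?thesis by (rule Lim_transform_eventually[OF tendsto_const])
qed

text \<open>At \<open>t\<close> the individuals of \<open>E\<close> leave, and each of them whose
  coin is \<open>True\<close> is replaced by two children born exactly then.\<close>

lemma population_jump:
  assumes t: "0 < t"
  defines "E \<equiv> {u \<in> born_set. end_of u = t}"
  shows "real (z t) - real (card (before t)) = 2 * real (card {u \<in> E. C u \<omega>}) - real (card E)"
proof -
  let ?S = "{u \<in> born_set. birth u = t}"
  have lt: "birth u < end_of u" for u using L_pos by (simp add: end_of_def)
  have fin: "finite E" "finite ?S" "finite (before t)"
    using finite_born by (auto simp: E_def before_def)
  have E_sub: "E \<subseteq> before t" using lt by (auto simp: E_def before_def)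
  have split: "{u \<in> born_set. birth u \<le> t \<and> t < end_of u} = (before t - E) \<union> ?S"
    using lt by (auto simp: before_def E_def)
  have "z t = card (before t - E) + card ?S"
    unfolding population_eq split using fin by (intro card_Un_disjoint) (auto simp: before_def)
  moreover have "card (before t - E) = card (before t) - card E" "card E \<le> card (before t)"
    using fin E_sub by (auto simp: card_Diff_subset card_mono)
  moreover have "card ?S = 2 * card {u \<in> E. C u \<omega>}"
  proof -
    let ?child = "\<lambda>(u, b). (fst u, snd u @ [b]) :: label"
    have "?S = ?child ` ({u \<in> E. C u \<omega>} \<times> UNIV)"
    proof (intro equalityI subsetI)
      fix u assume u: "u \<in> ?S"
      obtain i w where iw: "u = (i, w)" by (cases u)
      \<comment> \<open>Initial individuals have birth time 0, whereas \<open>t\<close> is positive,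
        so a birth at \<open>t\<close> has a parent.\<close>
      have "w \<noteq> []" using u t by (auto simp: iw)
      then obtain v b where w: "w = v @ [b]" by (metis rev_exhaust)
      have "(i, v) \<in> {u \<in> E. C u \<omega>}"
        using u unfolding iw w E_def mem_Collect_eq is_born_child birth_child by simp
      thus "u \<in> ?child ` ({u \<in> E. C u \<omega>} \<times> UNIV)"
        by (intro image_eqI[of _ _ "((i, v), b)"]) (auto simp: iw w)
    next
      fix u assume "u \<in> ?child ` ({u \<in> E. C u \<omega>} \<times> UNIV)"
      then obtain i v b where u: "u = (i, v @ [b])" and v: "(i, v) \<in> {u \<in> E. C u \<omega>}" by auto
      show "u \<in> ?S"
        using v unfolding u E_def mem_Collect_eq is_born_child birth_child by simp
    qed
    moreover have "inj_on ?child ({u \<in> E. C u \<omega>} \<times> UNIV)"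
      by (auto simp: inj_on_def prod_eq_iff)
    ultimately show ?thesis by (simp add: card_image card_cartesian_product)
  qed
  ultimately show ?thesis by simp
qed

text \<open>As end times are distinct, at most one individual ends at a given time; the jump is then
  1 or -1 according to its coin, and 0 if nobody ends.\<close>

lemma deaths_population: "deaths z = end_of ` {u \<in> born_set. \<not> C u \<omega>}"
proof (intro set_eqI)
  fix t
  show "t \<in> deaths z \<longleftrightarrow> t \<in> end_of ` {u \<in> born_set. \<not> C u \<omega>}"
  proof (cases "0 < t")
    case False
    thus ?thesis using end_of_pos by (auto simp: deaths_def)
  next
    case True
    let ?E = "{u \<in> born_set. end_of u = t}"
    have "t \<in> deaths z \<longleftrightarrow> real (z t) - real (card (before t)) = -1"
      using True population_left_limit[of t] tendsto_unique[OF trivial_limit_at_left_real]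
      by (auto simp: deaths_def)
    also have "\<dots> \<longleftrightarrow> 2 * real (card {u \<in> ?E. C u \<omega>}) - real (card ?E) = -1"
      by (simp add: population_jump[OF True])
    also have "\<dots> \<longleftrightarrow> (\<exists>u\<in>?E. \<not> C u \<omega>)"
    proof (cases "?E = {}")
      case False
      then obtain u where u: "u \<in> ?E" by blast
      have "v = u" if "v \<in> ?E" for v
        using ends_distinct[of v u] u that unfolding end_of_def by blast
      hence "?E = {u}" using u by blast
      moreover from this have "{v \<in> ?E. C v \<omega>} = (if C u \<omega> then {u} else {})" by auto
      ultimately show ?thesis by simp
    next
      case True
      show ?thesis unfolding True by simp
    qed
    also have "\<dots> \<longleftrightarrow> t \<in> end_of ` {u \<in> born_set. \<not> C u \<omega>}" by blast
    finally show ?thesis .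
  qed
qed

lemma inj_end_of: "inj_on end_of A"
  using ends_distinct by (auto simp: inj_on_def end_of_def)

end

context critical_binary_branching
begin

lemma AE_lifetime_pos: "AE \<omega> in N. \<forall>u. 0 < L u \<omega>"
  unfolding AE_all_countable
proof
  fix u
  have "AE x in density lborel (exponential_density 2). 0 < x"
    using AE_lborel_singleton[of 0]
    by (subst AE_density) (auto simp: exponential_density_def elim!: eventually_mono)
  also have "density lborel (exponential_density 2) = distr N lborel (L u)"
    using distributed_distr_eq_density[OF lifetime[of u]] by simp
  finally show "AE \<omega> in N. 0 < L u \<omega>"
    by (subst (asm) AE_distr_iff) auto
qed

text \<open>For distinct labels one of them, say \<open>u\<close>, is no ancestor of the other. Its
  lifetime then occurs in only one of the two end times and is independent of the rest.\<close>

lemma AE_ends_distinct: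
  "AE \<omega> in N. \<forall>u v. u \<noteq> v \<longrightarrow> birth_time L \<omega> u + L u \<omega> \<noteq> birth_time L \<omega> v + L v \<omega>"
proof -
  have one_sided: "AE \<omega> in N. birth_time L \<omega> u + L u \<omega> \<noteq> birth_time L \<omega> v + L v \<omega>"
    if u: "u \<notin> ancestors v" for u v
  proof -
    let ?A = "Lifetime ` (ancestors u \<union> ancestors v - {u})"
    \<comment> \<open>The value that \<open>L u\<close> would have to take for the two end times to
      coincide; it involves no source belonging to \<open>u\<close>.\<close>
    let ?f = "\<lambda>x. (\<Sum>a\<in>ancestors v. x (Lifetime a)) - (\<Sum>a\<in>ancestors u - {u}. x (Lifetime a)) :: real"
    have "indep_var (PiM ?A (\<lambda>_. borel)) (\<lambda>\<omega>. restrict (\<lambda>s. src s \<omega>) ?A)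
        (PiM {Lifetime u} (\<lambda>_. borel)) (\<lambda>\<omega>. restrict (\<lambda>s. src s \<omega>) {Lifetime u})"
      by (rule indep_var_restrict[OF indep_src]) auto
    moreover have "?f \<in> borel_measurable (PiM ?A (\<lambda>_. borel))"
      using u by (intro borel_measurable_diff borel_measurable_sum measurable_component_singleton) auto
    moreover have "(\<lambda>x. x (Lifetime u)) \<in> borel_measurable (PiM {Lifetime u} (\<lambda>_. borel :: real measure))"
      by (rule measurable_component_singleton) simp
    ultimately have "indep_var borel (?f \<circ> (\<lambda>\<omega>. restrict (\<lambda>s. src s \<omega>) ?A))
        borel ((\<lambda>x. x (Lifetime u)) \<circ> (\<lambda>\<omega>. restrict (\<lambda>s. src s \<omega>) {Lifetime u}))"
      by (rule indep_var_compose)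
    also have "(\<lambda>x. x (Lifetime u)) \<circ> (\<lambda>\<omega>. restrict (\<lambda>s. src s \<omega>) {Lifetime u}) = L u"
      by (simp add: fun_eq_iff src_def)
    also have "?f \<circ> (\<lambda>\<omega>. restrict (\<lambda>s. src s \<omega>) ?A) =
        (\<lambda>\<omega>. (\<Sum>a\<in>ancestors v. L a \<omega>) - (\<Sum>a\<in>ancestors u - {u}. L a \<omega>))"
    proof
      fix \<omega>
      have "restrict (\<lambda>s. src s \<omega>) ?A (Lifetime a) = L a \<omega>" if "a \<in> ancestors u \<union> ancestors v - {u}" for a
        using that by (simp add: src_def)
      thus "(?f \<circ> (\<lambda>\<omega>. restrict (\<lambda>s. src s \<omega>) ?A)) \<omega> =
          (\<Sum>a\<in>ancestors v. L a \<omega>) - (\<Sum>a\<in>ancestors u - {u}. L a \<omega>)"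
        using u unfolding comp_def by (intro arg_cong2[where f="(-)"] sum.cong) auto
    qed
    finally show ?thesis
    proof (rule eventually_mono[OF AE_indep_var_neq[OF _ lifetime]])
      fix \<omega> assume "L u \<omega> \<noteq> (\<Sum>a\<in>ancestors v. L a \<omega>) - (\<Sum>a\<in>ancestors u - {u}. L a \<omega>)"
      moreover have "(\<Sum>a\<in>ancestors u. L a \<omega>) = L u \<omega> + (\<Sum>a\<in>ancestors u - {u}. L a \<omega>)"
        by (rule sum.remove[OF finite_ancestors self_in_ancestors])
      ultimately show "birth_time L \<omega> u + L u \<omega> \<noteq> birth_time L \<omega> v + L v \<omega>"
        unfolding end_eq_sum_ancestors by auto
    qed
  qed
  show ?thesis
    unfolding AE_all_countable
  proof (intro allI)
    fix u v
    show "AE \<omega> in N. u \<noteq> v \<longrightarrow> birth_time L \<omega> u + L u \<omega> \<noteq> birth_time L \<omega> v + L v \<omega>"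
    proof (cases "u \<notin> ancestors v")
      case True
      thus ?thesis using one_sided[of u v] by (auto elim: eventually_mono)
    next
      case False
      hence "v \<notin> ancestors u \<or> u = v" using ancestors_antisym by blast
      thus ?thesis using one_sided[of v u] by (auto elim: eventually_mono)
    qed
  qed
qed

lemma is_born_measurable [measurable]: "Measurable.pred N (\<lambda>\<omega>. is_born Z0 C \<omega> u)"
  by (cases u) simp

lemma end_measurable [measurable]: "(\<lambda>\<omega>. birth_time L \<omega> u + L u \<omega>) \<in> borel_measurable N"
  unfolding end_eq_sum_ancestors by measurable

lemmas finite_born_measurable = finite_set_measurable[where S="\<lambda>\<omega>. {u. is_born Z0 C \<omega> u}" and N=N, simplified mem_Collect_eq, OF is_born_measurable]

text \<open>Counts labels in place of jump times, which makes measurability accessible; for the two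
  choices of \<open>P\<close> used later it is the number of deaths up to \<open>T\<close> and the
  total number.\<close>

definition leaves_before :: "(real \<Rightarrow> bool) \<Rightarrow> 'b \<Rightarrow> nat" where
  "leaves_before P \<omega> = (if finite {u. is_born Z0 C \<omega> u}
     then card {u. is_born Z0 C \<omega> u \<and> \<not> C u \<omega> \<and> P (birth_time L \<omega> u + L u \<omega>)} else 0)"

lemma leaves_before_measurable:
  assumes [measurable]: "Measurable.pred borel P"
  shows "leaves_before P \<in> N \<rightarrow>\<^sub>M count_space UNIV"
proof -
  let ?B = "\<lambda>\<omega>. {u. is_born Z0 C \<omega> u}"
  define G where "G B \<omega> = (if finite B then \<Sum>u\<in>B. if \<not> C u \<omega> \<and> P (birth_time L \<omega> u + L u \<omega>) then 1 else 0 :: nat else 0)" for B \<omega>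
  have "(\<lambda>\<omega>. G (if finite (?B \<omega>) then ?B \<omega> else UNIV) \<omega>) \<in> N \<rightarrow>\<^sub>M count_space UNIV"
  proof (rule measurable_compose_countable'[OF _ finite_born_measurable(1)])
    show "G B \<in> N \<rightarrow>\<^sub>M count_space UNIV" for B
      unfolding G_def by measurable
    show "countable (insert UNIV {B :: label set. finite B})"
      using countable_finite_sets by auto
  qed
  also have "(\<lambda>\<omega>. G (if finite (?B \<omega>) then ?B \<omega> else UNIV) \<omega>) = leaves_before P"
  proof
    fix \<omega>
    have "infinite (UNIV :: label set)"
      using infinite_UNIV_listI[where 'a=bool] by (simp add: finite_prod)
    moreover have "{u \<in> ?B \<omega>. \<not> C u \<omega> \<and> P (birth_time L \<omega> u + L u \<omega>)} =
        {u. is_born Z0 C \<omega> u \<and> \<not> C u \<omega> \<and> P (birth_time L \<omega> u + L u \<omega>)}" by auto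
    ultimately show "G (if finite (?B \<omega>) then ?B \<omega> else UNIV) \<omega> = leaves_before P \<omega>"
      unfolding G_def leaves_before_def by (simp add: sum.If_cases Int_def)
  qed
  finally show ?thesis .
qed

context
  assumes Z0_law: "\<And>n. prob {\<omega> \<in> space N. Z0 \<omega> = n} = 1 / 2 ^ (n + 1)"
begin

text \<open>At \<phi> = 1 the forest functional is the indicator of a finite population history, and
  its mean is 1 / (2 - 1) = 1.\<close>

lemma AE_finite_born: "AE \<omega> in N. finite {u. is_born Z0 C \<omega> u}"
proof -
  note [measurable] = finite_born_measurable(2)
  have "(\<integral>\<^sup>+\<omega>. ennreal (forest_functional (\<lambda>_. 1) \<omega>) \<partial>N) = 1"
    using forest_functional_pgf[OF Z0_law regular_1] by (simp add: tree_pgf_1)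
  also have "(\<integral>\<^sup>+\<omega>. ennreal (forest_functional (\<lambda>_. 1) \<omega>) \<partial>N) =
      (\<integral>\<^sup>+\<omega>. indicator {\<omega> \<in> space N. finite {u. is_born Z0 C \<omega> u}} \<omega> \<partial>N)"
    by (intro nn_integral_cong) (auto simp: forest_functional_def indicator_def)
  also have "\<dots> = emeasure N {\<omega> \<in> space N. finite {u. is_born Z0 C \<omega> u}}"
    by (rule nn_integral_indicator) measurable
  finally have "prob {\<omega> \<in> space N. finite {u. is_born Z0 C \<omega> u}} = 1"
    by (simp add: emeasure_eq_measure)
  thus ?thesis by (subst (asm) prob_Collect_eq_1) auto
qed

lemma AE_finite_genealogy: "AE \<omega> in N. finite_genealogy Z0 L C \<omega>"
  using AE_finite_born AE_lifetime_pos AE_ends_distinct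
  by eventually_elim (unfold_locales, blast+)

abbreviation "death_set \<omega> \<equiv> deaths (population Z0 L C \<omega>)"

lemma leaves_before_eq:
  assumes "finite_genealogy Z0 L C \<omega>"
  shows "leaves_before P \<omega> = card {x \<in> death_set \<omega>. P x}" "finite (death_set \<omega>)"
proof -
  interpret finite_genealogy Z0 L C \<omega> by fact
  have "{x \<in> death_set \<omega>. P x} = end_of ` {u. is_born Z0 C \<omega> u \<and> \<not> C u \<omega> \<and> P (end_of u)}"
    unfolding deaths_population by auto
  hence "card {x \<in> death_set \<omega>. P x} = card {u. is_born Z0 C \<omega> u \<and> \<not> C u \<omega> \<and> P (end_of u)}"
    by (simp add: card_image inj_end_of)
  thus "leaves_before P \<omega> = card {x \<in> death_set \<omega>. P x}"
    using finite_born by (simp add: leaves_before_def end_of_def)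
  show "finite (death_set \<omega>)"
    unfolding deaths_population using finite_born by auto
qed

lemma ordered_points_deaths:
  "ordered_points N death_set (\<lambda>T. leaves_before (\<lambda>x. x \<le> T)) (leaves_before (\<lambda>_. True))
    (\<lambda>\<omega>. num_deaths (population Z0 L C \<omega>)) (\<lambda>k \<omega>. death_time (population Z0 L C \<omega>) k)"
proof
  show "leaves_before (\<lambda>x. x \<le> T) \<in> N \<rightarrow>\<^sub>M count_space UNIV" for T
    by (rule leaves_before_measurable) measurable
  show "leaves_before (\<lambda>_. True) \<in> N \<rightarrow>\<^sub>M count_space UNIV"
    by (rule leaves_before_measurable) measurable
  show "AE \<omega> in N. finite (death_set \<omega>)"
    using AE_finite_genealogy by eventually_elim (rule leaves_before_eq(2))
  show "AE \<omega> in N. \<forall>T. leaves_before (\<lambda>x. x \<le> T) \<omega> = card {x \<in> death_set \<omega>. x \<le> T}"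
    using AE_finite_genealogy by eventually_elim (simp add: leaves_before_eq(1))
  show "AE \<omega> in N. leaves_before (\<lambda>_. True) \<omega> = card (death_set \<omega>)"
    using AE_finite_genealogy by eventually_elim (simp add: leaves_before_eq(1))
  show "AE \<omega> in N. num_deaths (population Z0 L C \<omega>) = enat (card (death_set \<omega>))"
    using AE_finite_genealogy by eventually_elim (simp add: num_deaths_def leaves_before_eq(2))
  show "AE \<omega> in N. \<forall>k\<le>card (death_set \<omega>). death_time (population Z0 L C \<omega>) k =
      (0 # sorted_list_of_set (death_set \<omega>)) ! k"
    using AE_finite_genealogy by eventually_elim (simp add: death_time_eq leaves_before_eq(2))
qed

lemma deaths_pgf:
  assumes \<phi>: "regular \<phi>"
  shows "(\<integral>\<^sup>+\<omega>. ennreal (\<Prod>x\<in>death_set \<omega>. \<phi> x) \<partial>N) = ennreal (1 / (2 - tree_pgf \<phi> 0))"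
proof -
  have "AE \<omega> in N. ennreal (\<Prod>x\<in>death_set \<omega>. \<phi> x) = ennreal (forest_functional \<phi> \<omega>)"
    using AE_finite_genealogy
  proof eventually_elim
    case (elim \<omega>)
    interpret finite_genealogy Z0 L C \<omega> by fact
    have "(\<Prod>x\<in>death_set \<omega>. \<phi> x) = (\<Prod>u | is_born Z0 C \<omega> u \<and> \<not> C u \<omega>. \<phi> (end_of u))"
      unfolding deaths_population by (simp add: prod.reindex[OF inj_end_of])
    thus ?case
      using finite_born by (simp add: forest_functional_def end_of_def)
  qed
  thus ?thesis
    unfolding forest_functional_pgf[OF Z0_law \<phi>, symmetric] by (rule nn_integral_cong_AE)
qed

end
end

theorem theorem4p3:
  fixes M :: "'a measure" and X :: "nat \<Rightarrow> 'a \<Rightarrow> real"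
    and N :: "'b measure" and Z0 :: "'b \<Rightarrow> nat"
    and L :: "label \<Rightarrow> 'b \<Rightarrow> real" and C :: "label \<Rightarrow> 'b \<Rightarrow> bool"
  assumes "prob_space M"
    and "prob_space.indep_vars M (\<lambda>_. borel) X UNIV"
    and "\<And>i. distributed M lborel (X i) (\<lambda>x. ennreal (1 / 2 * exp (- \<bar>x\<bar>)))"
    and "critical_binary_branching N Z0 L C"
    and "\<And>n. measure N {\<omega> \<in> space N. Z0 \<omega> = n} = 1 / 2 ^ (n + 1)"
  shows "(AE \<omega> in M. \<exists>n. nu X \<omega> = enat n \<and> order_stat X 0 \<omega> = 0 \<and>
            (\<forall>k<n. order_stat X k \<omega> < order_stat X (Suc k) \<omega>)) \<and>
         same_finite_sequence_law
            M (nu X) (order_stat X)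
            N (\<lambda>\<omega>. num_deaths (population Z0 L C \<omega>))
              (\<lambda>k \<omega>. death_time (population Z0 L C \<omega>) k) \<and>
         (\<forall>t>0. measure M {\<omega> \<in> space M. nu X \<omega> < \<infinity> \<and>
                    order_stat X (the_enat (nu X \<omega>)) \<omega> > t} = 1 / (2 + t))"
proof -
  interpret W: laplace_walk M X
    using assms(1-3) by (simp add: laplace_walk_def laplace_walk_axioms_def)
  interpret B: critical_binary_branching N Z0 L C by fact
  have Z0: "\<And>n. B.prob {\<omega> \<in> space N. Z0 \<omega> = n} = 1 / 2 ^ (n + 1)" by fact
  have "same_finite_sequence_law M (nu X) (order_stat X)
      N (\<lambda>\<omega>. num_deaths (population Z0 L C \<omega>)) (\<lambda>k \<omega>. death_time (population Z0 L C \<omega>) k)"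
    \<comment> \<open>Both generating functionals have been computed as 1 / (2 - p) with the same
      \<open>p = tree_pgf \<phi> 0\<close>.\<close>
    by (rule same_finite_sequence_law_pgf[OF W.ordered_points_walk B.ordered_points_deaths[OF Z0]])
       (simp only: W.points_pgf B.deaths_pgf[OF Z0])
  thus ?thesis
    using W.order_stat_strict W.max_tail by blast
qed

end
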